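(* Let $n>1$ be an integer and let $A$ be a commutative ring whose underlying abelian group is finitely generated, with a maximal ideal $\mathfrak{m}$ containing $\nu(n)$. Then the reduction map $A\to A/\mathfrak{m}$ induces isomorphisms of $A$-modules $U^A_0(n)^{\wedge}_{\mathfrak{m}}\xrightarrow{\cong}U^{A/\mathfrak{m}}_0(n)$ and $U^A_1(n)^{\wedge}_{\mathfrak{m}}\xrightarrow{\cong}U^{A/\mathfrak{m}}_1(n)$, where $(-)^{\wedge}_{\mathfrak{m}}$ denotes $\mathfrak{m}$-adic completion.
   Context: $\nu(n)=p$ if $n>1$ is a power of the prime $p$, $\nu(n)=1$ otherwise. For a commutative ring $B$, let $F_n(B)$ be the $B/\nu(n)$-module generated by symbols $c_b$ ($b\in B$) subject to $c_{b+b'}=c_b+c_{b'}$. $U^B(n)_\bullet$ is the chain complex with $U^B(n)_0=B/\nu(n)$, $U^B(n)_m=F_n(B)^{\otimes_Bm}$ ($m\ge1$), differential $\delta(c_{b_1}\otimes\cdots\otimes c_{b_{m+1}})=b_1c_{b_2}\otimes\cdots\otimes c_{b_{m+1}}+\sum_{i=1}^m(-1)^ic_{b_1}\otimes\cdots\otimes c_{b_ib_{i+1}}\otimes\cdots\otimes c_{b_{m+1}}+(-1)^{m+1}b_{m+1}^nc_{b_1}\otimes\cdots\otimes c_{b_m}$ (so $\delta(c_b)=b-b^n$, $\delta(c_b\otimes c_{b'})=bc_{b'}-c_{bb'}+b'^nc_b$). $U^B_i(n)=H_i(U^B(n)_\bullet)$; it is natural in the ring $B$. *)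

theory Defs
  imports
    "HOL-Number_Theory.Prime_Powers"
    "HOL-Algebra.Ideal_Product"
    "HOL-Algebra.Module"
    "HOL-Algebra.QuotRing"
    "HOL-Algebra.Generated_Groups"
begin

section \<open>Modules in the style of HOL-Algebra\<close>

text \<open>
  The record type of modules extends that of rings.  For modules that carry no multiplication the
  fields \<open>mult\<close> and \<open>one\<close> are junk; they are irrelevant for the locale \<^locale>\<open>module\<close>.
\<close>

definition lin_hom ::
    "('r, 'x) ring_scheme \<Rightarrow> ('r, 'a, 'y) module_scheme \<Rightarrow> ('r, 'b, 'z) module_scheme \<Rightarrow> ('a \<Rightarrow> 'b) set"
  where "lin_hom R M N = {h \<in> carrier M \<rightarrow> carrier N.
    (\<forall>x\<in>carrier M. \<forall>y\<in>carrier M. h (x \<oplus>\<^bsub>M\<^esub> y) = h x \<oplus>\<^bsub>N\<^esub> h y) \<and>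
    (\<forall>r\<in>carrier R. \<forall>x\<in>carrier M. h (r \<odot>\<^bsub>M\<^esub> x) = r \<odot>\<^bsub>N\<^esub> h x)}"

definition lin_iso ::
    "('r, 'x) ring_scheme \<Rightarrow> ('r, 'a, 'y) module_scheme \<Rightarrow> ('r, 'b, 'z) module_scheme \<Rightarrow> ('a \<Rightarrow> 'b) set"
  where "lin_iso R M N = {h \<in> lin_hom R M N. bij_betw h (carrier M) (carrier N)}"

text \<open>
  The linear map \<open>M \<rightarrow> N\<close> prescribed by \<open>e i \<mapsto> g i\<close> for \<open>i \<in> I\<close>, where the \<open>e i\<close> generate \<open>M\<close>
  (so that there is at most one).  Restricting to \<^const>\<open>extensional\<close> functions fixes the values
  outside the carrier.
\<close>

definition lin_ext ::
    "('r, 'x) ring_scheme \<Rightarrow> ('r, 'a, 'y) module_scheme \<Rightarrow> ('r, 'b, 'z) module_scheme \<Rightarrow>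
      'i set \<Rightarrow> ('i \<Rightarrow> 'a) \<Rightarrow> ('i \<Rightarrow> 'b) \<Rightarrow> 'a \<Rightarrow> 'b"
  where "lin_ext R M N I e g =
    (THE h. h \<in> lin_hom R M N \<and> h \<in> extensional (carrier M) \<and> (\<forall>i\<in>I. h (e i) = g i))"

definition span_submodule :: "('r, 'x) ring_scheme \<Rightarrow> ('r, 'a, 'y) module_scheme \<Rightarrow> 'a set \<Rightarrow> 'a set"
  where "span_submodule R M Z = \<Inter>{N. submodule N R M \<and> Z \<subseteq> N}"

definition quot_module :: "('r, 'a, 'y) module_scheme \<Rightarrow> 'a set \<Rightarrow> ('r, 'a set) module"
  where "quot_module M N =
    \<lparr>carrier = a_rcosets\<^bsub>M\<^esub> N, mult = undefined, one = undefined, zero = N, add = set_add M,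
     smult = (\<lambda>r Z. \<Union>x\<in>Z. N +>\<^bsub>M\<^esub> (r \<odot>\<^bsub>M\<^esub> x))\<rparr>"

text \<open>
  For a map \<open>h : M \<rightarrow> M'\<close> that sends the submodule \<open>N\<close> into \<open>N'\<close>, the map \<open>M / N \<rightarrow> M' / N'\<close>;
  the source enters only through its cosets.
\<close>

definition quot_map ::
    "('r, 'b, 'y) module_scheme \<Rightarrow> 'b set \<Rightarrow> ('a \<Rightarrow> 'b) \<Rightarrow> 'a set \<Rightarrow> 'b set"
  where "quot_map M' N' h Z = the_elem ((\<lambda>x. N' +>\<^bsub>M'\<^esub> h x) ` Z)"

definition restrict_scalars :: "('r \<Rightarrow> 's) \<Rightarrow> ('s, 'a, 'y) module_scheme \<Rightarrow> ('r, 'a) module"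
  where "restrict_scalars f M =
    \<lparr>carrier = carrier M, mult = mult M, one = one M, zero = zero M, add = add M,
     smult = (\<lambda>r. smult M (f r))\<rparr>"

definition ring_as_module :: "('r, 'x) ring_scheme \<Rightarrow> ('r, 'r) module"
  where "ring_as_module R =
    \<lparr>carrier = carrier R, mult = mult R, one = one R, zero = zero R, add = add R,
     smult = mult R\<rparr>"

definition free_module :: "('r, 'x) ring_scheme \<Rightarrow> 's set \<Rightarrow> ('r, 's \<Rightarrow> 'r) module"
  where "free_module R S =
    \<lparr>carrier = {f. (\<forall>s\<in>S. f s \<in> carrier R) \<and> (\<forall>s. s \<notin> S \<longrightarrow> f s = \<zero>\<^bsub>R\<^esub>) \<and>
       finite {s. f s \<noteq> \<zero>\<^bsub>R\<^esub>}},
     mult = undefined, one = undefined, zero = (\<lambda>s. \<zero>\<^bsub>R\<^esub>),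
     add = (\<lambda>f g s. f s \<oplus>\<^bsub>R\<^esub> g s), smult = (\<lambda>r f s. r \<otimes>\<^bsub>R\<^esub> f s)\<rparr>"

definition free_gen :: "('r, 'x) ring_scheme \<Rightarrow> 's \<Rightarrow> 's \<Rightarrow> 'r"
  where "free_gen R s = (\<lambda>t. if t = s then \<one>\<^bsub>R\<^esub> else \<zero>\<^bsub>R\<^esub>)"


subsection \<open>Tensor powers\<close>

text \<open>
  The \<open>m\<close>-th tensor power of \<open>M\<close> over \<open>R\<close> is generated by the words of length \<open>m\<close> in \<open>M\<close>, subject to
  additivity and homogeneity in each of the \<open>m\<close> slots.
\<close>

definition tensor_words :: "('r, 'a, 'y) module_scheme \<Rightarrow> nat \<Rightarrow> 'a list set"
  where "tensor_words M m = {xs. length xs = m \<and> set xs \<subseteq> carrier M}"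

definition tensor_rels ::
    "('r, 'x) ring_scheme \<Rightarrow> ('r, 'a, 'y) module_scheme \<Rightarrow> nat \<Rightarrow> ('a list \<Rightarrow> 'r) set"
  where "tensor_rels R M m = (let F = free_module R (tensor_words M m); e = free_gen R in
    {e (xs[i := x \<oplus>\<^bsub>M\<^esub> y]) \<ominus>\<^bsub>F\<^esub> (e (xs[i := x]) \<oplus>\<^bsub>F\<^esub> e (xs[i := y])) | xs i x y.
       xs \<in> tensor_words M m \<and> i < m \<and> x \<in> carrier M \<and> y \<in> carrier M} \<union>
    {e (xs[i := r \<odot>\<^bsub>M\<^esub> x]) \<ominus>\<^bsub>F\<^esub> r \<odot>\<^bsub>F\<^esub> e (xs[i := x]) | xs i r x.
       xs \<in> tensor_words M m \<and> i < m \<and> r \<in> carrier R \<and> x \<in> carrier M})"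

definition tensor_ker ::
    "('r, 'x) ring_scheme \<Rightarrow> ('r, 'a, 'y) module_scheme \<Rightarrow> nat \<Rightarrow> ('a list \<Rightarrow> 'r) set"
  where "tensor_ker R M m =
    span_submodule R (free_module R (tensor_words M m)) (tensor_rels R M m)"

definition tensor_power ::
    "('r, 'x) ring_scheme \<Rightarrow> ('r, 'a, 'y) module_scheme \<Rightarrow> nat \<Rightarrow> ('r, ('a list \<Rightarrow> 'r) set) module"
  where "tensor_power R M m =
    quot_module (free_module R (tensor_words M m)) (tensor_ker R M m)"

definition pure_tensor ::
    "('r, 'x) ring_scheme \<Rightarrow> ('r, 'a, 'y) module_scheme \<Rightarrow> 'a list \<Rightarrow> ('a list \<Rightarrow> 'r) set"
  where "pure_tensor R M xs =
    tensor_ker R M (length xs) +>\<^bsub>free_module R (tensor_words M (length xs))\<^esub> free_gen R xs"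


subsection \<open>Adic completion\<close>

text \<open>\<open>I\<^sup>k M\<close>, where the power \<open>I\<^sup>k\<close> is taken in the monoid of ideals (so \<open>I\<^sup>0 = R\<close>).\<close>

definition adic_submodule ::
    "('r, 'x) ring_scheme \<Rightarrow> 'r set \<Rightarrow> ('r, 'a, 'y) module_scheme \<Rightarrow> nat \<Rightarrow> 'a set"
  where "adic_submodule R I M k =
    span_submodule R M {a \<odot>\<^bsub>M\<^esub> x | a x. a \<in> I [^]\<^bsub>ideals_set R\<^esub> k \<and> x \<in> carrier M}"

text \<open>
  The inverse limit of the modules \<open>M / I\<^sup>k M\<close>; the second condition says that the projection
  \<open>M / I\<^bsup>k+1\<^esup> M \<rightarrow> M / I\<^sup>k M\<close> maps \<open>Z (k + 1)\<close> to \<open>Z k\<close>.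
\<close>

definition adic_completion ::
    "('r, 'x) ring_scheme \<Rightarrow> 'r set \<Rightarrow> ('r, 'a, 'y) module_scheme \<Rightarrow> ('r, nat \<Rightarrow> 'a set) module"
  where "adic_completion R I M = (let Q = (\<lambda>k. quot_module M (adic_submodule R I M k)) in
    \<lparr>carrier = {Z. (\<forall>k. Z k \<in> carrier (Q k)) \<and>
       (\<forall>k. \<forall>x\<in>Z (Suc k). Z k = adic_submodule R I M k +>\<^bsub>M\<^esub> x)},
     mult = undefined, one = undefined, zero = (\<lambda>k. \<zero>\<^bsub>Q k\<^esub>),
     add = (\<lambda>Z Y k. Z k \<oplus>\<^bsub>Q k\<^esub> Y k), smult = (\<lambda>r Z k. r \<odot>\<^bsub>Q k\<^esub> Z k)\<rparr>)"

text \<open>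
  Let \<open>h : M \<rightarrow> N\<close> be linear and \<open>I N = 0\<close>.  Then \<open>N\<close> is its own \<open>I\<close>-adic completion and \<open>h\<close>
  vanishes on \<open>I M\<close>, so that the map from the completion of \<open>M\<close> to \<open>N\<close> induced by \<open>h\<close> is the
  projection to \<open>M / I M\<close>, that is \<open>Z \<mapsto> Z 1\<close>, followed by \<open>x + I M \<mapsto> h x\<close>.
\<close>

definition completion_map :: "('a \<Rightarrow> 'b) \<Rightarrow> (nat \<Rightarrow> 'a set) \<Rightarrow> 'b"
  where "completion_map h Z = the_elem (h ` Z 1)"


section \<open>The complex\<close>

definition nu :: "nat \<Rightarrow> nat"
  where "nu n = (if primepow n then aprimedivisor n else 1)"

definition nu_ideal :: "nat \<Rightarrow> ('a, 'x) ring_scheme \<Rightarrow> 'a set"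
  where "nu_ideal n B = PIdl\<^bsub>B\<^esub> ([nu n] \<cdot>\<^bsub>B\<^esub> \<one>\<^bsub>B\<^esub>)"

definition nu_quot :: "nat \<Rightarrow> ('a, 'x) ring_scheme \<Rightarrow> 'a set ring"
  where "nu_quot n B = B Quot nu_ideal n B"

definition nu_proj :: "nat \<Rightarrow> ('a, 'x) ring_scheme \<Rightarrow> 'a \<Rightarrow> 'a set"
  where "nu_proj n B b = nu_ideal n B +>\<^bsub>B\<^esub> b"

definition F_rels :: "nat \<Rightarrow> ('a, 'x) ring_scheme \<Rightarrow> ('a \<Rightarrow> 'a set) set"
  where "F_rels n B = (let F = free_module (nu_quot n B) (carrier B); e = free_gen (nu_quot n B) in
    {e (b \<oplus>\<^bsub>B\<^esub> b') \<ominus>\<^bsub>F\<^esub> (e b \<oplus>\<^bsub>F\<^esub> e b') | b b'. b \<in> carrier B \<and> b' \<in> carrier B})"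

definition F_ker :: "nat \<Rightarrow> ('a, 'x) ring_scheme \<Rightarrow> ('a \<Rightarrow> 'a set) set"
  where "F_ker n B =
    span_submodule (nu_quot n B) (free_module (nu_quot n B) (carrier B)) (F_rels n B)"

text \<open>\<open>F\<^sub>n(B)\<close>, generated by the symbols \<open>c_sym n B b\<close>, is a module over \<open>B/\<nu>(n)\<close>; it is viewed as a \<open>B\<close>-module to form its tensor powers.\<close>

definition F_module :: "nat \<Rightarrow> ('a, 'x) ring_scheme \<Rightarrow> ('a, ('a \<Rightarrow> 'a set) set) module"
  where "F_module n B = restrict_scalars (nu_proj n B)
    (quot_module (free_module (nu_quot n B) (carrier B)) (F_ker n B))"

definition c_sym :: "nat \<Rightarrow> ('a, 'x) ring_scheme \<Rightarrow> 'a \<Rightarrow> ('a \<Rightarrow> 'a set) set"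
  where "c_sym n B b =
    F_ker n B +>\<^bsub>free_module (nu_quot n B) (carrier B)\<^esub> free_gen (nu_quot n B) b"

text \<open>
  The module in degree zero and those in degrees \<open>m \<ge> 1\<close> have different types.  All of them
  are \<open>B\<close>-modules.
\<close>

definition U_zero :: "nat \<Rightarrow> ('a, 'x) ring_scheme \<Rightarrow> ('a, 'a set) module"
  where "U_zero n B = restrict_scalars (nu_proj n B) (ring_as_module (nu_quot n B))"

definition U_pos ::
    "nat \<Rightarrow> ('a, 'x) ring_scheme \<Rightarrow> nat \<Rightarrow> ('a, (('a \<Rightarrow> 'a set) set list \<Rightarrow> 'a) set) module"
  where "U_pos n B m = tensor_power B (F_module n B) m"

definition words :: "('a, 'x) ring_scheme \<Rightarrow> nat \<Rightarrow> 'a list set"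
  where "words B m = {bs. length bs = m \<and> set bs \<subseteq> carrier B}"

definition c_word ::
    "nat \<Rightarrow> ('a, 'x) ring_scheme \<Rightarrow> 'a list \<Rightarrow> (('a \<Rightarrow> 'a set) set list \<Rightarrow> 'a) set"
  where "c_word n B bs = pure_tensor B (F_module n B) (map (c_sym n B) bs)"

definition merge :: "('a, 'x) ring_scheme \<Rightarrow> nat \<Rightarrow> 'a list \<Rightarrow> 'a list"
    \<comment> \<open>\<open>[b\<^sub>1, \<dots>, b\<^sub>i b\<^bsub>i+1\<^esub>, \<dots>]\<close>; entries are numbered from one, so \<open>b\<^sub>i\<close> is \<open>bs ! (i - 1)\<close>\<close>
  where "merge B i bs = take (i - 1) bs @ [bs ! (i - 1) \<otimes>\<^bsub>B\<^esub> bs ! i] @ drop (i + 1) bs"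

definition sign :: "('a, 'x) ring_scheme \<Rightarrow> nat \<Rightarrow> 'a"
  where "sign B i = (\<ominus>\<^bsub>B\<^esub> \<one>\<^bsub>B\<^esub>) [^]\<^bsub>B\<^esub> i"

definition delta_zero ::
    "nat \<Rightarrow> ('a, 'x) ring_scheme \<Rightarrow> (('a \<Rightarrow> 'a set) set list \<Rightarrow> 'a) set \<Rightarrow> 'a set"
    \<comment> \<open>from degree \<open>1\<close> to degree \<open>0\<close>\<close>
  where "delta_zero n B = lin_ext B (U_pos n B 1) (U_zero n B) (words B 1) (c_word n B)
    (\<lambda>bs. nu_proj n B (bs ! 0 \<ominus>\<^bsub>B\<^esub> (bs ! 0) [^]\<^bsub>B\<^esub> n))"

definition delta_pos ::
    "nat \<Rightarrow> ('a, 'x) ring_scheme \<Rightarrow> nat \<Rightarrow>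
      (('a \<Rightarrow> 'a set) set list \<Rightarrow> 'a) set \<Rightarrow> (('a \<Rightarrow> 'a set) set list \<Rightarrow> 'a) set"
    \<comment> \<open>from degree \<open>m + 1\<close> to degree \<open>m\<close>, for \<open>m \<ge> 1\<close>\<close>
  where "delta_pos n B m = lin_ext B (U_pos n B (m + 1)) (U_pos n B m) (words B (m + 1)) (c_word n B)
    (\<lambda>bs. bs ! 0 \<odot>\<^bsub>U_pos n B m\<^esub> c_word n B (tl bs)
       \<oplus>\<^bsub>U_pos n B m\<^esub> (\<Oplus>\<^bsub>U_pos n B m\<^esub>i\<in>{1..m}. sign B i \<odot>\<^bsub>U_pos n B m\<^esub> c_word n B (merge B i bs))
       \<oplus>\<^bsub>U_pos n B m\<^esub> (sign B (m + 1) \<otimes>\<^bsub>B\<^esub> (bs ! m) [^]\<^bsub>B\<^esub> n) \<odot>\<^bsub>U_pos n B m\<^esub> c_word n B (butlast bs))"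


subsection \<open>Homology in degrees zero and one\<close>

definition boundaries_zero :: "nat \<Rightarrow> ('a, 'x) ring_scheme \<Rightarrow> 'a set set"
  where "boundaries_zero n B = delta_zero n B ` carrier (U_pos n B 1)"

definition boundaries_one ::
    "nat \<Rightarrow> ('a, 'x) ring_scheme \<Rightarrow> (('a \<Rightarrow> 'a set) set list \<Rightarrow> 'a) set set"
  where "boundaries_one n B = delta_pos n B 1 ` carrier (U_pos n B 2)"

definition cycles_one ::
    "nat \<Rightarrow> ('a, 'x) ring_scheme \<Rightarrow> ('a, (('a \<Rightarrow> 'a set) set list \<Rightarrow> 'a) set) module"
  where "cycles_one n B = (U_pos n B 1)
    \<lparr>carrier := {z \<in> carrier (U_pos n B 1). delta_zero n B z = \<zero>\<^bsub>U_zero n B\<^esub>}\<rparr>"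

definition H_zero :: "nat \<Rightarrow> ('a, 'x) ring_scheme \<Rightarrow> ('a, 'a set set) module"
  where "H_zero n B = quot_module (U_zero n B) (boundaries_zero n B)"

definition H_one ::
    "nat \<Rightarrow> ('a, 'x) ring_scheme \<Rightarrow> ('a, (('a \<Rightarrow> 'a set) set list \<Rightarrow> 'a) set set) module"
  where "H_one n B = quot_module (cycles_one n B) (boundaries_one n B)"


subsection \<open>Naturality in the ring\<close>

text \<open>The maps induced by a ring homomorphism \<open>f : B \<rightarrow> B'\<close>: \<open>c\<^sub>b \<mapsto> c\<^bsub>f b\<^esub>\<close> on the complex.\<close>

definition U_zero_map ::
    "nat \<Rightarrow> ('b, 'y) ring_scheme \<Rightarrow> ('a \<Rightarrow> 'b) \<Rightarrow> 'a set \<Rightarrow> 'b set"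
  where "U_zero_map n B' f Z = the_elem ((\<lambda>b. nu_proj n B' (f b)) ` Z)"

definition U_pos_map ::
    "nat \<Rightarrow> ('a, 'x) ring_scheme \<Rightarrow> ('b, 'y) ring_scheme \<Rightarrow> ('a \<Rightarrow> 'b) \<Rightarrow> nat \<Rightarrow>
      (('a \<Rightarrow> 'a set) set list \<Rightarrow> 'a) set \<Rightarrow> (('b \<Rightarrow> 'b set) set list \<Rightarrow> 'b) set"
  where "U_pos_map n B B' f m =
    lin_ext B (U_pos n B m) (restrict_scalars f (U_pos n B' m)) (words B m) (c_word n B)
      (\<lambda>bs. c_word n B' (map f bs))"

definition H_zero_map ::
    "nat \<Rightarrow> ('b, 'y) ring_scheme \<Rightarrow> ('a \<Rightarrow> 'b) \<Rightarrow> 'a set set \<Rightarrow> 'b set set"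
  where "H_zero_map n B' f = quot_map (U_zero n B') (boundaries_zero n B') (U_zero_map n B' f)"

definition H_one_map ::
    "nat \<Rightarrow> ('a, 'x) ring_scheme \<Rightarrow> ('b, 'y) ring_scheme \<Rightarrow> ('a \<Rightarrow> 'b) \<Rightarrow>
      (('a \<Rightarrow> 'a set) set list \<Rightarrow> 'a) set set \<Rightarrow> (('b \<Rightarrow> 'b set) set list \<Rightarrow> 'b) set set"
  where "H_one_map n B B' f =
    quot_map (cycles_one n B') (boundaries_one n B') (U_pos_map n B B' f 1)"

end

(* Since nu(n) lies in a proper ideal, n is a power of a prime p = nu(n), and U(n) is the Hochschild complex of A/p
   with coefficients twisted by the n-th power Frobenius on one side.

   H_0 is the quotient of A/p by the ideal generated by all b - b^n, so a and a^n act on it in the same way.  Hence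
   m^k H_0 = m H_0 for all k >= 1, and the completion of H_0 is H_0 / m H_0 = H_0(A/m).

   H_1 vanishes for every ring B with B/p finite, in particular for A and for A/m.  Let d be the universal twisted
   derivation, d(ab) = a db + b^n da, and let z be a cycle.  The identity a db = d(ab - a b^n) + a^n d(b^n) shows that
   the Frobenius fixes z, so z is a combination of elements dt with t = b^(n^i) for i arbitrarily large, and such t
   satisfy t^(n^N) = t modulo p because B/p is finite.  Then dt = d(t^(n^N)) is a multiple of (t - t^n) dt.  But
   (t - t^n) db = (b - b^n) dt shows that t - t^n kills all cycles, so that z = 0. *)

theory Submission
  imports Defs
begin

section \<open>Quotients, spans and linear maps\<close>

text \<open>The differentials and induced maps are definite descriptions over presented modules, so
  they mean something only once a linear map with the prescribed values has been produced. Hence the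
  universal properties of free modules, of \<open>F_module\<close> and of tensor powers; degree two
  is reached by currying. In the identity that gives the Frobenius step, ab - a b^n is a lift to the
  ring of the boundary of a db. For a cycle these lifts add up to a multiple of p, where d vanishes,
  and only the Frobenius terms remain. The relation between db and dt expands d(tb) = d(bt) in two
  ways. In d(t^(n^N)) the leading coefficient n^N is divisible by p, and t^n may be replaced by t up
  to multiples of t - t^n. The multiplier that fixes dt depends on t. For sums of generators,
  multipliers v and w are merged into v + w - vw, which fixes whatever v or w fixes. High powers t
  are taken because Frobenius need not be injective on a finite B/p with nilpotents, so b itself
  need not be periodic.\<close>

lemma lin_homI:
  assumes "\<And>x. x \<in> carrier M \<Longrightarrow> h x \<in> carrier N"
    and "\<And>x y. x \<in> carrier M \<Longrightarrow> y \<in> carrier M \<Longrightarrow> h (x \<oplus>\<^bsub>M\<^esub> y) = h x \<oplus>\<^bsub>N\<^esub> h y"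
    and "\<And>r x. r \<in> carrier R \<Longrightarrow> x \<in> carrier M \<Longrightarrow> h (r \<odot>\<^bsub>M\<^esub> x) = r \<odot>\<^bsub>N\<^esub> h x"
  shows "h \<in> lin_hom R M N"
  using assms by (auto simp: lin_hom_def)

lemma lin_homD:
  assumes "h \<in> lin_hom R M N"
  shows lin_hom_closed: "x \<in> carrier M \<Longrightarrow> h x \<in> carrier N"
    and lin_hom_add: "x \<in> carrier M \<Longrightarrow> y \<in> carrier M \<Longrightarrow> h (x \<oplus>\<^bsub>M\<^esub> y) = h x \<oplus>\<^bsub>N\<^esub> h y"
    and lin_hom_smult: "r \<in> carrier R \<Longrightarrow> x \<in> carrier M \<Longrightarrow> h (r \<odot>\<^bsub>M\<^esub> x) = r \<odot>\<^bsub>N\<^esub> h x"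
  using assms by (auto simp: lin_hom_def)

lemma lin_hom_comp:
  assumes "h \<in> lin_hom R M N" "g \<in> lin_hom R N P"
  shows "(\<lambda>x. g (h x)) \<in> lin_hom R M P"
  by (rule lin_homI) (simp_all add: lin_homD[OF assms(1)] lin_homD[OF assms(2)])

lemma lin_hom_zero:
  assumes M: "module R M" and N: "module R N" and h: "h \<in> lin_hom R M N"
  shows "h \<zero>\<^bsub>M\<^esub> = \<zero>\<^bsub>N\<^esub>"
proof -
  interpret M: module R M by fact
  interpret N: module R N by fact
  have "h \<zero>\<^bsub>M\<^esub> = h (\<zero>\<^bsub>R\<^esub> \<odot>\<^bsub>M\<^esub> \<zero>\<^bsub>M\<^esub>)" by simp
  also have "\<dots> = \<zero>\<^bsub>R\<^esub> \<odot>\<^bsub>N\<^esub> h \<zero>\<^bsub>M\<^esub>" by (rule lin_hom_smult[OF h]) auto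
  also have "\<dots> = \<zero>\<^bsub>N\<^esub>" by (simp add: lin_hom_closed[OF h])
  finally show ?thesis .
qed

lemma lin_hom_neg:
  assumes M: "module R M" and N: "module R N" and h: "h \<in> lin_hom R M N" and x: "x \<in> carrier M"
  shows "h (\<ominus>\<^bsub>M\<^esub> x) = \<ominus>\<^bsub>N\<^esub> h x"
proof -
  interpret M: module R M by fact
  interpret N: module R N by fact
  have "h (\<ominus>\<^bsub>M\<^esub> x) \<oplus>\<^bsub>N\<^esub> h x = h (\<ominus>\<^bsub>M\<^esub> x \<oplus>\<^bsub>M\<^esub> x)" using x by (simp add: lin_hom_add[OF h])
  also have "\<dots> = \<zero>\<^bsub>N\<^esub>" using x by (simp add: M.M.l_neg lin_hom_zero[OF M N h])
  finally show ?thesis using x lin_hom_closed[OF h]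
    by (simp add: N.M.minus_equality)
qed

lemma lin_hom_minus:
  assumes M: "module R M" and N: "module R N" and h: "h \<in> lin_hom R M N"
    and "x \<in> carrier M" "y \<in> carrier M"
  shows "h (x \<ominus>\<^bsub>M\<^esub> y) = h x \<ominus>\<^bsub>N\<^esub> h y"
proof -
  interpret M: module R M by fact
  interpret N: module R N by fact
  show ?thesis using assms by (simp add: a_minus_def lin_hom_add[OF h] lin_hom_neg[OF M N h])
qed

context module
begin

lemma minus_eq_smult: "x \<in> carrier M \<Longrightarrow> \<ominus>\<^bsub>M\<^esub> x = (\<ominus> \<one>) \<odot>\<^bsub>M\<^esub> x"
  by (simp add: smult_l_minus)

text \<open>Closure under negation is automatic, being the action of the scalar -1.\<close>

lemma submoduleI2:
  assumes "H \<subseteq> carrier M" "\<zero>\<^bsub>M\<^esub> \<in> H"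
    "\<And>a b. a \<in> H \<Longrightarrow> b \<in> H \<Longrightarrow> a \<oplus>\<^bsub>M\<^esub> b \<in> H"
    "\<And>a x. a \<in> carrier R \<Longrightarrow> x \<in> H \<Longrightarrow> a \<odot>\<^bsub>M\<^esub> x \<in> H"
  shows "submodule H R M"
  using assms by (intro submoduleI) (auto simp: minus_eq_smult subset_iff)

lemma submodule_zero: "submodule H R M \<Longrightarrow> \<zero>\<^bsub>M\<^esub> \<in> H"
  using subgroup.one_closed[OF submodule.axioms(1)] by fastforce

lemma minus_eq_zeroD:
  assumes "x \<in> carrier M" "y \<in> carrier M" "x \<ominus>\<^bsub>M\<^esub> y = \<zero>\<^bsub>M\<^esub>"
  shows "x = y"
  using assms M.minus_equality[of x "\<ominus>\<^bsub>M\<^esub> y"] by (simp add: a_minus_def)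

lemma preimage_submodule:
  assumes N: "module R N" and h: "h \<in> lin_hom R M N" and H: "submodule H R N"
  shows "submodule {x \<in> carrier M. h x \<in> H} R M"
proof -
  interpret N: module R N by fact
  show ?thesis
    by (rule submoduleI2)
      (auto simp: lin_hom_zero[OF module_axioms N h] N.submodule_zero[OF H] lin_hom_add[OF h]
        lin_hom_smult[OF h] N.submoduleE[OF H])
qed

lemma zero_submodule: "submodule {\<zero>\<^bsub>M\<^esub>} R M"
  by (rule submoduleI2) auto

lemma image_submodule:
  assumes N: "module R N" and h: "h \<in> lin_hom R M N"
  shows "submodule (h ` carrier M) R N"
proof -
  interpret N: module R N by fact
  show ?thesis
  proof (rule N.submoduleI2)
    show "h ` carrier M \<subseteq> carrier N" using lin_hom_closed[OF h] by auto
    show "\<zero>\<^bsub>N\<^esub> \<in> h ` carrier M"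
      by (rule image_eqI[of _ _ "\<zero>\<^bsub>M\<^esub>"]) (simp_all add: lin_hom_zero[OF module_axioms N h])
    show "a \<oplus>\<^bsub>N\<^esub> b \<in> h ` carrier M" if ab: "a \<in> h ` carrier M" "b \<in> h ` carrier M" for a b
    proof -
      obtain x y where "x \<in> carrier M" "y \<in> carrier M" "a = h x" "b = h y" using ab by auto
      then show ?thesis
        by (intro image_eqI[of _ _ "x \<oplus>\<^bsub>M\<^esub> y"]) (simp_all add: lin_hom_add[OF h])
    qed
    show "r \<odot>\<^bsub>N\<^esub> a \<in> h ` carrier M" if ra: "r \<in> carrier R" "a \<in> h ` carrier M" for r a
    proof -
      obtain x where "x \<in> carrier M" "a = h x" using ra by auto
      then show ?thesis using ra
        by (intro image_eqI[of _ _ "r \<odot>\<^bsub>M\<^esub> x"]) (simp_all add: lin_hom_smult[OF h])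
    qed
  qed
qed

lemma span_submodule: 
  assumes "Z \<subseteq> carrier M"
  shows "submodule (span_submodule R M Z) R M"
proof (rule submoduleI2)
  show "span_submodule R M Z \<subseteq> carrier M"
    using assms carrier_is_submodule by (auto simp: span_submodule_def)
qed (auto simp: span_submodule_def submodule_zero submoduleE)

lemma span_incl: "Z \<subseteq> span_submodule R M Z"
  by (auto simp: span_submodule_def)

lemma span_least: "submodule N R M \<Longrightarrow> Z \<subseteq> N \<Longrightarrow> span_submodule R M Z \<subseteq> N"
  by (auto simp: span_submodule_def)

text \<open>The closure cases are bundled into one submodule hypothesis, so that a preimage, a
  kernel or an equalizer can be supplied as a whole.\<close>

lemma span_carrier_induct:
  assumes "span_submodule R M Z = carrier M" "submodule {x \<in> carrier M. P x} R M"
    "\<And>z. z \<in> Z \<Longrightarrow> z \<in> carrier M \<and> P z" "x \<in> carrier M"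
  shows "P x"
proof -
  have "span_submodule R M Z \<subseteq> {x \<in> carrier M. P x}"
    by (rule span_least[OF assms(2)]) (use assms(3) in auto)
  then show ?thesis using assms by auto
qed

lemma equalizer_submodule:
  assumes N: "module R N" and g: "g \<in> lin_hom R M N" and h: "h \<in> lin_hom R M N"
  shows "submodule {x \<in> carrier M. g x = h x} R M"
  by (rule submoduleI2)
    (auto simp: lin_hom_zero[OF module_axioms N h] lin_hom_zero[OF module_axioms N g]
      lin_hom_add[OF h] lin_hom_smult[OF h] lin_hom_add[OF g] lin_hom_smult[OF g])

lemma lin_hom_eqI:
  assumes N: "module R N" and g: "g \<in> lin_hom R M N" and h: "h \<in> lin_hom R M N"
    and span: "span_submodule R M (e ` I) = carrier M" and e: "\<And>i. i \<in> I \<Longrightarrow> e i \<in> carrier M"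
    and eq: "\<And>i. i \<in> I \<Longrightarrow> g (e i) = h (e i)" and x: "x \<in> carrier M"
  shows "g x = h x"
  by (rule span_carrier_induct[OF span equalizer_submodule[OF N g h] _ x])
    (use e eq in auto)

text \<open>A definite description has its intended value only if a solution exists. The witness
  \<open>h\<close> provides existence and the spanning hypothesis uniqueness; each differential
  below is unlocked by constructing such an \<open>h\<close>.\<close>

lemma lin_ext:
  assumes N: "module R N" and h: "h \<in> lin_hom R M N"
    and span: "span_submodule R M (e ` I) = carrier M" and e: "\<And>i. i \<in> I \<Longrightarrow> e i \<in> carrier M"
    and eq: "\<And>i. i \<in> I \<Longrightarrow> h (e i) = g i"
  shows "lin_ext R M N I e g \<in> lin_hom R M N" "\<And>i. i \<in> I \<Longrightarrow> lin_ext R M N I e g (e i) = g i"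
proof -
  have "\<exists>!h. h \<in> lin_hom R M N \<and> h \<in> extensional (carrier M) \<and> (\<forall>i\<in>I. h (e i) = g i)"
  \<comment> \<open>Spanning determines a linear map only on the carrier; cutting \<open>h\<close>
    down to an extensional function fixes the remaining values.\<close>
  proof (intro ex1I[of _ "restrict h (carrier M)"] conjI ballI)
    show "restrict h (carrier M) \<in> lin_hom R M N"
      using h by (auto simp: lin_hom_def)
    show "k = restrict h (carrier M)" if k: "k \<in> lin_hom R M N \<and> k \<in> extensional (carrier M) \<and> (\<forall>i\<in>I. k (e i) = g i)" for k
    proof
      fix x show "k x = restrict h (carrier M) x"
        using lin_hom_eqI[OF N _ h span e, of k x] k eq 
        by (cases "x \<in> carrier M") (auto simp: extensional_def)
    qed
  qed (use e eq in auto)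
  from theI'[OF this, folded lin_ext_def]
  show "lin_ext R M N I e g \<in> lin_hom R M N" "\<And>i. i \<in> I \<Longrightarrow> lin_ext R M N I e g (e i) = g i"
    by auto
qed

section \<open>Cosets and quotient modules\<close>

lemma submodule_abelian_subgroup: "submodule N R M \<Longrightarrow> abelian_subgroup N M"
  by (intro abelian_subgroupI3 additive_subgroupI submodule.axioms(1) M.abelian_group_axioms)

context
  fixes N assumes N: "submodule N R M"
begin

interpretation N: abelian_subgroup N M by (rule submodule_abelian_subgroup[OF N])

lemma coset_eq_iff:
  assumes "x \<in> carrier M" "y \<in> carrier M"
  shows "N +>\<^bsub>M\<^esub> x = N +>\<^bsub>M\<^esub> y \<longleftrightarrow> x \<ominus>\<^bsub>M\<^esub> y \<in> N"
  using N.a_rcos_module[OF assms(2,1)] N.a_rcos_self[OF assms(1)]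
    N.a_repr_independence'[of x y] assms(2)
  by (auto simp: a_minus_def)

lemma coset_memD:
  assumes "z \<in> N +>\<^bsub>M\<^esub> x" "x \<in> carrier M"
  shows "z \<in> carrier M" "N +>\<^bsub>M\<^esub> z = N +>\<^bsub>M\<^esub> x"
  using assms N.a_elemrcos_carrier N.a_repr_independence' by auto

lemma coset_zero_iff:
  assumes "x \<in> carrier M"
  shows "N +>\<^bsub>M\<^esub> x = N \<longleftrightarrow> x \<in> N"
  using assms N.a_rcos_const N.a_rcos_self by blast

lemma quot_carrier: "carrier (quot_module M N) = (\<lambda>x. N +>\<^bsub>M\<^esub> x) ` carrier M"
  by (auto simp: quot_module_def A_RCOSETS_def')

lemma quot_zero: "\<zero>\<^bsub>quot_module M N\<^esub> = N"
  by (simp add: quot_module_def)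

lemma quot_add:
  "x \<in> carrier M \<Longrightarrow> y \<in> carrier M \<Longrightarrow>
    (N +>\<^bsub>M\<^esub> x) \<oplus>\<^bsub>quot_module M N\<^esub> (N +>\<^bsub>M\<^esub> y) = N +>\<^bsub>M\<^esub> (x \<oplus>\<^bsub>M\<^esub> y)"
  by (simp add: quot_module_def N.a_rcos_sum)

text \<open>The action on a coset is defined as a union over all representatives; it collapses
  because every representative gives the same coset.\<close>

lemma quot_smult:
  assumes "r \<in> carrier R" "x \<in> carrier M"
  shows "r \<odot>\<^bsub>quot_module M N\<^esub> (N +>\<^bsub>M\<^esub> x) = N +>\<^bsub>M\<^esub> (r \<odot>\<^bsub>M\<^esub> x)"
proof -
  have eq: "N +>\<^bsub>M\<^esub> (r \<odot>\<^bsub>M\<^esub> z) = N +>\<^bsub>M\<^esub> (r \<odot>\<^bsub>M\<^esub> x)" if z: "z \<in> N +>\<^bsub>M\<^esub> x" for z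
  proof -
    have zc: "z \<in> carrier M" "z \<ominus>\<^bsub>M\<^esub> x \<in> N"
      using coset_memD[OF z assms(2)] coset_eq_iff assms by auto
    then have "r \<odot>\<^bsub>M\<^esub> (z \<ominus>\<^bsub>M\<^esub> x) \<in> N" using assms submoduleE(4)[OF N] by blast
    moreover have "r \<odot>\<^bsub>M\<^esub> (z \<ominus>\<^bsub>M\<^esub> x) = r \<odot>\<^bsub>M\<^esub> z \<ominus>\<^bsub>M\<^esub> r \<odot>\<^bsub>M\<^esub> x"
      using zc assms by (simp add: a_minus_def smult_r_distr smult_r_minus)
    ultimately show ?thesis using zc assms by (simp add: coset_eq_iff)
  qed
  have "(\<Union>z\<in>N +>\<^bsub>M\<^esub> x. N +>\<^bsub>M\<^esub> (r \<odot>\<^bsub>M\<^esub> z)) = N +>\<^bsub>M\<^esub> (r \<odot>\<^bsub>M\<^esub> x)"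
    by (rule SUP_eq_const[OF _ eq]) (use N.a_rcos_self[OF assms(2)] in blast)
  then show ?thesis by (simp add: quot_module_def)
qed

lemma quot_module: "module R (quot_module M N)"
proof (rule moduleI)
  show "cring R" by (rule R.is_cring)
  have c: "N +>\<^bsub>M\<^esub> \<zero>\<^bsub>M\<^esub> = N" using coset_zero_iff submodule_zero[OF N] by simp
  show "abelian_group (quot_module M N)"
  proof (rule abelian_groupI)
    show "\<exists>y\<in>carrier (quot_module M N). y \<oplus>\<^bsub>quot_module M N\<^esub> x = \<zero>\<^bsub>quot_module M N\<^esub>"
      if x: "x \<in> carrier (quot_module M N)" for x
    proof -
      obtain z where z: "z \<in> carrier M" "x = N +>\<^bsub>M\<^esub> z" using x by (auto simp: quot_carrier)
      show ?thesis by (rule bexI[of _ "N +>\<^bsub>M\<^esub> (\<ominus>\<^bsub>M\<^esub> z)"])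
          (use z in \<open>auto simp: quot_carrier quot_add quot_zero M.l_neg c\<close>)
    qed
    show "\<zero>\<^bsub>quot_module M N\<^esub> \<in> carrier (quot_module M N)"
      using c by (auto simp: quot_zero quot_carrier intro: image_eqI[of _ _ "\<zero>\<^bsub>M\<^esub>"])
    show "\<zero>\<^bsub>quot_module M N\<^esub> \<oplus>\<^bsub>quot_module M N\<^esub> x = x" if x: "x \<in> carrier (quot_module M N)" for x
    proof -
      obtain z where z: "z \<in> carrier M" "x = N +>\<^bsub>M\<^esub> z" using x by (auto simp: quot_carrier)
      have "N \<oplus>\<^bsub>quot_module M N\<^esub> x = (N +>\<^bsub>M\<^esub> \<zero>\<^bsub>M\<^esub>) \<oplus>\<^bsub>quot_module M N\<^esub> x" by (simp add: c)
      also have "\<dots> = x" using z by (simp only: quot_add M.zero_closed M.l_zero)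
      finally show ?thesis by (simp add: quot_zero)
    qed
  qed (auto simp: quot_carrier quot_add M.a_ac)
qed (simp_all add: quot_carrier, (elim imageE, simp add: quot_add quot_smult smult_l_distr smult_r_distr smult_assoc1)+)

lemma quot_proj_hom: "(\<lambda>x. N +>\<^bsub>M\<^esub> x) \<in> lin_hom R M (quot_module M N)"
  by (rule lin_homI) (auto simp: quot_carrier quot_add quot_smult)

text \<open>A map that vanishes on N is constant on cosets, so the image of a coset is a singleton
  and \<open>the_elem\<close> reads off its only value. All maps out of quotients are handled in
  this way.\<close>

lemma the_elem_coset:
  assumes P: "module R P" and h: "h \<in> lin_hom R M P" and z: "\<And>y. y \<in> N \<Longrightarrow> h y = \<zero>\<^bsub>P\<^esub>"
    and x: "x \<in> carrier M"
  shows "the_elem (h ` (N +>\<^bsub>M\<^esub> x)) = h x"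
proof -
  interpret P: module R P by fact
  have eq: "h y = h x" if y: "y \<in> N +>\<^bsub>M\<^esub> x" for y
  proof -
    have yc: "y \<in> carrier M" "y \<ominus>\<^bsub>M\<^esub> x \<in> N"
      using coset_memD[OF y x] coset_eq_iff x by auto
    then have "h y \<ominus>\<^bsub>P\<^esub> h x = \<zero>\<^bsub>P\<^esub>"
      using z x by (simp add: lin_hom_minus[OF module_axioms P h, symmetric])
    then show ?thesis using yc x lin_hom_closed[OF h] by (blast intro: P.minus_eq_zeroD)
  qed
  have "h ` (N +>\<^bsub>M\<^esub> x) = {h x}" using N.a_rcos_self[OF x] eq by blast
  then show ?thesis by simp
qed

lemma quot_lift_hom:
  assumes P: "module R P" and h: "h \<in> lin_hom R M P" and z: "\<And>y. y \<in> N \<Longrightarrow> h y = \<zero>\<^bsub>P\<^esub>"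
  shows "(\<lambda>Z. the_elem (h ` Z)) \<in> lin_hom R (quot_module M N) P"
  by (rule lin_homI)
    (auto simp: quot_carrier quot_add quot_smult the_elem_coset[OF P h z]
      lin_hom_closed[OF h] lin_hom_add[OF h] lin_hom_smult[OF h])

end

end

lemma quot_map:
  assumes M: "module R M" and M': "module R M'" and N: "submodule N R M" and N': "submodule N' R M'"
    and h: "h \<in> lin_hom R M M'" and hN: "\<And>y. y \<in> N \<Longrightarrow> h y \<in> N'"
  shows "quot_map M' N' h \<in> lin_hom R (quot_module M N) (quot_module M' N')"
    and "x \<in> carrier M \<Longrightarrow> quot_map M' N' h (N +>\<^bsub>M\<^esub> x) = N' +>\<^bsub>M'\<^esub> h x"
proof -
  interpret M: module R M by fact
  interpret M': module R M' by fact
  have h': "(\<lambda>x. N' +>\<^bsub>M'\<^esub> h x) \<in> lin_hom R M (quot_module M' N')"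
    by (rule lin_hom_comp[OF h M'.quot_proj_hom[OF N']])
  have z: "N' +>\<^bsub>M'\<^esub> h y = \<zero>\<^bsub>quot_module M' N'\<^esub>" if "y \<in> N" for y
    using hN[OF that] M'.submoduleE(1)[OF N'] M'.coset_zero_iff[OF N', of "h y"]
    by (simp add: M'.quot_zero[OF N'] subset_iff)
  show "quot_map M' N' h \<in> lin_hom R (quot_module M N) (quot_module M' N')"
    using M.quot_lift_hom[OF N M'.quot_module[OF N'] h' z] by (simp add: quot_map_def[abs_def])
  show "x \<in> carrier M \<Longrightarrow> quot_map M' N' h (N +>\<^bsub>M\<^esub> x) = N' +>\<^bsub>M'\<^esub> h x"
    using M.the_elem_coset[OF N M'.quot_module[OF N'] h' z] by (simp add: quot_map_def)
qed

section \<open>Change of scalars\<close>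

lemma restrict_scalars_sel [simp]:
  "carrier (restrict_scalars f M) = carrier M" "\<zero>\<^bsub>restrict_scalars f M\<^esub> = \<zero>\<^bsub>M\<^esub>"
  "x \<oplus>\<^bsub>restrict_scalars f M\<^esub> y = x \<oplus>\<^bsub>M\<^esub> y" "r \<odot>\<^bsub>restrict_scalars f M\<^esub> x = f r \<odot>\<^bsub>M\<^esub> x"
  by (simp_all add: restrict_scalars_def)

lemma a_r_coset_restrict_scalars [simp]: "N +>\<^bsub>restrict_scalars f M\<^esub> x = N +>\<^bsub>M\<^esub> x"
  by (simp add: a_r_coset_def')

text \<open>An equality of records, not merely an isomorphism: \<open>quot_map\<close> yields a map
  into a quotient of restricted modules, while the final statement restricts the quotient.\<close>

lemma quot_module_restrict_scalars:
  "quot_module (restrict_scalars f M) N = restrict_scalars f (quot_module M N)"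
  by (simp add: quot_module_def restrict_scalars_def a_r_coset_def' A_RCOSETS_def' set_add_def' fun_eq_iff)

lemma abelian_group_restrict_scalars:
  assumes "abelian_group M" shows "abelian_group (restrict_scalars f M)"
proof -
  interpret abelian_group M by fact
  show ?thesis
    by (rule abelian_groupI) (auto simp: a_ac intro!: bexI[of _ "\<ominus>\<^bsub>M\<^esub> x" for x] l_neg)
qed

lemma module_restrict_scalars:
  assumes "cring R" "f \<in> ring_hom R S" "module S M"
  shows "module R (restrict_scalars f M)"
proof -
  interpret R: cring R by fact
  interpret M: module S M by fact
  interpret f: ring_hom_cring R S f
    using assms M.R.is_cring by (simp add: ring_hom_cring_def ring_hom_cring_axioms_def)
  show ?thesis
    by (rule moduleI)
      (auto simp: assms abelian_group_restrict_scalars M.M.abelian_group_axioms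
        M.smult_l_distr M.smult_r_distr M.smult_assoc1)
qed

lemma lin_hom_restrict_scalars:
  assumes "f \<in> ring_hom R S" "h \<in> lin_hom S M N"
  shows "h \<in> lin_hom R (restrict_scalars f M) (restrict_scalars f N)"
  using assms by (intro lin_homI) (auto simp: lin_homD ring_hom_closed)

lemma submodule_restrict_scalars:
  assumes "cring R" "f \<in> ring_hom R S" "module S M" "submodule N S M"
  shows "submodule N R (restrict_scalars f M)"
proof -
  interpret M: module S M by fact
  interpret r: module R "restrict_scalars f M" by (rule module_restrict_scalars[OF assms(1-3)])
  show ?thesis
    using M.submoduleE[OF assms(4)] M.submodule_zero[OF assms(4)] ring_hom_closed[OF assms(2)]
    by (intro r.submoduleI2) auto
qed

text \<open>Surjectivity of f realizes each scalar of S by one of R. It is applied to the projection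
  onto B/nu(n) and to surjective ring homomorphisms such as A -> A/m.\<close>

lemma submodule_restrict_scalarsD:
  assumes "module S M" "f ` carrier R = carrier S" "module R (restrict_scalars f M)"
    "submodule N R (restrict_scalars f M)"
  shows "submodule N S M"
proof -
  interpret M: module S M by fact
  interpret r: module R "restrict_scalars f M" by fact
  show ?thesis
  proof (rule M.submoduleI2)
    show "a \<odot>\<^bsub>M\<^esub> x \<in> N" if ax: "a \<in> carrier S" "x \<in> N" for a x
    proof -
      obtain r where "r \<in> carrier R" "a = f r" using ax(1) assms(2) by blast
      then show ?thesis using r.submoduleE(4)[OF assms(4) _ ax(2)] by auto
    qed
  qed (use r.submoduleE[OF assms(4)] r.submodule_zero[OF assms(4)] in auto)
qed

text \<open>Converse to \<open>restrict_scalars\<close> along R -> R/I: a coset acts through any of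
  its representatives, which makes sense when I annihilates M. It allows maps from F_n(B), presented
  over B/nu(n), into modules given over B.\<close>

definition descend_scalars ::
    "('r, 'a, 'y) module_scheme \<Rightarrow> ('r set, 'a) module"
  where "descend_scalars M =
    \<lparr>carrier = carrier M, mult = mult M, one = one M, zero = zero M, add = add M,
     smult = (\<lambda>Z x. the_elem ((\<lambda>r. r \<odot>\<^bsub>M\<^esub> x) ` Z))\<rparr>"

lemma descend_scalars_sel [simp]:
  "carrier (descend_scalars M) = carrier M" "\<zero>\<^bsub>descend_scalars M\<^esub> = \<zero>\<^bsub>M\<^esub>"
  "x \<oplus>\<^bsub>descend_scalars M\<^esub> y = x \<oplus>\<^bsub>M\<^esub> y"
  by (simp_all add: descend_scalars_def)

lemma ring_as_module: "cring R \<Longrightarrow> module R (ring_as_module R)"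
proof -
  assume "cring R"
  then interpret cring R .
  have "abelian_group (ring_as_module R)"
    by (rule abelian_groupI)
      (auto simp: a_ac ring_as_module_def intro!: bexI[of _ "\<ominus>\<^bsub>R\<^esub> x" for x] l_neg)
  then show ?thesis
    by (intro moduleI is_cring) (auto simp: ring_as_module_def l_distr r_distr m_assoc)
qed

lemma ring_as_module_sel [simp]:
  "carrier (ring_as_module R) = carrier R" "\<zero>\<^bsub>ring_as_module R\<^esub> = \<zero>\<^bsub>R\<^esub>"
  "x \<oplus>\<^bsub>ring_as_module R\<^esub> y = x \<oplus>\<^bsub>R\<^esub> y" "r \<odot>\<^bsub>ring_as_module R\<^esub> x = r \<otimes>\<^bsub>R\<^esub> x"
  by (simp_all add: ring_as_module_def)

context
  fixes R :: "('r, 'x) ring_scheme" and I and M :: "('r, 'a, 'y) module_scheme"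
  assumes I: "ideal I R" and M: "module R M"
    and kill: "\<And>i x. i \<in> I \<Longrightarrow> x \<in> carrier M \<Longrightarrow> i \<odot>\<^bsub>M\<^esub> x = \<zero>\<^bsub>M\<^esub>"
begin

interpretation M: module R M by (rule M)
interpretation I: ideal I R by (rule I)

lemma descend_scalars_smult:
  assumes r: "r \<in> carrier R" and x: "x \<in> carrier M"
  shows "(I +>\<^bsub>R\<^esub> r) \<odot>\<^bsub>descend_scalars M\<^esub> x = r \<odot>\<^bsub>M\<^esub> x"
proof -
  have eq: "s \<odot>\<^bsub>M\<^esub> x = r \<odot>\<^bsub>M\<^esub> x" if s: "s \<in> I +>\<^bsub>R\<^esub> r" for s
  proof -
    obtain i where "i \<in> I" "s = i \<oplus>\<^bsub>R\<^esub> r" using s by (auto simp: a_r_coset_def')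
    then show ?thesis using r x kill[of i x] by (simp add: M.smult_l_distr)
  qed
  have "(\<lambda>s. s \<odot>\<^bsub>M\<^esub> x) ` (I +>\<^bsub>R\<^esub> r) = {r \<odot>\<^bsub>M\<^esub> x}"
    using eq I.a_rcos_self[OF r] by blast
  then show ?thesis by (simp add: descend_scalars_def)
qed

lemma module_descend_scalars: "module (R Quot I) (descend_scalars M)"
proof (rule moduleI)
  show "cring (R Quot I)" by (rule I.quotient_is_cring[OF M.R.is_cring])
  show "abelian_group (descend_scalars M)"
    by (rule abelian_groupI) (auto simp: M.M.a_ac intro!: bexI[of _ "\<ominus>\<^bsub>M\<^esub> x" for x] M.M.l_neg)
qed (auto simp: FactRing_def A_RCOSETS_def' I.a_rcos_sum I.rcoset_mult_add descend_scalars_smult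
    M.smult_l_distr M.smult_r_distr M.smult_assoc1)

end


section \<open>Free modules\<close>

lemma free_module_sel [simp]:
  "\<zero>\<^bsub>free_module R S\<^esub> = (\<lambda>s. \<zero>\<^bsub>R\<^esub>)" "f \<oplus>\<^bsub>free_module R S\<^esub> g = (\<lambda>s. f s \<oplus>\<^bsub>R\<^esub> g s)"
  "r \<odot>\<^bsub>free_module R S\<^esub> f = (\<lambda>s. r \<otimes>\<^bsub>R\<^esub> f s)"
  by (simp_all add: free_module_def)

context cring
begin

lemma free_module_carrier:
  "f \<in> carrier (free_module R S) \<longleftrightarrow>
     (\<forall>s. f s \<in> carrier R) \<and> (\<forall>s. s \<notin> S \<longrightarrow> f s = \<zero>) \<and> finite {s. f s \<noteq> \<zero>}"
proof -
  have "f s \<in> carrier R" if "\<forall>s\<in>S. f s \<in> carrier R" "\<forall>s. s \<notin> S \<longrightarrow> f s = \<zero>" for s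
    using that by (cases "s \<in> S") auto
  then show ?thesis by (auto simp: free_module_def)
qed

lemma module_free_module: "module R (free_module R S)"
proof (rule moduleI)
  have fin: "finite {s. f s \<oplus> g s \<noteq> \<zero>}" if "finite {s. f s \<noteq> \<zero>}" "finite {s. g s \<noteq> \<zero>}"
    for f g :: "'s \<Rightarrow> 'a"
    by (rule finite_subset[of _ "{s. f s \<noteq> \<zero>} \<union> {s. g s \<noteq> \<zero>}"]) (use that in auto)
  have fin2: "finite {s. h (f s) \<noteq> \<zero>}" if "finite {s. f s \<noteq> \<zero>}" "h \<zero> = \<zero>"
    for f :: "'s \<Rightarrow> 'a" and h
    by (rule finite_subset[of _ "{s. f s \<noteq> \<zero>}"]) (use that in auto)
  show "abelian_group (free_module R S)"
  proof (rule abelian_groupI)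
    fix f assume f: "f \<in> carrier (free_module R S)"
    show "\<exists>g\<in>carrier (free_module R S). g \<oplus>\<^bsub>free_module R S\<^esub> f = \<zero>\<^bsub>free_module R S\<^esub>"
      by (rule bexI[of _ "\<lambda>s. \<ominus> f s"])
        (use f fin2[of f "\<lambda>x. \<ominus> x"] in \<open>auto simp: free_module_carrier l_neg\<close>)
  qed (auto simp: free_module_carrier a_ac intro!: fin)
qed (auto simp: is_cring free_module_carrier l_distr r_distr m_assoc
      intro!: finite_subset[of "{s. r \<otimes> f s \<noteq> \<zero>}" "{s. f s \<noteq> \<zero>}" for r f])

lemma free_gen_closed: "s \<in> S \<Longrightarrow> free_gen R s \<in> carrier (free_module R S)"
  by (auto simp: free_module_carrier free_gen_def intro: finite_subset[of _ "{s}"])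

text \<open>Induction on the support: f is f(a := 0) plus the multiple f a of the generator at
  a.\<close>

lemma free_module_span: "span_submodule R (free_module R S) (free_gen R ` S) = carrier (free_module R S)"
proof -
  interpret F: module R "free_module R S" by (rule module_free_module)
  define H where "H = span_submodule R (free_module R S) (free_gen R ` S)"
  have H: "submodule H R (free_module R S)"
    unfolding H_def by (rule F.span_submodule) (auto simp: free_gen_closed)
  have "f \<in> H" if "finite A" "f \<in> carrier (free_module R S)" "{s. f s \<noteq> \<zero>} = A" for A f
    using that
  proof (induction A arbitrary: f rule: finite_induct)
    case empty
    then have "f = (\<lambda>s. \<zero>)" by auto
    then show ?case using F.submodule_zero[OF H] by simp
  next
    case (insert a A)
    have a: "a \<in> S" "f a \<in> carrier R" using insert.prems by (auto simp: free_module_carrier)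
    have supp: "{s. (f(a := \<zero>)) s \<noteq> \<zero>} = A"
      using insert.prems(2) insert.hyps(2) by (auto simp: set_eq_iff)
    have fc: "f(a := \<zero>) \<in> carrier (free_module R S)"
      unfolding free_module_carrier supp using insert.prems(1) insert.hyps(1)
      by (simp add: free_module_carrier)
    from insert.IH[OF fc supp] have "f(a := \<zero>) \<in> H" .
    moreover have "f a \<odot>\<^bsub>free_module R S\<^esub> free_gen R a \<in> H"
      using F.span_incl[of "free_gen R ` S"] a by (intro F.submoduleE(4)[OF H]) (auto simp: H_def)
    ultimately have "f(a := \<zero>) \<oplus>\<^bsub>free_module R S\<^esub> f a \<odot>\<^bsub>free_module R S\<^esub> free_gen R a \<in> H"
      by (rule F.submoduleE(5)[OF H])
    moreover have "f(a := \<zero>) \<oplus>\<^bsub>free_module R S\<^esub> f a \<odot>\<^bsub>free_module R S\<^esub> free_gen R a = f"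
      using insert.prems(1) by (auto simp: free_gen_def free_module_carrier fun_eq_iff)
    ultimately show ?case by simp
  qed
  then show ?thesis using F.submoduleE(1)[OF H] by (auto simp: H_def free_module_carrier)
qed

lemma free_lift:
  assumes N: "module R N" and g: "\<And>s. s \<in> S \<Longrightarrow> g s \<in> carrier N"
  shows "\<exists>h\<in>lin_hom R (free_module R S) N. \<forall>s\<in>S. h (free_gen R s) = g s"
proof -
  interpret N: module R N by fact
  define h where "h f = (\<Oplus>\<^bsub>N\<^esub>s\<in>{s. f s \<noteq> \<zero>}. f s \<odot>\<^bsub>N\<^esub> g s)" for f
  have fg: "f s \<odot>\<^bsub>N\<^esub> g s \<in> carrier N" if "f \<in> carrier (free_module R S)" "s \<in> S" for f s
    using that g by (auto simp: free_module_carrier)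
  \<comment> \<open>The sum may run over any finite set containing the support, so that two elements
    can be summed over a common index set.\<close>
  have h_eq: "h f = (\<Oplus>\<^bsub>N\<^esub>s\<in>T. f s \<odot>\<^bsub>N\<^esub> g s)"
    if f: "f \<in> carrier (free_module R S)" and T: "finite T" "{s. f s \<noteq> \<zero>} \<subseteq> T" "T \<subseteq> S" for f T
    unfolding h_def
    by (rule N.M.add.finprod_mono_neutral_cong_left[simplified])
      (use T g fg[OF f] in auto)
  have supp: "finite {s. f s \<noteq> \<zero>}" "{s. f s \<noteq> \<zero>} \<subseteq> S" if "f \<in> carrier (free_module R S)" for f
    using that by (auto simp: free_module_carrier)
  interpret F: module R "free_module R S" by (rule module_free_module)
  have "h \<in> lin_hom R (free_module R S) N"
  proof (rule lin_homI)
    fix f assume f: "f \<in> carrier (free_module R S)"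
    show "h f \<in> carrier N"
      unfolding h_def using supp[OF f] fg[OF f] by (intro N.M.finsum_closed) auto
    show "h (r \<odot>\<^bsub>free_module R S\<^esub> f) = r \<odot>\<^bsub>N\<^esub> h f" if r: "r \<in> carrier R" for r
    proof -
      have "h (r \<odot>\<^bsub>free_module R S\<^esub> f) = (\<Oplus>\<^bsub>N\<^esub>s\<in>{s. f s \<noteq> \<zero>}. (r \<otimes> f s) \<odot>\<^bsub>N\<^esub> g s)"
        using h_eq[OF F.smult_closed[OF r f] supp(1)[OF f] _ supp(2)[OF f]] r by fastforce
      also have "\<dots> = (\<Oplus>\<^bsub>N\<^esub>s\<in>{s. f s \<noteq> \<zero>}. r \<odot>\<^bsub>N\<^esub> (f s \<odot>\<^bsub>N\<^esub> g s))"
        using f supp[OF f] g r fg[OF f]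
        by (intro N.M.finsum_cong') (auto simp: free_module_carrier N.smult_assoc1 Pi_def subset_iff)
      also have "\<dots> = r \<odot>\<^bsub>N\<^esub> h f"
        unfolding h_def using supp[OF f] fg[OF f] r
        by (intro N.finsum_smult_ldistr[symmetric]) auto
      finally show ?thesis .
    qed
    fix f' assume f': "f' \<in> carrier (free_module R S)"
    let ?T = "{s. f s \<noteq> \<zero>} \<union> {s. f' s \<noteq> \<zero>}"
    have T: "finite ?T" "?T \<subseteq> S" using supp[OF f] supp[OF f'] by auto
    have "h (f \<oplus>\<^bsub>free_module R S\<^esub> f') = (\<Oplus>\<^bsub>N\<^esub>s\<in>?T. (f s \<oplus> f' s) \<odot>\<^bsub>N\<^esub> g s)"
      using h_eq[OF F.M.a_closed[OF f f'] T(1) _ T(2)] by fastforce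
    also have "\<dots> = (\<Oplus>\<^bsub>N\<^esub>s\<in>?T. f s \<odot>\<^bsub>N\<^esub> g s \<oplus>\<^bsub>N\<^esub> f' s \<odot>\<^bsub>N\<^esub> g s)"
    proof (rule N.M.finsum_cong')
      fix s assume "s \<in> ?T"
      then have "s \<in> S" using T(2) by blast
      then show "(f s \<oplus> f' s) \<odot>\<^bsub>N\<^esub> g s = f s \<odot>\<^bsub>N\<^esub> g s \<oplus>\<^bsub>N\<^esub> f' s \<odot>\<^bsub>N\<^esub> g s"
        using f f' g by (simp add: free_module_carrier N.smult_l_distr)
    qed (use T(2) fg[OF f] fg[OF f'] in blast)+
    also have "\<dots> = h f \<oplus>\<^bsub>N\<^esub> h f'"
      unfolding h_eq[OF f T(1) Un_upper1 T(2)] h_eq[OF f' T(1) Un_upper2 T(2)]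
      using T(2) fg[OF f] fg[OF f'] by (intro N.M.finsum_addf) auto
    finally show "h (f \<oplus>\<^bsub>free_module R S\<^esub> f') = h f \<oplus>\<^bsub>N\<^esub> h f'" .
  qed
  moreover have "h (free_gen R s) = g s" if s: "s \<in> S" for s
  proof -
    have "{t. free_gen R s t \<noteq> \<zero>} \<subseteq> {s}" by (auto simp: free_gen_def)
    from h_eq[OF free_gen_closed[OF s] _ this] show ?thesis
      using s g[OF s] by (simp add: free_gen_def)
  qed
  ultimately show ?thesis by blast
qed

text \<open>The condition on relations ranges over every linear h with the given values on
  generators, because the map from \<open>free_lift\<close> is known only through these
  values.\<close>

lemma presented_lift:
  assumes Z: "Z \<subseteq> carrier (free_module R S)" and N: "module R N"
    and g: "\<And>s. s \<in> S \<Longrightarrow> g s \<in> carrier N"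
    and rels: "\<And>h z. h \<in> lin_hom R (free_module R S) N \<Longrightarrow> (\<And>s. s \<in> S \<Longrightarrow> h (free_gen R s) = g s) \<Longrightarrow>
        z \<in> Z \<Longrightarrow> h z = \<zero>\<^bsub>N\<^esub>"
  defines "K \<equiv> span_submodule R (free_module R S) Z"
  shows "\<exists>h\<in>lin_hom R (quot_module (free_module R S) K) N.
    \<forall>s\<in>S. h (K +>\<^bsub>free_module R S\<^esub> free_gen R s) = g s"
proof -
  interpret F: module R "free_module R S" by (rule module_free_module)
  interpret N: module R N by fact
  have K: "submodule K R (free_module R S)" unfolding K_def by (rule F.span_submodule[OF Z])
  obtain h where h: "h \<in> lin_hom R (free_module R S) N" "\<And>s. s \<in> S \<Longrightarrow> h (free_gen R s) = g s"
    using free_lift[OF N g, of S "\<lambda>s. s"] by auto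
  have "K \<subseteq> {x \<in> carrier (free_module R S). h x \<in> {\<zero>\<^bsub>N\<^esub>}}"
    unfolding K_def
    by (rule F.span_least[OF F.preimage_submodule[OF N h(1) N.zero_submodule]]) (use Z rels h in auto)
  then have z: "\<And>y. y \<in> K \<Longrightarrow> h y = \<zero>\<^bsub>N\<^esub>" by auto
  show ?thesis
    by (intro bexI[OF _ F.quot_lift_hom[OF K N h(1) z]])
      (auto simp: F.the_elem_coset[OF K N h(1) z] free_gen_closed h(2))
qed

text \<open>The preimage of the span in the free module is a submodule that contains the free
  generators, hence everything.\<close>

lemma presented_span:
  assumes Z: "Z \<subseteq> carrier (free_module R S)"
  defines "K \<equiv> span_submodule R (free_module R S) Z"
  shows "span_submodule R (quot_module (free_module R S) K)
      ((\<lambda>s. K +>\<^bsub>free_module R S\<^esub> free_gen R s) ` S) = carrier (quot_module (free_module R S) K)"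
proof -
  interpret F: module R "free_module R S" by (rule module_free_module)
  have K: "submodule K R (free_module R S)" unfolding K_def by (rule F.span_submodule[OF Z])
  interpret Q: module R "quot_module (free_module R S) K" by (rule F.quot_module[OF K])
  let ?E = "(\<lambda>s. K +>\<^bsub>free_module R S\<^esub> free_gen R s) ` S"
  let ?H = "span_submodule R (quot_module (free_module R S) K) ?E"
  have H: "submodule ?H R (quot_module (free_module R S) K)"
    by (rule Q.span_submodule) (auto simp: F.quot_carrier[OF K] free_gen_closed)
  have "submodule {x \<in> carrier (free_module R S). K +>\<^bsub>free_module R S\<^esub> x \<in> ?H} R (free_module R S)"
    by (rule F.preimage_submodule[OF Q.module_axioms F.quot_proj_hom[OF K] H])
  moreover have "free_gen R ` S \<subseteq> {x \<in> carrier (free_module R S). K +>\<^bsub>free_module R S\<^esub> x \<in> ?H}"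
    using subsetD[OF Q.span_incl[of ?E] imageI] by (simp add: image_subset_iff free_gen_closed)
  ultimately have
    "carrier (free_module R S) \<subseteq> {x \<in> carrier (free_module R S). K +>\<^bsub>free_module R S\<^esub> x \<in> ?H}"
    unfolding free_module_span[symmetric] by (rule F.span_least)
  then have "carrier (quot_module (free_module R S) K) \<subseteq> ?H"
    unfolding F.quot_carrier[OF K] by blast
  then show ?thesis using Q.submoduleE(1)[OF H] by (rule subset_antisym[rotated])
qed

end

section \<open>Tensor powers and homomorphism modules\<close>

lemma tensor_words_update:
  "xs \<in> tensor_words M m \<Longrightarrow> x \<in> carrier M \<Longrightarrow> xs[i := x] \<in> tensor_words M m"
  by (auto simp: tensor_words_def dest: subsetD[OF set_update_subset_insert])

context module
begin

lemma tensor_rels_carrier: "tensor_rels R M m \<subseteq> carrier (free_module R (tensor_words M m))"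
proof -
  interpret F: module R "free_module R (tensor_words M m)" by (rule R.module_free_module)
  have g: "free_gen R (xs[i := x]) \<in> carrier (free_module R (tensor_words M m))"
    if "xs \<in> tensor_words M m" "x \<in> carrier M" for xs i x
    by (rule R.free_gen_closed[OF tensor_words_update[OF that]])
  show ?thesis unfolding tensor_rels_def Let_def
    by (intro Un_least subsetI; elim CollectE exE conjE; simp only:;
        intro F.M.minus_closed F.M.a_closed F.smult_closed g; simp)
qed

lemma tensor_ker_submodule: "submodule (tensor_ker R M m) R (free_module R (tensor_words M m))"
  unfolding tensor_ker_def
  by (rule module.span_submodule[OF R.module_free_module tensor_rels_carrier])

lemma module_tensor_power: "module R (tensor_power R M m)"
  unfolding tensor_power_def
  by (rule module.quot_module[OF R.module_free_module tensor_ker_submodule])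

lemma pure_tensor_eq:
  "xs \<in> tensor_words M m \<Longrightarrow>
    pure_tensor R M xs = tensor_ker R M m +>\<^bsub>free_module R (tensor_words M m)\<^esub> free_gen R xs"
  by (auto simp: pure_tensor_def tensor_words_def)

lemma pure_tensor_closed:
  "xs \<in> tensor_words M m \<Longrightarrow> pure_tensor R M xs \<in> carrier (tensor_power R M m)"
  by (auto simp: pure_tensor_eq tensor_power_def R.free_gen_closed
      module.quot_carrier[OF R.module_free_module tensor_ker_submodule])

lemma pure_tensor_add:
  assumes "xs \<in> tensor_words M m" "i < m" "x \<in> carrier M" "y \<in> carrier M"
  shows "pure_tensor R M (xs[i := x \<oplus>\<^bsub>M\<^esub> y]) =
    pure_tensor R M (xs[i := x]) \<oplus>\<^bsub>tensor_power R M m\<^esub> pure_tensor R M (xs[i := y])"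
proof -
  let ?F = "free_module R (tensor_words M m)"
  interpret F: module R ?F by (rule R.module_free_module)
  note K = tensor_ker_submodule[of m]
  have g: "free_gen R (xs[i := z]) \<in> carrier ?F" if "z \<in> carrier M" for z
    by (rule R.free_gen_closed[OF tensor_words_update[OF assms(1) that]])
  have "free_gen R (xs[i := x \<oplus>\<^bsub>M\<^esub> y]) \<ominus>\<^bsub>?F\<^esub> (free_gen R (xs[i := x]) \<oplus>\<^bsub>?F\<^esub> free_gen R (xs[i := y]))
      \<in> tensor_rels R M m"
    unfolding tensor_rels_def Let_def using assms by blast
  then have "tensor_ker R M m +>\<^bsub>?F\<^esub> free_gen R (xs[i := x \<oplus>\<^bsub>M\<^esub> y]) =
      tensor_ker R M m +>\<^bsub>?F\<^esub> (free_gen R (xs[i := x]) \<oplus>\<^bsub>?F\<^esub> free_gen R (xs[i := y]))"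
    by (subst F.coset_eq_iff[OF K])
      (use F.span_incl assms g in \<open>auto simp del: free_module_sel simp: tensor_ker_def intro: F.M.a_closed\<close>)
  then show ?thesis
    using assms g
    by (simp add: pure_tensor_eq[OF tensor_words_update[OF assms(1)]] tensor_power_def F.quot_add[OF K]
        del: free_module_sel)
qed

lemma pure_tensor_smult:
  assumes "xs \<in> tensor_words M m" "i < m" "r \<in> carrier R" "x \<in> carrier M"
  shows "pure_tensor R M (xs[i := r \<odot>\<^bsub>M\<^esub> x]) =
    r \<odot>\<^bsub>tensor_power R M m\<^esub> pure_tensor R M (xs[i := x])"
proof -
  let ?F = "free_module R (tensor_words M m)"
  interpret F: module R ?F by (rule R.module_free_module)
  note K = tensor_ker_submodule[of m]
  have g: "free_gen R (xs[i := z]) \<in> carrier ?F" if "z \<in> carrier M" for z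
    by (rule R.free_gen_closed[OF tensor_words_update[OF assms(1) that]])
  have "free_gen R (xs[i := r \<odot>\<^bsub>M\<^esub> x]) \<ominus>\<^bsub>?F\<^esub> r \<odot>\<^bsub>?F\<^esub> free_gen R (xs[i := x]) \<in> tensor_rels R M m"
    unfolding tensor_rels_def Let_def using assms by blast
  then have "tensor_ker R M m +>\<^bsub>?F\<^esub> free_gen R (xs[i := r \<odot>\<^bsub>M\<^esub> x]) =
      tensor_ker R M m +>\<^bsub>?F\<^esub> (r \<odot>\<^bsub>?F\<^esub> free_gen R (xs[i := x]))"
    by (subst F.coset_eq_iff[OF K])
      (use F.span_incl assms g in \<open>auto simp del: free_module_sel simp: tensor_ker_def intro: F.smult_closed\<close>)
  then show ?thesis
    using assms g
    by (simp add: pure_tensor_eq[OF tensor_words_update[OF assms(1)]] tensor_power_def F.quot_smult[OF K]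
        del: free_module_sel)
qed

lemma tensor_lift:
  assumes N: "module R N"
    and T: "\<And>xs. xs \<in> tensor_words M m \<Longrightarrow> T xs \<in> carrier N"
    and add: "\<And>xs i x y. xs \<in> tensor_words M m \<Longrightarrow> i < m \<Longrightarrow> x \<in> carrier M \<Longrightarrow> y \<in> carrier M \<Longrightarrow>
      T (xs[i := x \<oplus>\<^bsub>M\<^esub> y]) = T (xs[i := x]) \<oplus>\<^bsub>N\<^esub> T (xs[i := y])"
    and smult: "\<And>xs i r x. xs \<in> tensor_words M m \<Longrightarrow> i < m \<Longrightarrow> r \<in> carrier R \<Longrightarrow> x \<in> carrier M \<Longrightarrow>
      T (xs[i := r \<odot>\<^bsub>M\<^esub> x]) = r \<odot>\<^bsub>N\<^esub> T (xs[i := x])"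
  shows "\<exists>h\<in>lin_hom R (tensor_power R M m) N. \<forall>xs\<in>tensor_words M m. h (pure_tensor R M xs) = T xs"
proof -
  let ?F = "free_module R (tensor_words M m)"
  interpret F: module R ?F by (rule R.module_free_module)
  interpret N: module R N by (rule N)
  have "\<exists>h\<in>lin_hom R (quot_module ?F (tensor_ker R M m)) N.
      \<forall>xs\<in>tensor_words M m. h (tensor_ker R M m +>\<^bsub>?F\<^esub> free_gen R xs) = T xs"
    unfolding tensor_ker_def
  proof (rule R.presented_lift[OF tensor_rels_carrier N T], assumption)
    fix h z assume h: "h \<in> lin_hom R ?F N" and e: "\<And>s. s \<in> tensor_words M m \<Longrightarrow> h (free_gen R s) = T s"
      and z: "z \<in> tensor_rels R M m"
    note w = tensor_words_update
    note g = R.free_gen_closed[OF w]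
    note [simp] = lin_hom_minus[OF F.module_axioms N h] lin_hom_add[OF h] lin_hom_smult[OF h] g e[OF w]
      T[OF w] N.M.r_neg
    note [simp del] = free_module_sel
    from z show "h z = \<zero>\<^bsub>N\<^esub>"
      unfolding tensor_rels_def Let_def
    proof (elim UnE CollectE exE conjE)
      fix xs i x y assume "z = free_gen R (xs[i := x \<oplus>\<^bsub>M\<^esub> y]) \<ominus>\<^bsub>?F\<^esub>
          (free_gen R (xs[i := x]) \<oplus>\<^bsub>?F\<^esub> free_gen R (xs[i := y]))"
        "xs \<in> tensor_words M m" "i < m" "x \<in> carrier M" "y \<in> carrier M"
      then show ?thesis by (simp add: add a_minus_def[of N])
    next
      fix xs i r x assume "z = free_gen R (xs[i := r \<odot>\<^bsub>M\<^esub> x]) \<ominus>\<^bsub>?F\<^esub> r \<odot>\<^bsub>?F\<^esub> free_gen R (xs[i := x])"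
        "xs \<in> tensor_words M m" "i < m" "r \<in> carrier R" "x \<in> carrier M"
      then show ?thesis by (simp add: smult a_minus_def[of N])
    qed
  qed
  then show ?thesis by (simp add: tensor_power_def pure_tensor_eq cong: ball_cong)
qed

lemma tensor_span:
  "span_submodule R (tensor_power R M m) (pure_tensor R M ` tensor_words M m) = carrier (tensor_power R M m)"
  using R.presented_span[OF tensor_rels_carrier[of m]]
  by (simp add: tensor_power_def tensor_ker_def[symmetric] pure_tensor_eq cong: image_cong)

text \<open>With the other slots frozen, a pure tensor is linear in slot i. This allows arbitrary
  entries to be traded for generators one slot at a time.\<close>

lemma tensor_slot_submodule:
  assumes xs: "xs \<in> tensor_words M m" "i < m" and H: "submodule H R (tensor_power R M m)"
  shows "submodule {x \<in> carrier M. pure_tensor R M (xs[i := x]) \<in> H} R M"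
proof -
  interpret T: module R "tensor_power R M m" by (rule module_tensor_power)
  have "pure_tensor R M (xs[i := \<zero>\<^bsub>M\<^esub>]) = pure_tensor R M (xs[i := \<zero> \<odot>\<^bsub>M\<^esub> \<zero>\<^bsub>M\<^esub>])" by simp
  also have "\<dots> = \<zero> \<odot>\<^bsub>tensor_power R M m\<^esub> pure_tensor R M (xs[i := \<zero>\<^bsub>M\<^esub>])"
    using xs by (rule pure_tensor_smult) auto
  also have "\<dots> = \<zero>\<^bsub>tensor_power R M m\<^esub>"
    by (rule T.smult_l_null) (intro pure_tensor_closed tensor_words_update xs M.zero_closed)
  finally show ?thesis
    by (intro submoduleI2)
      (auto simp: T.submodule_zero[OF H] T.submoduleE[OF H] pure_tensor_add[OF xs] pure_tensor_smult[OF xs])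
qed

lemma tensor_span_gen:
  assumes E: "E \<subseteq> carrier M" and span: "span_submodule R M E = carrier M"
  shows "span_submodule R (tensor_power R M m) (pure_tensor R M ` {xs. length xs = m \<and> set xs \<subseteq> E})
    = carrier (tensor_power R M m)"
proof -
  let ?H = "span_submodule R (tensor_power R M m) (pure_tensor R M ` {xs. length xs = m \<and> set xs \<subseteq> E})"
  interpret T: module R "tensor_power R M m" by (rule module_tensor_power)
  have H: "submodule ?H R (tensor_power R M m)"
    by (rule T.span_submodule) (use E in \<open>auto intro!: pure_tensor_closed simp: tensor_words_def\<close>)
  \<comment> \<open>Induction on the number k of leading slots with arbitrary entries; from slot k
    on the entries already lie in E.\<close>
  have gen: "pure_tensor R M xs \<in> ?H"
    if "k \<le> m" "xs \<in> tensor_words M m" "\<forall>i. k \<le> i \<and> i < m \<longrightarrow> xs ! i \<in> E" for k xs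
    using that
  proof (induction k arbitrary: xs)
    case 0
    then have "length xs = m" "set xs \<subseteq> E" by (auto simp: tensor_words_def in_set_conv_nth)
    then show ?case by (intro subsetD[OF T.span_incl] imageI CollectI conjI)
  next
    case (Suc k)
    have k: "k < m" and len: "length xs = m" and xk: "xs ! k \<in> carrier M"
      using Suc.prems by (auto simp: tensor_words_def)
    have "submodule {x \<in> carrier M. pure_tensor R M (xs[k := x]) \<in> ?H} R M"
      by (rule tensor_slot_submodule[OF Suc.prems(2) k H])
    moreover have "x \<in> carrier M \<and> pure_tensor R M (xs[k := x]) \<in> ?H" if "x \<in> E" for x
      using that E Suc.prems k len
      by (intro conjI Suc.IH) (auto intro!: tensor_words_update simp: nth_list_update)
    ultimately have "pure_tensor R M (xs[k := xs ! k]) \<in> ?H"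
      by (rule span_carrier_induct[OF span _ _ xk])
    then show ?case by simp
  qed
  have "pure_tensor R M ` tensor_words M m \<subseteq> ?H"
    by (rule image_subsetI, rule gen[OF order_refl]) auto
  from T.span_least[OF H this] show ?thesis
    unfolding tensor_span using T.submoduleE(1)[OF H] by (rule subset_antisym[rotated])
qed

end

text \<open>The target for currying bilinear maps in \<open>U_two_lift\<close>. Extensionality makes
  maps that agree on the carrier equal as functions, as the module axioms require.\<close>

definition hom_module ::
    "('r, 'x) ring_scheme \<Rightarrow> ('r, 'a, 'y) module_scheme \<Rightarrow> ('r, 'b, 'z) module_scheme \<Rightarrow> ('r, 'a \<Rightarrow> 'b) module"
  where "hom_module R M N =
    \<lparr>carrier = lin_hom R M N \<inter> extensional (carrier M), mult = undefined, one = undefined,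
     zero = (\<lambda>x\<in>carrier M. \<zero>\<^bsub>N\<^esub>), add = (\<lambda>f g. \<lambda>x\<in>carrier M. f x \<oplus>\<^bsub>N\<^esub> g x),
     smult = (\<lambda>r f. \<lambda>x\<in>carrier M. r \<odot>\<^bsub>N\<^esub> f x)\<rparr>"

lemma hom_module_sel [simp]:
  "carrier (hom_module R M N) = lin_hom R M N \<inter> extensional (carrier M)"
  "\<zero>\<^bsub>hom_module R M N\<^esub> = (\<lambda>x\<in>carrier M. \<zero>\<^bsub>N\<^esub>)"
  "f \<oplus>\<^bsub>hom_module R M N\<^esub> g = (\<lambda>x\<in>carrier M. f x \<oplus>\<^bsub>N\<^esub> g x)"
  "r \<odot>\<^bsub>hom_module R M N\<^esub> f = (\<lambda>x\<in>carrier M. r \<odot>\<^bsub>N\<^esub> f x)"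
  by (simp_all add: hom_module_def)

lemma restrict_lin_hom:
  assumes "module R M" "h \<in> lin_hom R M N"
  shows "restrict h (carrier M) \<in> carrier (hom_module R M N)"
proof -
  interpret M: module R M by fact
  show ?thesis using assms(2) by (auto simp: lin_hom_def)
qed

lemma module_hom_module:
  assumes M: "module R M" and N: "module R N"
  shows "module R (hom_module R M N)"
proof -
  interpret M: module R M by fact
  interpret N: module R N by fact
  have hom: "(\<lambda>x\<in>carrier M. h x) \<in> lin_hom R M N" if "h \<in> lin_hom R M N" for h
    using restrict_lin_hom[OF M that] by simp
  have ext: "(\<lambda>x\<in>carrier M. h x) = f"
    if "f \<in> extensional (carrier M)" "\<And>x. x \<in> carrier M \<Longrightarrow> h x = f x" for h f
    using that by (auto simp: fun_eq_iff extensional_def)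
  have sm: "(\<lambda>x. r \<odot>\<^bsub>N\<^esub> f x) \<in> lin_hom R M N" if "r \<in> carrier R" "f \<in> lin_hom R M N" for r f
    using that(1) lin_homD[OF that(2)]
    by (intro lin_homI) (auto simp: N.smult_r_distr N.smult_assoc1[symmetric] M.R.m_comm)
  have ad: "(\<lambda>x. f x \<oplus>\<^bsub>N\<^esub> g x) \<in> lin_hom R M N" if "f \<in> lin_hom R M N" "g \<in> lin_hom R M N" for f g
    using lin_homD[OF that(1)] lin_homD[OF that(2)]
    by (intro lin_homI) (auto simp: N.smult_r_distr N.M.a_ac)
  have ze: "(\<lambda>x. \<zero>\<^bsub>N\<^esub>) \<in> lin_hom R M N"
    by (intro lin_homI) auto
  show ?thesis
  proof (rule moduleI)
    show "abelian_group (hom_module R M N)"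
    proof (rule abelian_groupI)
      fix f assume f: "f \<in> carrier (hom_module R M N)"
      show "\<exists>g\<in>carrier (hom_module R M N). g \<oplus>\<^bsub>hom_module R M N\<^esub> f = \<zero>\<^bsub>hom_module R M N\<^esub>"
        by (rule bexI[of _ "\<lambda>x\<in>carrier M. (\<ominus>\<^bsub>R\<^esub> \<one>\<^bsub>R\<^esub>) \<odot>\<^bsub>N\<^esub> f x"])
          (use f in \<open>auto simp: fun_eq_iff hom[OF sm] lin_hom_closed N.minus_eq_smult[symmetric] N.M.l_neg\<close>)
    qed (auto simp: hom[OF ad] hom[OF ze] lin_hom_closed N.M.a_ac intro!: ext restrict_ext)
  qed (auto simp: M.R.is_cring hom[OF sm] lin_hom_closed N.smult_l_distr N.smult_r_distr N.smult_assoc1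
      intro!: ext restrict_ext)
qed

section \<open>The complex in degrees zero, one and two\<close>

lemma (in module) smult_left_comm:
  assumes "a \<in> carrier R" "b \<in> carrier R" "x \<in> carrier M"
  shows "a \<odot>\<^bsub>M\<^esub> (b \<odot>\<^bsub>M\<^esub> x) = b \<odot>\<^bsub>M\<^esub> (a \<odot>\<^bsub>M\<^esub> x)"
  using assms R.m_comm[of a b] by (simp add: smult_assoc1[symmetric])

context cring
begin

section \<open>The ideal generated by nu(n) and its quotient ring\<close>

lemma ideal_nu_ideal: "ideal (nu_ideal n R) R"
  by (simp add: nu_ideal_def cgenideal_ideal)

lemma cring_nu_quot: "cring (nu_quot n R)"
  unfolding nu_quot_def by (rule ideal.quotient_is_cring[OF ideal_nu_ideal is_cring])

lemma nu_proj_hom: "nu_proj n R \<in> ring_hom R (nu_quot n R)"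
  using ideal.rcos_ring_hom[OF ideal_nu_ideal[of n]]
  by (simp add: nu_quot_def nu_proj_def[abs_def])

lemma nu_proj_image: "nu_proj n R ` carrier R = carrier (nu_quot n R)"
  by (auto simp: nu_proj_def nu_quot_def FactRing_def A_RCOSETS_def')

lemma nu_proj_eq_iff:
  assumes "a \<in> carrier R" "b \<in> carrier R"
  shows "nu_proj n R a = nu_proj n R b \<longleftrightarrow> a \<ominus> b \<in> nu_ideal n R"
  unfolding nu_proj_def using quotient_eq_iff_same_a_r_cos[OF ideal_nu_ideal assms] by simp

lemma nu_ideal_iff: "a \<in> nu_ideal n R \<longleftrightarrow> (\<exists>b\<in>carrier R. a = b \<otimes> ([nu n] \<cdot> \<one>))"
  by (auto simp: nu_ideal_def cgenideal_def)

lemma nu_in_nu_ideal: "[nu n] \<cdot> \<one> \<in> nu_ideal n R"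
  by (simp add: nu_ideal_def cgenideal_self)

lemma nu_ideal_kills:
  assumes "module R N" "\<And>x. x \<in> carrier N \<Longrightarrow> ([nu n] \<cdot> \<one>) \<odot>\<^bsub>N\<^esub> x = \<zero>\<^bsub>N\<^esub>"
    and "a \<in> nu_ideal n R" "x \<in> carrier N"
  shows "a \<odot>\<^bsub>N\<^esub> x = \<zero>\<^bsub>N\<^esub>"
proof -
  interpret N: module R N by fact
  show ?thesis using assms by (auto simp: nu_ideal_iff N.smult_assoc1)
qed

section \<open>The module F_n(B) and maps out of it\<close>

lemma F_rels_carrier: "F_rels n R \<subseteq> carrier (free_module (nu_quot n R) (carrier R))"
proof -
  interpret Q: cring "nu_quot n R" by (rule cring_nu_quot)
  interpret F: module "nu_quot n R" "free_module (nu_quot n R) (carrier R)" by (rule Q.module_free_module)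
  show ?thesis unfolding F_rels_def Let_def
    by (auto simp del: free_module_sel intro!: F.M.minus_closed F.M.a_closed Q.free_gen_closed)
qed

lemma F_ker_submodule:
  "submodule (F_ker n R) (nu_quot n R) (free_module (nu_quot n R) (carrier R))"
  unfolding F_ker_def
  by (rule module.span_submodule[OF cring.module_free_module[OF cring_nu_quot] F_rels_carrier])

lemma module_F_quot:
  "module (nu_quot n R) (quot_module (free_module (nu_quot n R) (carrier R)) (F_ker n R))"
  by (rule module.quot_module[OF cring.module_free_module[OF cring_nu_quot] F_ker_submodule])

lemma module_F: "module R (F_module n R)"
  unfolding F_module_def by (rule module_restrict_scalars[OF is_cring nu_proj_hom module_F_quot])

lemma c_sym_closed:
  assumes "b \<in> carrier R" shows "c_sym n R b \<in> carrier (F_module n R)"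
  using imageI[OF cring.free_gen_closed[OF cring_nu_quot assms]]
  unfolding F_module_def restrict_scalars_sel c_sym_def
    module.quot_carrier[OF cring.module_free_module[OF cring_nu_quot] F_ker_submodule] .

lemma c_sym_add:
  assumes "a \<in> carrier R" "b \<in> carrier R"
  shows "c_sym n R (a \<oplus> b) = c_sym n R a \<oplus>\<^bsub>F_module n R\<^esub> c_sym n R b"
proof -
  let ?F = "free_module (nu_quot n R) (carrier R)"
  interpret Q: cring "nu_quot n R" by (rule cring_nu_quot)
  interpret F: module "nu_quot n R" ?F by (rule Q.module_free_module)
  note K = F_ker_submodule[of n]
  note g = Q.free_gen_closed[of _ "carrier R"]
  have "free_gen (nu_quot n R) (a \<oplus> b) \<ominus>\<^bsub>?F\<^esub>
      (free_gen (nu_quot n R) a \<oplus>\<^bsub>?F\<^esub> free_gen (nu_quot n R) b) \<in> F_rels n R"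
    unfolding F_rels_def Let_def using assms by blast
  then have "F_ker n R +>\<^bsub>?F\<^esub> free_gen (nu_quot n R) (a \<oplus> b) =
      F_ker n R +>\<^bsub>?F\<^esub> (free_gen (nu_quot n R) a \<oplus>\<^bsub>?F\<^esub> free_gen (nu_quot n R) b)"
    by (subst F.coset_eq_iff[OF K])
      (use F.span_incl assms g in \<open>auto simp del: free_module_sel simp: F_ker_def intro: F.M.a_closed\<close>)
  then show ?thesis
    using assms g by (simp add: c_sym_def F_module_def F.quot_add[OF K] del: free_module_sel)
qed

lemma F_nu_kill:
  assumes "x \<in> carrier (F_module n R)"
  shows "([nu n] \<cdot> \<one>) \<odot>\<^bsub>F_module n R\<^esub> x = \<zero>\<^bsub>F_module n R\<^esub>"
proof -
  interpret F: module "nu_quot n R" "quot_module (free_module (nu_quot n R) (carrier R)) (F_ker n R)"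
    by (rule module_F_quot)
  interpret I: ideal "nu_ideal n R" R by (rule ideal_nu_ideal)
  have "nu_proj n R ([nu n] \<cdot> \<one>) = \<zero>\<^bsub>nu_quot n R\<^esub>"
    using I.a_rcos_const[OF nu_in_nu_ideal] by (simp add: nu_proj_def nu_quot_def FactRing_def)
  then show ?thesis using assms F.smult_l_null by (simp add: F_module_def)
qed

text \<open>The presentation gives generation over B/nu(n). Generation over B follows because the
  projection is surjective, so that every B-submodule is stable under B/nu(n).\<close>

lemma F_span: "span_submodule R (F_module n R) (c_sym n R ` carrier R) = carrier (F_module n R)"
proof -
  interpret Q: cring "nu_quot n R" by (rule cring_nu_quot)
  let ?M = "quot_module (free_module (nu_quot n R) (carrier R)) (F_ker n R)"
  interpret M: module "nu_quot n R" ?M by (rule module_F_quot)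
  interpret F: module R "F_module n R" by (rule module_F)
  let ?H = "span_submodule R (F_module n R) (c_sym n R ` carrier R)"
  have H: "submodule ?H R (F_module n R)"
    by (rule F.span_submodule) (auto intro: c_sym_closed)
  have "submodule ?H (nu_quot n R) ?M"
    using H module_F[of n] unfolding F_module_def
    by (rule submodule_restrict_scalarsD[OF module_F_quot nu_proj_image, rotated])
  from M.span_least[OF this F.span_incl] have "carrier ?M \<subseteq> ?H"
    using Q.presented_span[OF F_rels_carrier[of n]]
    by (simp add: F_ker_def[symmetric] c_sym_def[abs_def])
  then have "carrier (F_module n R) \<subseteq> ?H" by (simp add: F_module_def)
  then show ?thesis using F.submoduleE(1)[OF H] by (rule subset_antisym[rotated])
qed

text \<open>The target, being killed by nu(n), is first turned into a module over
  \<open>nu_quot n R\<close>, where the presentation applies; linearity is then read back over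
  R.\<close>

lemma F_lift:
  assumes N: "module R N" and kill: "\<And>x. x \<in> carrier N \<Longrightarrow> ([nu n] \<cdot> \<one>) \<odot>\<^bsub>N\<^esub> x = \<zero>\<^bsub>N\<^esub>"
    and g: "\<And>b. b \<in> carrier R \<Longrightarrow> g b \<in> carrier N"
    and add: "\<And>a b. a \<in> carrier R \<Longrightarrow> b \<in> carrier R \<Longrightarrow> g (a \<oplus> b) = g a \<oplus>\<^bsub>N\<^esub> g b"
  shows "\<exists>h\<in>lin_hom R (F_module n R) N. \<forall>b\<in>carrier R. h (c_sym n R b) = g b"
proof -
  let ?Q = "nu_quot n R" let ?F = "free_module ?Q (carrier R)" let ?N = "descend_scalars N"
  interpret Q: cring ?Q by (rule cring_nu_quot)
  interpret F: module ?Q ?F by (rule Q.module_free_module)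
  interpret N: module R N by (rule N)
  note nk = nu_ideal_kills[OF N kill]
  have N': "module ?Q ?N"
    unfolding nu_quot_def by (rule module_descend_scalars[OF ideal_nu_ideal N nk])
  interpret N': module ?Q ?N by (rule N')
  have "\<exists>h\<in>lin_hom ?Q (quot_module ?F (F_ker n R)) ?N.
      \<forall>b\<in>carrier R. h (F_ker n R +>\<^bsub>?F\<^esub> free_gen ?Q b) = g b"
    unfolding F_ker_def
  proof (rule Q.presented_lift[OF F_rels_carrier N'])
    fix h z assume h: "h \<in> lin_hom ?Q ?F ?N" and e: "\<And>s. s \<in> carrier R \<Longrightarrow> h (free_gen ?Q s) = g s"
      and z: "z \<in> F_rels n R"
    note gg = Q.free_gen_closed[of _ "carrier R"]
    from z obtain a b where ab: "a \<in> carrier R" "b \<in> carrier R"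
      and z: "z = free_gen ?Q (a \<oplus> b) \<ominus>\<^bsub>?F\<^esub> (free_gen ?Q a \<oplus>\<^bsub>?F\<^esub> free_gen ?Q b)"
      unfolding F_rels_def Let_def by blast
    have "h z = g (a \<oplus> b) \<ominus>\<^bsub>?N\<^esub> (g a \<oplus>\<^bsub>?N\<^esub> g b)"
      unfolding z using ab gg
      by (simp add: lin_hom_minus[OF F.module_axioms N' h] lin_hom_add[OF h] e del: free_module_sel)
    also have "\<dots> = \<zero>\<^bsub>?N\<^esub>"
      using ab g[of "a \<oplus> b"] N'.M.r_neg[of "g (a \<oplus> b)"] by (simp add: add[symmetric] a_minus_def[of ?N])
    finally show "h z = \<zero>\<^bsub>?N\<^esub>" .
  qed (use g in simp)
  then obtain h where h: "h \<in> lin_hom ?Q (quot_module ?F (F_ker n R)) ?N"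
    and hc: "\<And>b. b \<in> carrier R \<Longrightarrow> h (c_sym n R b) = g b"
    by (auto simp: c_sym_def)
  have "h \<in> lin_hom R (F_module n R) N"
  proof (rule lin_homI)
    fix r x assume r: "r \<in> carrier R" and x: "x \<in> carrier (F_module n R)"
    then have "h (r \<odot>\<^bsub>F_module n R\<^esub> x) = nu_proj n R r \<odot>\<^bsub>?N\<^esub> h x"
      using lin_hom_smult[OF h, of "nu_proj n R r" x] ring_hom_closed[OF nu_proj_hom r]
      by (simp add: F_module_def)
    also have "\<dots> = r \<odot>\<^bsub>N\<^esub> h x"
      unfolding nu_proj_def
      by (rule descend_scalars_smult[OF ideal_nu_ideal N nk r])
        (use lin_hom_closed[OF h, of x] x in \<open>auto simp: F_module_def\<close>)
    finally show "h (r \<odot>\<^bsub>F_module n R\<^esub> x) = r \<odot>\<^bsub>N\<^esub> h x" .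
  qed (use lin_homD[OF h] in \<open>auto simp: F_module_def\<close>)
  then show ?thesis using hc by blast
qed

section \<open>The chain modules, and maps out of degrees one and two\<close>

lemma module_U_pos: "module R (U_pos n R m)"
  unfolding U_pos_def by (rule module.module_tensor_power[OF module_F])

lemma map_c_sym_words: "bs \<in> words R m \<Longrightarrow> map (c_sym n R) bs \<in> tensor_words (F_module n R) m"
  by (auto simp: words_def tensor_words_def c_sym_closed subset_iff)

lemma c_word_closed: "bs \<in> words R m \<Longrightarrow> c_word n R bs \<in> carrier (U_pos n R m)"
  unfolding U_pos_def c_word_def by (rule module.pure_tensor_closed[OF module_F map_c_sym_words])

lemma U_span: "span_submodule R (U_pos n R m) (c_word n R ` words R m) = carrier (U_pos n R m)"
proof -
  have "{xs. length xs = m \<and> set xs \<subseteq> c_sym n R ` carrier R} = map (c_sym n R) ` words R m"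
  proof (intro subset_antisym subsetI)
    fix xs assume "xs \<in> {xs. length xs = m \<and> set xs \<subseteq> c_sym n R ` carrier R}"
    then have "xs \<in> lists (c_sym n R ` carrier R)" "length xs = m" by auto
    then show "xs \<in> map (c_sym n R) ` words R m"
      by (auto simp: lists_image words_def)
  qed (auto simp: words_def intro!: imageI)
  then have "pure_tensor R (F_module n R) ` {xs. length xs = m \<and> set xs \<subseteq> c_sym n R ` carrier R} =
      c_word n R ` words R m"
    by (simp add: image_image c_word_def)
  then show ?thesis
    using module.tensor_span_gen[OF module_F _ F_span, of n m] c_sym_closed
    unfolding U_pos_def by (simp add: image_subset_iff)
qed

lemma c_word_add:
  assumes "a \<in> carrier R" "b \<in> carrier R"
  shows "c_word n R [a \<oplus> b] = c_word n R [a] \<oplus>\<^bsub>U_pos n R 1\<^esub> c_word n R [b]"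
  using module.pure_tensor_add[OF module_F, of "[c_sym n R a]" n 1 0 "c_sym n R a" "c_sym n R b"] assms
  by (simp add: c_word_def U_pos_def c_sym_add tensor_words_def c_sym_closed)

text \<open>The tensor power is formed over B, so annihilation by nu(n) has to be inherited from
  F_n(B). The hypothesis \<open>m > 0\<close> provides a slot that absorbs the scalar.\<close>

lemma U_nu_kill:
  assumes m: "m > 0" and x: "x \<in> carrier (U_pos n R m)"
  shows "([nu n] \<cdot> \<one>) \<odot>\<^bsub>U_pos n R m\<^esub> x = \<zero>\<^bsub>U_pos n R m\<^esub>"
proof -
  interpret U: module R "U_pos n R m" by (rule module_U_pos)
  interpret F: module R "F_module n R" by (rule module_F)
  let ?r = "[nu n] \<cdot> \<one>"
  have r: "?r \<in> carrier R" by simp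
  have "submodule {x \<in> carrier (U_pos n R m). ?r \<odot>\<^bsub>U_pos n R m\<^esub> x = \<zero>\<^bsub>U_pos n R m\<^esub>} R (U_pos n R m)"
  proof (rule U.submoduleI2)
    fix a x assume a: "a \<in> carrier R"
      and x: "x \<in> {x \<in> carrier (U_pos n R m). ?r \<odot>\<^bsub>U_pos n R m\<^esub> x = \<zero>\<^bsub>U_pos n R m\<^esub>}"
    have "?r \<odot>\<^bsub>U_pos n R m\<^esub> (a \<odot>\<^bsub>U_pos n R m\<^esub> x) = a \<odot>\<^bsub>U_pos n R m\<^esub> (?r \<odot>\<^bsub>U_pos n R m\<^esub> x)"
      using a x r by (intro U.smult_left_comm) auto
    then show "a \<odot>\<^bsub>U_pos n R m\<^esub> x \<in> {x \<in> carrier (U_pos n R m). ?r \<odot>\<^bsub>U_pos n R m\<^esub> x = \<zero>\<^bsub>U_pos n R m\<^esub>}"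
      using a x by simp
  qed (use r in \<open>auto simp: U.smult_r_distr\<close>)
  moreover have "z \<in> carrier (U_pos n R m) \<and> ?r \<odot>\<^bsub>U_pos n R m\<^esub> z = \<zero>\<^bsub>U_pos n R m\<^esub>"
    if z: "z \<in> pure_tensor R (F_module n R) ` tensor_words (F_module n R) m" for z
  proof -
    obtain xs where xs: "xs \<in> tensor_words (F_module n R) m" "z = pure_tensor R (F_module n R) xs"
      using z by blast
    have x0: "xs ! 0 \<in> carrier (F_module n R)" using xs m by (auto simp: tensor_words_def)
    note sm = F.pure_tensor_smult[OF xs(1) m, folded U_pos_def]
    have z: "z = pure_tensor R (F_module n R) (xs[0 := xs ! 0])" by (simp add: xs(2))
    have "?r \<odot>\<^bsub>U_pos n R m\<^esub> z = pure_tensor R (F_module n R) (xs[0 := ?r \<odot>\<^bsub>F_module n R\<^esub> xs ! 0])"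
      unfolding z by (rule sm[OF r x0, symmetric])
    \<comment> \<open>The zero in the slot is rewritten as 0 times the old entry, so that
      homogeneity can pull the scalar 0 out again.\<close>
    also have "\<dots> = pure_tensor R (F_module n R) (xs[0 := \<zero> \<odot>\<^bsub>F_module n R\<^esub> xs ! 0])"
      by (simp only: F_nu_kill[OF x0] F.smult_l_null[OF x0])
    also have "\<dots> = \<zero> \<odot>\<^bsub>U_pos n R m\<^esub> z" unfolding z by (rule sm[OF zero_closed x0])
    also have "\<dots> = \<zero>\<^bsub>U_pos n R m\<^esub>"
      by (rule U.smult_l_null) (use F.pure_tensor_closed[OF xs(1)] xs(2) in \<open>simp add: U_pos_def\<close>)
    finally show ?thesis using F.pure_tensor_closed[OF xs(1)] xs(2) by (simp add: U_pos_def)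
  qed
  ultimately show ?thesis
    by (rule U.span_carrier_induct[OF F.tensor_span[folded U_pos_def] _ _ x])
qed

lemma U_one_lift:
  assumes N: "module R N" and kill: "\<And>x. x \<in> carrier N \<Longrightarrow> ([nu n] \<cdot> \<one>) \<odot>\<^bsub>N\<^esub> x = \<zero>\<^bsub>N\<^esub>"
    and g: "\<And>b. b \<in> carrier R \<Longrightarrow> g b \<in> carrier N"
    and add: "\<And>a b. a \<in> carrier R \<Longrightarrow> b \<in> carrier R \<Longrightarrow> g (a \<oplus> b) = g a \<oplus>\<^bsub>N\<^esub> g b"
  shows "\<exists>h\<in>lin_hom R (U_pos n R 1) N. \<forall>b\<in>carrier R. h (c_word n R [b]) = g b"
proof -
  obtain k where k: "k \<in> lin_hom R (F_module n R) N" "\<And>b. b \<in> carrier R \<Longrightarrow> k (c_sym n R b) = g b"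
    using F_lift[OF N kill g add] by auto
  have "\<exists>h\<in>lin_hom R (tensor_power R (F_module n R) 1) N.
      \<forall>xs\<in>tensor_words (F_module n R) 1. h (pure_tensor R (F_module n R) xs) = k (xs ! 0)"
    by (rule module.tensor_lift[OF module_F N])
      (auto simp: tensor_words_def length_Suc_conv lin_homD[OF k(1)])
  then obtain h where h: "h \<in> lin_hom R (U_pos n R 1) N"
    "\<And>xs. xs \<in> tensor_words (F_module n R) 1 \<Longrightarrow> h (pure_tensor R (F_module n R) xs) = k (xs ! 0)"
    by (auto simp: U_pos_def)
  then have "h (c_word n R [b]) = g b" if "b \<in> carrier R" for b
    using that by (simp add: c_word_def tensor_words_def c_sym_closed k(2))
  then show ?thesis using h(1) by blast
qed

text \<open>Currying: for fixed a, the map g a extends to a linear \<open>L a\<close> from F_n(B) to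
  N; then a -> \<open>L a\<close> is additive with values in a module killed by nu(n), so it extends
  to \<open>l\<close>. The bilinear map (x, y) -> \<open>l x y\<close> finally factors through the
  tensor square.\<close>

lemma U_two_lift:
  assumes N: "module R N" and kill: "\<And>x. x \<in> carrier N \<Longrightarrow> ([nu n] \<cdot> \<one>) \<odot>\<^bsub>N\<^esub> x = \<zero>\<^bsub>N\<^esub>"
    and g: "\<And>a b. a \<in> carrier R \<Longrightarrow> b \<in> carrier R \<Longrightarrow> g a b \<in> carrier N"
    and add1: "\<And>a a' b. a \<in> carrier R \<Longrightarrow> a' \<in> carrier R \<Longrightarrow> b \<in> carrier R \<Longrightarrow>
      g (a \<oplus> a') b = g a b \<oplus>\<^bsub>N\<^esub> g a' b"
    and add2: "\<And>a b b'. a \<in> carrier R \<Longrightarrow> b \<in> carrier R \<Longrightarrow> b' \<in> carrier R \<Longrightarrow>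
      g a (b \<oplus> b') = g a b \<oplus>\<^bsub>N\<^esub> g a b'"
  shows "\<exists>h\<in>lin_hom R (U_pos n R 2) N. \<forall>a\<in>carrier R. \<forall>b\<in>carrier R. h (c_word n R [a, b]) = g a b"
proof -
  let ?F = "F_module n R"
  let ?H = "hom_module R ?F N"
  interpret F: module R ?F by (rule module_F)
  interpret N: module R N by (rule N)
  have H: "module R ?H" by (rule module_hom_module[OF module_F N])
  have "\<exists>l. l \<in> carrier ?H \<and> (\<forall>b\<in>carrier R. l (c_sym n R b) = g a b)" if a: "a \<in> carrier R" for a
  proof -
    obtain h where "h \<in> lin_hom R ?F N" "\<And>b. b \<in> carrier R \<Longrightarrow> h (c_sym n R b) = g a b"
      using F_lift[of N n "g a", OF N kill g[OF a] add2[OF a]] by auto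
    then show ?thesis
      by (intro exI[of _ "restrict h (carrier ?F)"]) (simp add: restrict_lin_hom[OF module_F, simplified] c_sym_closed)
  qed
  then obtain L where L: "\<And>a. a \<in> carrier R \<Longrightarrow> L a \<in> carrier ?H"
    and Lc: "\<And>a b. a \<in> carrier R \<Longrightarrow> b \<in> carrier R \<Longrightarrow> L a (c_sym n R b) = g a b"
    by metis
  interpret H: module R ?H by (rule H)
  \<comment> \<open>\<open>L a\<close> was merely chosen, so additivity in a is not built in; it
    holds since both sides are extensional and agree on the generators
    \<open>c_sym n R b\<close>.\<close>
  have Ladd: "L (a \<oplus> a') = L a \<oplus>\<^bsub>?H\<^esub> L a'" if a: "a \<in> carrier R" "a' \<in> carrier R" for a a'
  proof
    fix x
    have s: "L a \<oplus>\<^bsub>?H\<^esub> L a' \<in> carrier ?H" using L a by (intro H.M.a_closed)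
    have l: "L (a \<oplus> a') \<in> carrier ?H" using L a by simp
    show "L (a \<oplus> a') x = (L a \<oplus>\<^bsub>?H\<^esub> L a') x"
    proof (cases "x \<in> carrier ?F")
      case True
      show ?thesis
      proof (rule F.lin_hom_eqI[OF N _ _ F_span c_sym_closed _ True])
        show "L (a \<oplus> a') (c_sym n R b) = (L a \<oplus>\<^bsub>?H\<^esub> L a') (c_sym n R b)" if b: "b \<in> carrier R" for b
          using a b by (simp add: Lc c_sym_closed add1)
      qed (use s l in \<open>auto simp del: hom_module_sel(3)\<close>)
    next
      case False
      then show ?thesis using l by (simp add: extensional_def)
    qed
  qed
  have Hkill: "([nu n] \<cdot> \<one>) \<odot>\<^bsub>?H\<^esub> f = \<zero>\<^bsub>?H\<^esub>" if "f \<in> carrier ?H" for f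
    using that kill lin_hom_closed[of f R ?F N] by (auto intro!: restrict_ext)
  obtain l where l: "l \<in> lin_hom R ?F ?H" "\<And>a. a \<in> carrier R \<Longrightarrow> l (c_sym n R a) = L a"
    using F_lift[of ?H n L, OF H Hkill L Ladd] by auto
  have lx: "l x \<in> lin_hom R ?F N" if "x \<in> carrier ?F" for x
    using lin_hom_closed[OF l(1) that] by simp
  have "\<exists>h\<in>lin_hom R (tensor_power R ?F 2) N.
      \<forall>xs\<in>tensor_words ?F 2. h (pure_tensor R ?F xs) = l (xs ! 0) (xs ! 1)"
  proof (rule F.tensor_lift[OF N])
    fix xs i x assume xs: "xs \<in> tensor_words ?F 2" and i: "i < (2::nat)" and x: "x \<in> carrier ?F"
    have c: "length xs = 2" "xs ! 0 \<in> carrier ?F" "xs ! 1 \<in> carrier ?F"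
      using xs by (auto simp: tensor_words_def)
    have i: "i = 0 \<or> i = 1" using i by auto
    show "l (xs[i := x \<oplus>\<^bsub>?F\<^esub> y] ! 0) (xs[i := x \<oplus>\<^bsub>?F\<^esub> y] ! 1) =
        l (xs[i := x] ! 0) (xs[i := x] ! 1) \<oplus>\<^bsub>N\<^esub> l (xs[i := y] ! 0) (xs[i := y] ! 1)"
      if y: "y \<in> carrier ?F" for y
      using i c x y by (auto simp: lin_hom_add[OF l(1)] lin_hom_add[OF lx])
    show "l (xs[i := r \<odot>\<^bsub>?F\<^esub> x] ! 0) (xs[i := r \<odot>\<^bsub>?F\<^esub> x] ! 1) =
        r \<odot>\<^bsub>N\<^esub> l (xs[i := x] ! 0) (xs[i := x] ! 1)" if r: "r \<in> carrier R" for r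
      using i c r x by (auto simp: lin_hom_smult[OF l(1)] lin_hom_smult[OF lx])
  next
    fix xs assume "xs \<in> tensor_words ?F 2"
    then have "xs ! 0 \<in> carrier ?F" "xs ! 1 \<in> carrier ?F" by (auto simp: tensor_words_def)
    then show "l (xs ! 0) (xs ! 1) \<in> carrier N" by (intro lin_hom_closed[OF lx])
  qed
  then obtain h where h: "h \<in> lin_hom R (U_pos n R 2) N"
    "\<And>xs. xs \<in> tensor_words ?F 2 \<Longrightarrow> h (pure_tensor R ?F xs) = l (xs ! 0) (xs ! 1)"
    by (auto simp: U_pos_def)
  then have "h (c_word n R [a, b]) = g a b" if "a \<in> carrier R" "b \<in> carrier R" for a b
    using that by (simp add: c_word_def tensor_words_def c_sym_closed l(2) Lc)
  then show ?thesis using h(1) by blast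
qed

end

section \<open>The Frobenius map\<close>

lemma (in ring_hom_cring) hom_nat_one: "h ([m] \<cdot>\<^bsub>R\<^esub> \<one>\<^bsub>R\<^esub>) = [m] \<cdot>\<^bsub>S\<^esub> \<one>\<^bsub>S\<^esub>" for m :: nat
  by (induction m) (simp_all add: R.add.nat_pow_Suc S.add.nat_pow_Suc)

lemma (in ring_hom_cring) hom_nat_power:
  "x \<in> carrier R \<Longrightarrow> h (x [^]\<^bsub>R\<^esub> (m::nat)) = h x [^]\<^bsub>S\<^esub> m"
  by (induction m) auto

context cring
begin

text \<open>Pascal's rule. The products with a and with b are both written over
  \<open>{..Suc m}\<close>, with a zero coefficient at the missing end: at 0 by the conditional, at
  \<open>Suc m\<close> because m choose m + 1 is 0.\<close>

lemma binomial_pow: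
  assumes "a \<in> carrier R" "b \<in> carrier R"
  shows "(a \<oplus> b) [^] (m::nat) = (\<Oplus>i\<in>{..m}. [(m choose i)] \<cdot> (a [^] i \<otimes> b [^] (m - i)))"
proof (induction m)
  case 0
  then show ?case using assms by (simp add: Pi_def)
next
  case (Suc m)
  let ?u = "\<lambda>i. a [^] i \<otimes> b [^] (Suc m - i)"
  have u: "?u i \<in> carrier R" for i using assms by simp
  have "a \<otimes> (a \<oplus> b) [^] m = (\<Oplus>i\<in>{..m}. a \<otimes> [(m choose i)] \<cdot> (a [^] i \<otimes> b [^] (m - i)))"
    unfolding Suc using assms by (intro finsum_rdistr) auto
  also have "\<dots> = (\<Oplus>i\<in>{..m}. [(m choose (Suc i - 1))] \<cdot> ?u (Suc i))"
  proof (rule finsum_cong')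
    fix i
    have "a \<otimes> (a [^] i \<otimes> b [^] (m - i)) = a [^] Suc i \<otimes> b [^] (m - i)"
      using assms by (simp add: m_ac)
    then show "a \<otimes> [(m choose i)] \<cdot> (a [^] i \<otimes> b [^] (m - i)) = [(m choose (Suc i - 1))] \<cdot> ?u (Suc i)"
      using assms by (simp add: add_pow_rdistr del: nat_pow_Suc)
  qed (use assms in auto)
  also have "\<dots> = (\<Oplus>i\<in>{..Suc m}. [(if i = 0 then 0 else m choose (i - 1))] \<cdot> ?u i)"
    using u assms by (subst finsum_Suc2) (simp_all add: Pi_def)
  finally have 1: "a \<otimes> (a \<oplus> b) [^] m = (\<Oplus>i\<in>{..Suc m}. [(if i = 0 then 0 else m choose (i - 1))] \<cdot> ?u i)" .
  have "b \<otimes> (a \<oplus> b) [^] m = (\<Oplus>i\<in>{..m}. b \<otimes> [(m choose i)] \<cdot> (a [^] i \<otimes> b [^] (m - i)))"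
    unfolding Suc using assms by (intro finsum_rdistr) auto
  also have "\<dots> = (\<Oplus>i\<in>{..m}. [(m choose i)] \<cdot> ?u i)"
  proof (rule finsum_cong')
    fix i assume "i \<in> {..m}"
    then have i: "Suc m - i = Suc (m - i)" by simp
    have "b \<otimes> (a [^] i \<otimes> b [^] (m - i)) = a [^] i \<otimes> b [^] Suc (m - i)"
      using assms by (simp add: m_ac)
    then show "b \<otimes> [(m choose i)] \<cdot> (a [^] i \<otimes> b [^] (m - i)) = [(m choose i)] \<cdot> ?u i"
      using assms by (simp add: add_pow_rdistr i del: nat_pow_Suc)
  qed (use assms in auto)
  also have "\<dots> = (\<Oplus>i\<in>{..Suc m}. [(m choose i)] \<cdot> ?u i)"
    using u assms by (subst finsum_Suc) (simp_all add: Pi_def binomial_eq_0)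
  finally have 2: "b \<otimes> (a \<oplus> b) [^] m = (\<Oplus>i\<in>{..Suc m}. [(m choose i)] \<cdot> ?u i)" .
  have "(a \<oplus> b) [^] Suc m = a \<otimes> (a \<oplus> b) [^] m \<oplus> b \<otimes> (a \<oplus> b) [^] m"
    using assms by (simp add: l_distr m_comm[of "(a \<oplus> b) [^] m"])
  also have "\<dots> = (\<Oplus>i\<in>{..Suc m}. [(if i = 0 then 0 else m choose (i - 1))] \<cdot> ?u i \<oplus> [(m choose i)] \<cdot> ?u i)"
    unfolding 1 2 using u by (intro finsum_addf[symmetric]) auto
  also have "\<dots> = (\<Oplus>i\<in>{..Suc m}. [(Suc m choose i)] \<cdot> ?u i)"
  proof (rule finsum_cong')
    fix i
    have "(if i = 0 then 0 else m choose (i - 1)) + (m choose i) = (Suc m choose i)"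
      by (cases i) auto
    then show "[(if i = 0 then 0 else m choose (i - 1))] \<cdot> ?u i \<oplus> [(m choose i)] \<cdot> ?u i = [(Suc m choose i)] \<cdot> ?u i"
      using u[of i] by (simp only: add.nat_pow_mult)
  qed (use u in auto)
  finally show ?case .
qed

lemma add_pow_eq_zero:
  assumes "[p] \<cdot> \<one> = \<zero>" "a \<in> carrier R" "p dvd (m::nat)"
  shows "[m] \<cdot> a = \<zero>"
proof -
  obtain k where k: "m = p * k" using assms(3) by blast
  have "[p] \<cdot> a = ([p] \<cdot> \<one>) \<otimes> a" using assms(2) by (simp add: add_pow_ldistr)
  then have "[p] \<cdot> a = \<zero>" using assms by simp
  then show ?thesis using assms(2) add.nat_pow_pow[of a k p] k by simp
qed

lemma frobenius_prime:
  fixes p :: nat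
  assumes char: "[p] \<cdot> \<one> = \<zero>" and p: "prime p" and ab: "a \<in> carrier R" "b \<in> carrier R"
  shows "(a \<oplus> b) [^] p = a [^] p \<oplus> b [^] p"
proof -
  \<comment> \<open>With p = q + 2 the terms at 0 and p split off, and the middle ones have index i
    + 1 with i \<le> q.\<close>
  obtain q where q: "p = Suc (Suc q)"
    using le_Suc_ex[OF prime_ge_2_nat[OF p]] by auto
  let ?v = "\<lambda>i. [(p choose i)] \<cdot> (a [^] i \<otimes> b [^] (p - i))"
  have v: "?v i \<in> carrier R" for i using ab by simp
  have "(a \<oplus> b) [^] p = (\<Oplus>i\<in>{..p}. ?v i)" by (rule binomial_pow[OF ab])
  also have "\<dots> = ?v p \<oplus> (\<Oplus>i\<in>{..Suc q}. ?v i)"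
    using v unfolding q by (subst finsum_Suc) auto
  also have "(\<Oplus>i\<in>{..Suc q}. ?v i) = (\<Oplus>i\<in>{..q}. ?v (Suc i)) \<oplus> ?v 0"
    using v by (subst finsum_Suc2) auto
  also have "(\<Oplus>i\<in>{..q}. ?v (Suc i)) = \<zero>"
  proof (rule add.finprod_one_eqI)
    fix i assume "i \<in> {..q}"
    then have "p dvd (p choose Suc i)" using q p by (intro dvd_choose_prime) auto
    then show "?v (Suc i) = \<zero>" using ab by (intro add_pow_eq_zero[OF char]) auto
  qed
  finally show ?thesis using ab by simp
qed

lemma frobenius_power:
  fixes p :: nat
  assumes char: "[p] \<cdot> \<one> = \<zero>" and p: "prime p" and ab: "a \<in> carrier R" "b \<in> carrier R"
  shows "(a \<oplus> b) [^] (p ^ k) = a [^] (p ^ k) \<oplus> b [^] (p ^ k)"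
proof (induction k)
  case (Suc k)
  have pow: "x [^] (p ^ Suc k) = (x [^] (p ^ k)) [^] p" if "x \<in> carrier R" for x
    using that by (simp add: nat_pow_pow power_Suc2 del: power_Suc)
  show ?case using ab Suc by (simp add: pow frobenius_prime[OF char p] del: power_Suc)
qed (use ab in simp)

section \<open>The projection onto B/nu(n) as a ring homomorphism\<close>

lemma nu_proj_ring_hom_cring: "ring_hom_cring R (nu_quot n R) (nu_proj n R)"
  using nu_proj_hom is_cring cring_nu_quot by (simp add: ring_hom_cring_def ring_hom_cring_axioms_def)

lemma nu_proj_closed: "a \<in> carrier R \<Longrightarrow> nu_proj n R a \<in> carrier (nu_quot n R)"
  by (rule ring_hom_closed[OF nu_proj_hom])

lemma nu_proj_zero: "nu_proj n R \<zero> = \<zero>\<^bsub>nu_quot n R\<^esub>"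
  by (rule ring_hom_cring.hom_zero[OF nu_proj_ring_hom_cring])

lemma nu_proj_neg: "a \<in> carrier R \<Longrightarrow> nu_proj n R (\<ominus> a) = \<ominus>\<^bsub>nu_quot n R\<^esub> nu_proj n R a"
  by (rule ring_hom_cring.hom_a_inv[OF nu_proj_ring_hom_cring])

lemma nu_proj_pow:
  "a \<in> carrier R \<Longrightarrow> nu_proj n R (a [^] (m::nat)) = nu_proj n R a [^]\<^bsub>nu_quot n R\<^esub> m"
  by (rule ring_hom_cring.hom_nat_power[OF nu_proj_ring_hom_cring])

lemma nu_proj_add:
  "a \<in> carrier R \<Longrightarrow> b \<in> carrier R \<Longrightarrow>
    nu_proj n R (a \<oplus> b) = nu_proj n R a \<oplus>\<^bsub>nu_quot n R\<^esub> nu_proj n R b"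
  by (rule ring_hom_add[OF nu_proj_hom])

lemma nu_proj_mult:
  "a \<in> carrier R \<Longrightarrow> b \<in> carrier R \<Longrightarrow>
    nu_proj n R (a \<otimes> b) = nu_proj n R a \<otimes>\<^bsub>nu_quot n R\<^esub> nu_proj n R b"
  by (rule ring_hom_mult[OF nu_proj_hom])

lemma nu_proj_minus:
  "a \<in> carrier R \<Longrightarrow> b \<in> carrier R \<Longrightarrow>
    nu_proj n R (a \<ominus> b) = nu_proj n R a \<ominus>\<^bsub>nu_quot n R\<^esub> nu_proj n R b"
  by (simp add: a_minus_def nu_proj_add nu_proj_neg)

lemmas nu_proj_ring = nu_proj_closed nu_proj_zero nu_proj_neg nu_proj_pow nu_proj_add nu_proj_mult
  nu_proj_minus

lemma nu_char: "[nu n] \<cdot>\<^bsub>nu_quot n R\<^esub> \<one>\<^bsub>nu_quot n R\<^esub> = \<zero>\<^bsub>nu_quot n R\<^esub>"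
proof -
  have "nu_proj n R ([nu n] \<cdot> \<one>) = nu_proj n R \<zero>"
    by (subst nu_proj_eq_iff) (simp_all add: nu_in_nu_ideal a_minus_def)
  then show ?thesis
    by (simp add: ring_hom_cring.hom_nat_one[OF nu_proj_ring_hom_cring] nu_proj_zero)
qed

end

lemma primepow_nu:
  assumes "primepow n"
  shows "prime (nu n)" "nu n dvd n" "\<exists>k. n = nu n ^ k"
proof -
  have n: "n \<noteq> Suc 0" using primepow_gt_Suc_0[OF assms] by simp
  show "prime (nu n)" "nu n dvd n" using aprimedivisor_nat[OF n] assms by (auto simp: nu_def)
  show "\<exists>k. n = nu n ^ k" using primepow_decompose[OF assms] assms by (metis nu_def)
qed

context cring
begin

text \<open>Both differentials involve b^n and must be additive in b; this makes them well defined.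
  B/nu(n) has characteristic nu(n), a prime of which n is a power.\<close>

lemma nu_proj_pow_add:
  assumes n: "primepow n" and ab: "a \<in> carrier R" "b \<in> carrier R"
  shows "nu_proj n R ((a \<oplus> b) [^] n) = nu_proj n R (a [^] n \<oplus> b [^] n)"
proof -
  interpret Q: cring "nu_quot n R" by (rule cring_nu_quot)
  obtain k where k: "n = nu n ^ k" using primepow_nu[OF n] by blast
  have "(nu_proj n R a \<oplus>\<^bsub>nu_quot n R\<^esub> nu_proj n R b) [^]\<^bsub>nu_quot n R\<^esub> (nu n ^ k) =
      nu_proj n R a [^]\<^bsub>nu_quot n R\<^esub> (nu n ^ k) \<oplus>\<^bsub>nu_quot n R\<^esub> nu_proj n R b [^]\<^bsub>nu_quot n R\<^esub> (nu n ^ k)"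
    by (rule Q.frobenius_power[OF nu_char primepow_nu(1)[OF n]]) (use ab in \<open>auto simp: nu_proj_ring\<close>)
  then show ?thesis using ab by (simp add: nu_proj_ring k[symmetric])
qed


section \<open>Finiteness of the reduction modulo nu\<close>

text \<open>Generators are adjoined one at a time to a finite set that contains zero and is closed
  under addition. Negation is left out of the invariant, being an iterated sum in positive
  characteristic.\<close>

lemma finite_nu_quot:
  assumes p: "nu n > 0" and S: "finite S" "S \<subseteq> carrier R" "generate (add_monoid R) S = carrier R"
  shows "finite (carrier (nu_quot n R))"
proof -
  interpret Q: cring "nu_quot n R" by (rule cring_nu_quot)
  let ?Q = "nu_quot n R" let ?\<pi> = "nu_proj n R"
  have "\<exists>T. finite T \<and> T \<subseteq> carrier ?Q \<and> \<zero>\<^bsub>?Q\<^esub> \<in> T \<and> (\<forall>x\<in>T. \<forall>y\<in>T. x \<oplus>\<^bsub>?Q\<^esub> y \<in> T) \<and> ?\<pi> ` S \<subseteq> T"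
    using S(1,2)
  proof (induction S rule: finite_induct)
    case empty
    show ?case by (rule exI[of _ "{\<zero>\<^bsub>?Q\<^esub>}"]) auto
  next
    case (insert s S)
    have "S \<subseteq> carrier R" using insert.prems by simp
    from insert.IH[OF this] obtain T where T: "finite T" "T \<subseteq> carrier ?Q" "\<zero>\<^bsub>?Q\<^esub> \<in> T" "?\<pi> ` S \<subseteq> T"
      and "\<forall>x\<in>T. \<forall>y\<in>T. x \<oplus>\<^bsub>?Q\<^esub> y \<in> T"
      by (elim exE conjE)
    then have Tadd: "\<And>x y. x \<in> T \<Longrightarrow> y \<in> T \<Longrightarrow> x \<oplus>\<^bsub>?Q\<^esub> y \<in> T" by blast
    have s: "?\<pi> s \<in> carrier ?Q" using insert.prems by (simp add: nu_proj_ring)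
    define g where "g = (\<lambda>(t, j::nat). t \<oplus>\<^bsub>?Q\<^esub> [j] \<cdot>\<^bsub>?Q\<^esub> ?\<pi> s)"
    \<comment> \<open>Multiples of the new generator depend only on j modulo nu(n), so
      \<open>{..<nu n}\<close> suffices as the range of j.\<close>
    have mod: "[j] \<cdot>\<^bsub>?Q\<^esub> ?\<pi> s = [(j mod nu n)] \<cdot>\<^bsub>?Q\<^esub> ?\<pi> s" for j
    proof -
      have "[j] \<cdot>\<^bsub>?Q\<^esub> ?\<pi> s = [(nu n * (j div nu n))] \<cdot>\<^bsub>?Q\<^esub> ?\<pi> s \<oplus>\<^bsub>?Q\<^esub> [(j mod nu n)] \<cdot>\<^bsub>?Q\<^esub> ?\<pi> s"
        using s by (simp add: Q.add.nat_pow_mult)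
      also have "[(nu n * (j div nu n))] \<cdot>\<^bsub>?Q\<^esub> ?\<pi> s = \<zero>\<^bsub>?Q\<^esub>"
        by (rule Q.add_pow_eq_zero[OF nu_char s]) simp
      finally show ?thesis using s by simp
    qed
    have gT: "g (t, j) \<in> g ` (T \<times> {..<nu n})" if "t \<in> T" for t j
      using that p mod[of j] by (intro image_eqI[of _ _ "(t, j mod nu n)"]) (auto simp: g_def)
    have 1: "g (t, j) \<oplus>\<^bsub>?Q\<^esub> g (t', j') = g (t \<oplus>\<^bsub>?Q\<^esub> t', j + j')" if "t \<in> T" "t' \<in> T" for t j t' j'
    proof -
      have "t \<in> carrier ?Q" "t' \<in> carrier ?Q" using that T by auto
      then show ?thesis using s by (simp add: g_def Q.add.nat_pow_mult[symmetric] Q.a_ac)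
    qed
    have g0: "g (t, 0) = t" if "t \<in> T" for t using that T by (auto simp: g_def)
    have g1: "g (\<zero>\<^bsub>?Q\<^esub>, 1) = ?\<pi> s" using s by (simp add: g_def)
    show ?case
    proof (intro exI[of _ "g ` (T \<times> {..<nu n})"] conjI ballI)
      show "finite (g ` (T \<times> {..<nu n}))" using T(1) by simp
      show "g ` (T \<times> {..<nu n}) \<subseteq> carrier ?Q" using T s by (auto simp: g_def)
      show "\<zero>\<^bsub>?Q\<^esub> \<in> g ` (T \<times> {..<nu n})" using gT[OF T(3), of 0] g0[OF T(3)] by simp
      show "x \<oplus>\<^bsub>?Q\<^esub> y \<in> g ` (T \<times> {..<nu n})" if "x \<in> g ` (T \<times> {..<nu n})" "y \<in> g ` (T \<times> {..<nu n})" for x y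
        using that by (auto simp: 1 intro!: gT Tadd)
      have "?\<pi> s \<in> g ` (T \<times> {..<nu n})" using gT[OF T(3), of 1] g1 by simp
      moreover have "?\<pi> x \<in> g ` (T \<times> {..<nu n})" if "x \<in> S" for x
      proof -
        have x: "?\<pi> x \<in> T" using that T(4) by blast
        show ?thesis using gT[OF x, of 0] g0[OF x] by simp
      qed
      ultimately show "?\<pi> ` insert s S \<subseteq> g ` (T \<times> {..<nu n})" by blast
    qed
  qed
  then obtain T where T: "finite T" "T \<subseteq> carrier ?Q" "\<zero>\<^bsub>?Q\<^esub> \<in> T" "?\<pi> ` S \<subseteq> T"
    and "\<forall>x\<in>T. \<forall>y\<in>T. x \<oplus>\<^bsub>?Q\<^esub> y \<in> T"
    by (elim exE conjE)
  then have Tadd: "\<And>x y. x \<in> T \<Longrightarrow> y \<in> T \<Longrightarrow> x \<oplus>\<^bsub>?Q\<^esub> y \<in> T" by blast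
  \<comment> \<open>In characteristic nu(n), the negative of x is x added nu(n) - 1 times.\<close>
  have Tneg: "\<ominus>\<^bsub>?Q\<^esub> x \<in> T" if x: "x \<in> T" for x
  proof -
    have xc: "x \<in> carrier ?Q" using x T(2) by blast
    have mult: "[j] \<cdot>\<^bsub>?Q\<^esub> x \<in> T" for j :: nat
      by (induction j) (use x T(3) Tadd in \<open>auto simp: Q.add.nat_pow_Suc\<close>)
    have "[(nu n - 1)] \<cdot>\<^bsub>?Q\<^esub> x \<oplus>\<^bsub>?Q\<^esub> x = [nu n] \<cdot>\<^bsub>?Q\<^esub> x"
      using p xc Q.add.nat_pow_Suc[of "nu n - 1" x] by simp
    also have "\<dots> = \<zero>\<^bsub>?Q\<^esub>" by (rule Q.add_pow_eq_zero[OF nu_char xc]) simp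
    finally have "\<ominus>\<^bsub>?Q\<^esub> x = [(nu n - 1)] \<cdot>\<^bsub>?Q\<^esub> x"
      using xc by (intro Q.minus_equality) auto
    then show ?thesis using mult by simp
  qed
  have "?\<pi> x \<in> T" if "x \<in> generate (add_monoid R) S" for x
    using that
  proof (induction rule: generate.induct)
    case one
    then show ?case using T(3) by (simp add: nu_proj_zero)
  next
    case (incl h)
    then show ?case using T(4) by blast
  next
    case (inv h)
    then have h: "h \<in> carrier R" "?\<pi> h \<in> T" using S(2) T(4) by auto
    then show ?case using Tneg[OF h(2)] nu_proj_neg[OF h(1)] by (simp add: a_inv_def)
  next
    case (eng h1 h2)
    then have "h1 \<in> carrier R" "h2 \<in> carrier R" using S(3) by auto
    then show ?case using eng Tadd by (simp add: nu_proj_ring)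
  qed
  then have "?\<pi> ` carrier R \<subseteq> T" using S(3) by auto
  then have "carrier ?Q \<subseteq> T" by (simp only: nu_proj_image)
  then show ?thesis using T(1) finite_subset by blast
qed

text \<open>Pigeonhole on the power maps as elements of a finite function space, rather than on
  single orbits, so that i and N serve all b at once.\<close>

lemma eventually_periodic:
  assumes fin: "finite (carrier (nu_quot n R))"
  shows "\<exists>i N. N > 0 \<and> (\<forall>b\<in>carrier R. nu_proj n R (b [^] (n ^ i)) = nu_proj n R (b [^] (n ^ (i + N))))"
proof -
  interpret Q: cring "nu_quot n R" by (rule cring_nu_quot)
  let ?Q = "nu_quot n R"
  \<comment> \<open>Restriction to the carrier puts \<open>f j\<close> into the finite set of
    extensional self-maps.\<close>
  define f where "f j = (\<lambda>x\<in>carrier ?Q. x [^]\<^bsub>?Q\<^esub> (n ^ j))" for j :: nat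
  have "range f \<subseteq> carrier ?Q \<rightarrow>\<^sub>E carrier ?Q" by (auto simp: f_def)
  then have "finite (range f)" using fin finite_PiE[of "carrier ?Q" "\<lambda>_. carrier ?Q"] finite_subset by blast
  then have "\<not> inj f" using finite_imageD infinite_UNIV_nat by blast
  then obtain i j where ij: "f i = f j" "i \<noteq> j" by (auto simp: inj_def)
  obtain i j where ij: "f i = f j" "i < j"
    using ij by (metis nat_neq_iff)
  show ?thesis
  proof (rule exI[of _ i], rule exI[of _ "j - i"], intro conjI ballI)
    fix b assume b: "b \<in> carrier R"
    have "f i (nu_proj n R b) = f j (nu_proj n R b)" using ij by simp
    then show "nu_proj n R (b [^] (n ^ i)) = nu_proj n R (b [^] (n ^ (i + (j - i))))"
      using b ij(2) by (simp add: f_def nu_proj_ring)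
  qed (use ij in simp)
qed

end

section \<open>Cycles of twisted derivations\<close>

lemma U_zero_sel [simp]:
  "carrier (U_zero n R) = carrier (nu_quot n R)" "\<zero>\<^bsub>U_zero n R\<^esub> = \<zero>\<^bsub>nu_quot n R\<^esub>"
  "x \<oplus>\<^bsub>U_zero n R\<^esub> y = x \<oplus>\<^bsub>nu_quot n R\<^esub> y" "r \<odot>\<^bsub>U_zero n R\<^esub> x = nu_proj n R r \<otimes>\<^bsub>nu_quot n R\<^esub> x"
  by (simp_all add: U_zero_def)

lemma (in cring) module_U_zero: "module R (U_zero n R)"
  unfolding U_zero_def
  by (rule module_restrict_scalars[OF is_cring nu_proj_hom ring_as_module[OF cring_nu_quot]])

text \<open>Here P need not be stable under scalars: the induction carries P for all multiples of x.
  The properties proved by it ask for a ring element y tied to x, and stability under scalars is not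
  evident for them.\<close>

lemma (in module) span_induct_smult:
  assumes Z: "Z \<subseteq> carrier M" and x: "x \<in> span_submodule R M Z"
    and zero: "P \<zero>\<^bsub>M\<^esub>"
    and add: "\<And>x y. x \<in> carrier M \<Longrightarrow> y \<in> carrier M \<Longrightarrow> P x \<Longrightarrow> P y \<Longrightarrow> P (x \<oplus>\<^bsub>M\<^esub> y)"
    and gen: "\<And>r z. r \<in> carrier R \<Longrightarrow> z \<in> Z \<Longrightarrow> P (r \<odot>\<^bsub>M\<^esub> z)"
  shows "P x"
proof -
  have "submodule {x \<in> carrier M. \<forall>r\<in>carrier R. P (r \<odot>\<^bsub>M\<^esub> x)} R M"
    by (rule submoduleI2) (auto simp: zero add smult_r_distr smult_assoc1[symmetric])
  then have "span_submodule R M Z \<subseteq> {x \<in> carrier M. \<forall>r\<in>carrier R. P (r \<odot>\<^bsub>M\<^esub> x)}"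
    by (rule span_least) (use Z gen in auto)
  then have "x \<in> carrier M" "P (\<one> \<odot>\<^bsub>M\<^esub> x)" using x by auto
  then show ?thesis by simp
qed

text \<open>D stands for degree-one chains modulo boundaries, \<open>d b\<close> for the class of
  c_b and \<open>bd\<close> for the induced differential. The rule \<open>d_mult\<close> expresses
  that the boundary of c_a (x) c_b vanishes in D, so the kernel of \<open>bd\<close> is H_1.\<close>

locale twisted_derivation = module R D for R (structure) and D (structure) +
  fixes n :: nat and d :: "'a \<Rightarrow> 'c" and bd :: "'c \<Rightarrow> 'a set"
  assumes primepow: "primepow n"
    and d_closed [simp, intro]: "b \<in> carrier R \<Longrightarrow> d b \<in> carrier D"
    and d_add: "a \<in> carrier R \<Longrightarrow> b \<in> carrier R \<Longrightarrow> d (a \<oplus>\<^bsub>R\<^esub> b) = d a \<oplus>\<^bsub>D\<^esub> d b"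
    and d_mult: "a \<in> carrier R \<Longrightarrow> b \<in> carrier R \<Longrightarrow>
      d (a \<otimes>\<^bsub>R\<^esub> b) = a \<odot>\<^bsub>D\<^esub> d b \<oplus>\<^bsub>D\<^esub> (b [^]\<^bsub>R\<^esub> n) \<odot>\<^bsub>D\<^esub> d a"
    and nu_kill: "z \<in> carrier D \<Longrightarrow> ([nu n] \<cdot>\<^bsub>R\<^esub> \<one>\<^bsub>R\<^esub>) \<odot>\<^bsub>D\<^esub> z = \<zero>\<^bsub>D\<^esub>"
    and span_d: "span_submodule R D (d ` carrier R) = carrier D"
    and bd_hom: "bd \<in> lin_hom R D (U_zero n R)"
    and bd_d: "b \<in> carrier R \<Longrightarrow> bd (d b) = nu_proj n R (b \<ominus>\<^bsub>R\<^esub> b [^]\<^bsub>R\<^esub> n)"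
    and finite_quot: "finite (carrier (nu_quot n R))"
begin

lemma kill: "a \<in> nu_ideal n R \<Longrightarrow> z \<in> carrier D \<Longrightarrow> a \<odot>\<^bsub>D\<^esub> z = \<zero>\<^bsub>D\<^esub>"
  by (rule R.nu_ideal_kills[OF module_axioms nu_kill])

lemma d_zero: "d \<zero>\<^bsub>R\<^esub> = \<zero>\<^bsub>D\<^esub>"
proof -
  have "d \<zero>\<^bsub>R\<^esub> = d \<zero>\<^bsub>R\<^esub> \<oplus>\<^bsub>D\<^esub> d \<zero>\<^bsub>R\<^esub>" by (subst d_add[symmetric]) simp_all
  then show ?thesis using M.add.r_cancel_one' by blast
qed

lemma d_minus:
  assumes "a \<in> carrier R" "b \<in> carrier R"
  shows "d (a \<ominus>\<^bsub>R\<^esub> b) = d a \<ominus>\<^bsub>D\<^esub> d b"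
proof -
  have "d (\<ominus>\<^bsub>R\<^esub> b) \<oplus>\<^bsub>D\<^esub> d b = \<zero>\<^bsub>D\<^esub>"
    using assms by (simp add: d_add[symmetric] R.l_neg d_zero)
  then have "\<ominus>\<^bsub>D\<^esub> d b = d (\<ominus>\<^bsub>R\<^esub> b)" using assms by (intro M.minus_equality) auto
  then show ?thesis using assms by (simp add: a_minus_def d_add)
qed

text \<open>From d 1 = d 1 + d 1 one gets d 1 = 0, hence d p = 0 for p = nu(n). Then d(bp) = b dp +
  p^n db = 0, since n > 0 and p annihilates D.\<close>

lemma d_nu_ideal:
  assumes "a \<in> nu_ideal n R"
  shows "d a = \<zero>\<^bsub>D\<^esub>"
proof -
  let ?p = "[nu n] \<cdot>\<^bsub>R\<^esub> \<one>\<^bsub>R\<^esub>"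
  have "d \<one>\<^bsub>R\<^esub> = \<zero>\<^bsub>D\<^esub>"
    using d_mult[of "\<one>\<^bsub>R\<^esub>" "\<one>\<^bsub>R\<^esub>"] M.add.r_cancel_one'[of "d \<one>\<^bsub>R\<^esub>" "d \<one>\<^bsub>R\<^esub>"] by simp
  then have "d ([m] \<cdot>\<^bsub>R\<^esub> \<one>\<^bsub>R\<^esub>) = \<zero>\<^bsub>D\<^esub>" for m :: nat
    by (induction m) (simp_all add: R.add.nat_pow_Suc d_add d_zero)
  moreover obtain b where b: "b \<in> carrier R" "a = b \<otimes>\<^bsub>R\<^esub> ?p"
    using assms by (auto simp: R.nu_ideal_iff)
  moreover have "(?p [^]\<^bsub>R\<^esub> n) \<odot>\<^bsub>D\<^esub> d b = \<zero>\<^bsub>D\<^esub>"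
  proof -
    obtain m where m: "n = Suc m" using primepow_gt_0_nat[OF primepow] by (cases n) auto
    have "(?p [^]\<^bsub>R\<^esub> n) \<odot>\<^bsub>D\<^esub> d b = (?p [^]\<^bsub>R\<^esub> m) \<odot>\<^bsub>D\<^esub> (?p \<odot>\<^bsub>D\<^esub> d b)"
      unfolding m R.nat_pow_Suc using b by (intro smult_assoc1) auto
    then show ?thesis using b by (simp add: nu_kill)
  qed
  ultimately show ?thesis by (simp add: d_mult)
qed

lemma d_cong:
  assumes "a \<in> carrier R" "b \<in> carrier R" "nu_proj n R a = nu_proj n R b"
  shows "d a = d b"
proof (rule minus_eq_zeroD)
  have "a \<ominus>\<^bsub>R\<^esub> b \<in> nu_ideal n R" using assms by (simp add: R.nu_proj_eq_iff)
  then show "d a \<ominus>\<^bsub>D\<^esub> d b = \<zero>\<^bsub>D\<^esub>" using assms by (simp only: d_minus[symmetric] d_nu_ideal)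
qed (use assms in auto)

text \<open>A decreasing chain of submodules starting with D, since b^(n^(j+1)) is the n^j-th power
  of b^n. All cycles survive to every stage.\<close>

abbreviation frob_span :: "nat \<Rightarrow> 'c set"
  where "frob_span j \<equiv> span_submodule R D ((\<lambda>b. d (b [^]\<^bsub>R\<^esub> (n ^ j))) ` carrier R)"

lemma frob_span_submodule: "submodule (frob_span j) R D"
  by (rule span_submodule) auto

text \<open>
  The identity \<open>a db = d(ab - ab\<^sup>n) + a\<^sup>n d(b\<^sup>n)\<close> shows that the map \<open>a db \<mapsto> a\<^sup>n d(b\<^sup>n)\<close> is chain homotopic
  to the identity.
\<close>

lemma frobenius_homotopy:
  assumes z: "z \<in> frob_span j"
  shows "\<exists>y\<in>carrier R. bd z = nu_proj n R y \<and> (\<exists>w\<in>frob_span (Suc j). z = d y \<oplus>\<^bsub>D\<^esub> w)"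
proof (rule span_induct_smult[OF _ z])
  note S = frob_span_submodule[of "Suc j"]
  show "\<exists>y\<in>carrier R. bd \<zero>\<^bsub>D\<^esub> = nu_proj n R y \<and> (\<exists>w\<in>frob_span (Suc j). \<zero>\<^bsub>D\<^esub> = d y \<oplus>\<^bsub>D\<^esub> w)"
  proof (intro bexI conjI)
    show "bd \<zero>\<^bsub>D\<^esub> = nu_proj n R \<zero>\<^bsub>R\<^esub>"
      by (simp add: lin_hom_zero[OF module_axioms R.module_U_zero bd_hom] R.nu_proj_zero)
    show "\<zero>\<^bsub>D\<^esub> = d \<zero>\<^bsub>R\<^esub> \<oplus>\<^bsub>D\<^esub> \<zero>\<^bsub>D\<^esub>" by (simp add: d_zero)
  qed (use submodule_zero[OF S] in simp_all)
next
  note S = frob_span_submodule[of "Suc j"]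
  fix z z' assume zc: "z \<in> carrier D" "z' \<in> carrier D"
  assume "\<exists>y\<in>carrier R. bd z = nu_proj n R y \<and> (\<exists>w\<in>frob_span (Suc j). z = d y \<oplus>\<^bsub>D\<^esub> w)"
    and "\<exists>y\<in>carrier R. bd z' = nu_proj n R y \<and> (\<exists>w\<in>frob_span (Suc j). z' = d y \<oplus>\<^bsub>D\<^esub> w)"
  then obtain y y' w w' where y: "y \<in> carrier R" "y' \<in> carrier R"
    and b: "bd z = nu_proj n R y" "bd z' = nu_proj n R y'"
    and w: "w \<in> frob_span (Suc j)" "w' \<in> frob_span (Suc j)"
    and e: "z = d y \<oplus>\<^bsub>D\<^esub> w" "z' = d y' \<oplus>\<^bsub>D\<^esub> w'"
    by (elim bexE conjE)
  have wc: "w \<in> carrier D" "w' \<in> carrier D" using w submoduleE(1)[OF S] by auto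
  show "\<exists>y\<in>carrier R. bd (z \<oplus>\<^bsub>D\<^esub> z') = nu_proj n R y \<and> (\<exists>w\<in>frob_span (Suc j). z \<oplus>\<^bsub>D\<^esub> z' = d y \<oplus>\<^bsub>D\<^esub> w)"
  proof (intro bexI conjI)
    show "bd (z \<oplus>\<^bsub>D\<^esub> z') = nu_proj n R (y \<oplus>\<^bsub>R\<^esub> y')"
      using zc y by (simp add: lin_hom_add[OF bd_hom] b R.nu_proj_add)
    show "z \<oplus>\<^bsub>D\<^esub> z' = d (y \<oplus>\<^bsub>R\<^esub> y') \<oplus>\<^bsub>D\<^esub> (w \<oplus>\<^bsub>D\<^esub> w')"
      using y wc unfolding e by (simp add: d_add M.a_ac)
    show "w \<oplus>\<^bsub>D\<^esub> w' \<in> frob_span (Suc j)" using w by (rule submoduleE(5)[OF S])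
  qed (use y in simp)
next
  note S = frob_span_submodule[of "Suc j"]
  fix a z assume a: "a \<in> carrier R" and "z \<in> (\<lambda>b. d (b [^]\<^bsub>R\<^esub> (n ^ j))) ` carrier R"
  then obtain b where b: "b \<in> carrier R" and z: "z = d (b [^]\<^bsub>R\<^esub> (n ^ j))" by blast
  define c where "c = b [^]\<^bsub>R\<^esub> (n ^ j)"
  have c: "c \<in> carrier R" using b by (simp add: c_def)
  \<comment> \<open>The order of the factors matters: d(c^n a) = c^n da + a^n d(c^n), and its first
    term cancels against the one in d(ac) = a dc + c^n da. At the same time y lifts the boundary of
    a dc.\<close>
  define y where "y = a \<otimes>\<^bsub>R\<^esub> c \<ominus>\<^bsub>R\<^esub> c [^]\<^bsub>R\<^esub> n \<otimes>\<^bsub>R\<^esub> a"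
  have cn: "c [^]\<^bsub>R\<^esub> n = b [^]\<^bsub>R\<^esub> (n ^ Suc j)"
    using b by (simp add: c_def R.nat_pow_pow mult.commute)
  have yc: "y \<in> carrier R" using a c by (simp add: y_def)
  show "\<exists>y\<in>carrier R. bd (a \<odot>\<^bsub>D\<^esub> z) = nu_proj n R y \<and> (\<exists>w\<in>frob_span (Suc j). a \<odot>\<^bsub>D\<^esub> z = d y \<oplus>\<^bsub>D\<^esub> w)"
  proof (intro bexI conjI)
    have "y = a \<otimes>\<^bsub>R\<^esub> (c \<ominus>\<^bsub>R\<^esub> c [^]\<^bsub>R\<^esub> n)"
      using a c by (simp add: y_def a_minus_def R.r_distr R.r_minus R.m_comm[of a "c [^]\<^bsub>R\<^esub> n"])
    then show "bd (a \<odot>\<^bsub>D\<^esub> z) = nu_proj n R y"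
      using a c by (simp add: z c_def[symmetric] lin_hom_smult[OF bd_hom] bd_d R.nu_proj_mult)
    have "d y = a \<odot>\<^bsub>D\<^esub> d c \<ominus>\<^bsub>D\<^esub> (a [^]\<^bsub>R\<^esub> n) \<odot>\<^bsub>D\<^esub> d (c [^]\<^bsub>R\<^esub> n)"
    proof -
      let ?u = "a \<odot>\<^bsub>D\<^esub> d c" and ?v = "(c [^]\<^bsub>R\<^esub> n) \<odot>\<^bsub>D\<^esub> d a"
        and ?w = "(a [^]\<^bsub>R\<^esub> n) \<odot>\<^bsub>D\<^esub> d (c [^]\<^bsub>R\<^esub> n)"
      have uvw: "?u \<in> carrier D" "?v \<in> carrier D" "?w \<in> carrier D" using a c by auto
      have "d y = (?u \<oplus>\<^bsub>D\<^esub> ?v) \<ominus>\<^bsub>D\<^esub> (?v \<oplus>\<^bsub>D\<^esub> ?w)"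
        using a c by (simp add: y_def d_minus d_mult)
      also have "\<dots> = ?u \<oplus>\<^bsub>D\<^esub> (?v \<oplus>\<^bsub>D\<^esub> \<ominus>\<^bsub>D\<^esub> ?v) \<oplus>\<^bsub>D\<^esub> \<ominus>\<^bsub>D\<^esub> ?w"
        using uvw by (simp add: a_minus_def M.minus_add M.a_ac)
      also have "\<dots> = ?u \<ominus>\<^bsub>D\<^esub> ?w" using uvw by (simp only: M.r_neg M.r_zero a_minus_def)
      finally show ?thesis .
    qed
    then show "a \<odot>\<^bsub>D\<^esub> z = d y \<oplus>\<^bsub>D\<^esub> (a [^]\<^bsub>R\<^esub> n) \<odot>\<^bsub>D\<^esub> d (c [^]\<^bsub>R\<^esub> n)"
      using a c by (simp add: z c_def[symmetric] a_minus_def M.a_assoc M.l_neg)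
    have "d (c [^]\<^bsub>R\<^esub> n) \<in> frob_span (Suc j)"
      unfolding cn by (rule subsetD[OF span_incl imageI[OF b]])
    then show "(a [^]\<^bsub>R\<^esub> n) \<odot>\<^bsub>D\<^esub> d (c [^]\<^bsub>R\<^esub> n) \<in> frob_span (Suc j)"
      using a by (intro submoduleE(4)[OF S]) auto
  qed (use yc in simp)
qed auto

text \<open>For a cycle, the lift y from \<open>frobenius_homotopy\<close> is zero modulo nu(n), so
  d y = 0 and z lies in the next stage.\<close>

lemma cycle_in_frob_span:
  assumes z: "z \<in> carrier D" "bd z = \<zero>\<^bsub>nu_quot n R\<^esub>"
  shows "z \<in> frob_span j"
proof (induction j)
  case 0
  have "(\<lambda>b. d (b [^]\<^bsub>R\<^esub> (n ^ 0))) ` carrier R = d ` carrier R"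
    by (rule image_cong) auto
  then show ?case using z(1) span_d by simp
next
  case (Suc j)
  from frobenius_homotopy[OF this] obtain y w where y: "y \<in> carrier R" "bd z = nu_proj n R y"
    and w: "w \<in> frob_span (Suc j)" "z = d y \<oplus>\<^bsub>D\<^esub> w" by blast
  have "d y = d \<zero>\<^bsub>R\<^esub>"
    using y z(2) by (intro d_cong) (auto simp: R.nu_proj_zero)
  moreover have "w \<in> carrier D" using w(1) submoduleE(1)[OF frob_span_submodule] by blast
  ultimately have "z = w" using w(2) by (simp add: d_zero)
  then show ?case using w(1) by simp
qed

text \<open>A cycle z that is fixed by some v in this ideal satisfies z = v z = 0; such a v is what
  the rest of the locale constructs.\<close>

definition annihilator :: "'a set"
  where "annihilator =
    {r \<in> carrier R. \<forall>z\<in>carrier D. bd z = \<zero>\<^bsub>nu_quot n R\<^esub> \<longrightarrow> r \<odot>\<^bsub>D\<^esub> z = \<zero>\<^bsub>D\<^esub>}"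

lemma annihilator_mult: "r \<in> annihilator \<Longrightarrow> s \<in> carrier R \<Longrightarrow> r \<otimes>\<^bsub>R\<^esub> s \<in> annihilator"
  by (simp add: annihilator_def smult_assoc1 smult_left_comm[of r s])

lemma annihilator_add: "r \<in> annihilator \<Longrightarrow> s \<in> annihilator \<Longrightarrow> r \<oplus>\<^bsub>R\<^esub> s \<in> annihilator"
  by (simp add: annihilator_def smult_l_distr)

lemma annihilator_minus: "r \<in> annihilator \<Longrightarrow> s \<in> annihilator \<Longrightarrow> r \<ominus>\<^bsub>R\<^esub> s \<in> annihilator"
  by (simp add: annihilator_def a_minus_def smult_l_distr smult_l_minus)

text \<open>Expanding d(xb) = d(bx) in both ways gives (x - x^n) db = (b - b^n) dx, where b - b^n
  lifts the boundary of db. No generators of the module of cycles are at hand, so the identity is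
  extended to all of D and specialized to cycles afterwards.\<close>

lemma diff_smult:
  assumes x: "x \<in> carrier R" and z: "z \<in> carrier D"
  shows "\<exists>y\<in>carrier R. bd z = nu_proj n R y \<and> (x \<ominus>\<^bsub>R\<^esub> x [^]\<^bsub>R\<^esub> n) \<odot>\<^bsub>D\<^esub> z = y \<odot>\<^bsub>D\<^esub> d x"
proof -
  let ?w = "x \<ominus>\<^bsub>R\<^esub> x [^]\<^bsub>R\<^esub> n"
  have w: "?w \<in> carrier R" using x by simp
  have *: "?w \<odot>\<^bsub>D\<^esub> d b = (b \<ominus>\<^bsub>R\<^esub> b [^]\<^bsub>R\<^esub> n) \<odot>\<^bsub>D\<^esub> d x" if b: "b \<in> carrier R" for b
  proof -
    let ?p = "x \<odot>\<^bsub>D\<^esub> d b" and ?q = "(b [^]\<^bsub>R\<^esub> n) \<odot>\<^bsub>D\<^esub> d x"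
      and ?r = "b \<odot>\<^bsub>D\<^esub> d x" and ?s = "(x [^]\<^bsub>R\<^esub> n) \<odot>\<^bsub>D\<^esub> d b"
    have c: "?p \<in> carrier D" "?q \<in> carrier D" "?r \<in> carrier D" "?s \<in> carrier D" using b x by auto
    have e: "?p \<oplus>\<^bsub>D\<^esub> ?q = ?r \<oplus>\<^bsub>D\<^esub> ?s"
      using b x by (simp add: d_mult[symmetric] R.m_comm)
    have "?p \<ominus>\<^bsub>D\<^esub> ?s = (?p \<oplus>\<^bsub>D\<^esub> ?q) \<ominus>\<^bsub>D\<^esub> (?s \<oplus>\<^bsub>D\<^esub> ?q)"
    proof -
      have "(?p \<oplus>\<^bsub>D\<^esub> ?q) \<ominus>\<^bsub>D\<^esub> (?s \<oplus>\<^bsub>D\<^esub> ?q) = ?p \<oplus>\<^bsub>D\<^esub> \<ominus>\<^bsub>D\<^esub> ?s \<oplus>\<^bsub>D\<^esub> (?q \<oplus>\<^bsub>D\<^esub> \<ominus>\<^bsub>D\<^esub> ?q)"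
        using c by (simp add: a_minus_def M.minus_add M.a_ac)
      then show ?thesis using c by (simp add: M.r_neg a_minus_def)
    qed
    also have "\<dots> = (?r \<oplus>\<^bsub>D\<^esub> ?s) \<ominus>\<^bsub>D\<^esub> (?s \<oplus>\<^bsub>D\<^esub> ?q)" by (simp only: e)
    also have "\<dots> = ?r \<oplus>\<^bsub>D\<^esub> \<ominus>\<^bsub>D\<^esub> ?q \<oplus>\<^bsub>D\<^esub> (?s \<oplus>\<^bsub>D\<^esub> \<ominus>\<^bsub>D\<^esub> ?s)"
      using c by (simp add: a_minus_def M.minus_add M.a_ac)
    also have "\<dots> = ?r \<ominus>\<^bsub>D\<^esub> ?q" using c by (simp add: M.r_neg a_minus_def)
    finally show ?thesis using b x by (simp add: a_minus_def smult_l_distr smult_l_minus)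
  qed
  show ?thesis
  proof (rule span_induct_smult[of "d ` carrier R" z])
    show "\<exists>y\<in>carrier R. bd \<zero>\<^bsub>D\<^esub> = nu_proj n R y \<and> ?w \<odot>\<^bsub>D\<^esub> \<zero>\<^bsub>D\<^esub> = y \<odot>\<^bsub>D\<^esub> d x"
      using x w by (intro bexI[of _ "\<zero>\<^bsub>R\<^esub>"])
        (auto simp: lin_hom_zero[OF module_axioms R.module_U_zero bd_hom] R.nu_proj_zero)
  next
    fix z z' assume zc: "z \<in> carrier D" "z' \<in> carrier D"
    assume "\<exists>y\<in>carrier R. bd z = nu_proj n R y \<and> ?w \<odot>\<^bsub>D\<^esub> z = y \<odot>\<^bsub>D\<^esub> d x"
      and "\<exists>y\<in>carrier R. bd z' = nu_proj n R y \<and> ?w \<odot>\<^bsub>D\<^esub> z' = y \<odot>\<^bsub>D\<^esub> d x"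
    then obtain y y' where y: "y \<in> carrier R" "bd z = nu_proj n R y" "?w \<odot>\<^bsub>D\<^esub> z = y \<odot>\<^bsub>D\<^esub> d x"
      and y': "y' \<in> carrier R" "bd z' = nu_proj n R y'" "?w \<odot>\<^bsub>D\<^esub> z' = y' \<odot>\<^bsub>D\<^esub> d x"
      by blast
    show "\<exists>y\<in>carrier R. bd (z \<oplus>\<^bsub>D\<^esub> z') = nu_proj n R y \<and> ?w \<odot>\<^bsub>D\<^esub> (z \<oplus>\<^bsub>D\<^esub> z') = y \<odot>\<^bsub>D\<^esub> d x"
      using y y' x w zc by (intro bexI[of _ "y \<oplus>\<^bsub>R\<^esub> y'"])
        (auto simp: lin_hom_add[OF bd_hom] R.nu_proj_add smult_r_distr smult_l_distr simp del: R.minus_closed)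
  next
    fix a z assume a: "a \<in> carrier R" and "z \<in> d ` carrier R"
    then obtain b where b: "b \<in> carrier R" and zb: "z = d b" by blast
    have "?w \<odot>\<^bsub>D\<^esub> (a \<odot>\<^bsub>D\<^esub> z) = a \<odot>\<^bsub>D\<^esub> (?w \<odot>\<^bsub>D\<^esub> d b)"
      unfolding zb by (rule smult_left_comm[OF w a]) (use b in auto)
    also have "\<dots> = (a \<otimes>\<^bsub>R\<^esub> (b \<ominus>\<^bsub>R\<^esub> b [^]\<^bsub>R\<^esub> n)) \<odot>\<^bsub>D\<^esub> d x"
      unfolding *[OF b] by (rule smult_assoc1[symmetric]) (use a b x in auto)
    finally have e: "?w \<odot>\<^bsub>D\<^esub> (a \<odot>\<^bsub>D\<^esub> z) = (a \<otimes>\<^bsub>R\<^esub> (b \<ominus>\<^bsub>R\<^esub> b [^]\<^bsub>R\<^esub> n)) \<odot>\<^bsub>D\<^esub> d x" .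
    show "\<exists>y\<in>carrier R. bd (a \<odot>\<^bsub>D\<^esub> z) = nu_proj n R y \<and> ?w \<odot>\<^bsub>D\<^esub> (a \<odot>\<^bsub>D\<^esub> z) = y \<odot>\<^bsub>D\<^esub> d x"
    proof (intro bexI conjI)
      show "bd (a \<odot>\<^bsub>D\<^esub> z) = nu_proj n R (a \<otimes>\<^bsub>R\<^esub> (b \<ominus>\<^bsub>R\<^esub> b [^]\<^bsub>R\<^esub> n))"
        using a b by (simp add: zb lin_hom_smult[OF bd_hom] bd_d R.nu_proj_mult)
    qed (use e a b in auto)
  qed (use z span_d in auto)
qed

lemma diff_in_annihilator:
  assumes x: "x \<in> carrier R"
  shows "x \<ominus>\<^bsub>R\<^esub> x [^]\<^bsub>R\<^esub> n \<in> annihilator"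
proof -
  have "(x \<ominus>\<^bsub>R\<^esub> x [^]\<^bsub>R\<^esub> n) \<odot>\<^bsub>D\<^esub> z = \<zero>\<^bsub>D\<^esub>" if z: "z \<in> carrier D" "bd z = \<zero>\<^bsub>nu_quot n R\<^esub>" for z
  proof -
    obtain y where y: "y \<in> carrier R" "bd z = nu_proj n R y"
      "(x \<ominus>\<^bsub>R\<^esub> x [^]\<^bsub>R\<^esub> n) \<odot>\<^bsub>D\<^esub> z = y \<odot>\<^bsub>D\<^esub> d x"
      using diff_smult[OF x z(1)] by blast
    have "nu_proj n R y = nu_proj n R \<zero>\<^bsub>R\<^esub>" using y(2) z(2) by (simp add: R.nu_proj_zero)
    then have "y \<in> nu_ideal n R" using y(1) by (simp add: R.nu_proj_eq_iff a_minus_def)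
    then show ?thesis using y(3) x by (simp add: kill)
  qed
  then show ?thesis using x by (auto simp: annihilator_def)
qed

text \<open>t^n is congruent to t modulo t - t^n, and so are their powers; the cofactor is kept
  explicit so that t - t^n can later be shown to annihilate cycles.\<close>

lemma pow_diff:
  assumes t: "t \<in> carrier R"
  shows "\<exists>h\<in>carrier R. (t [^]\<^bsub>R\<^esub> n) [^]\<^bsub>R\<^esub> (l::nat) = t [^]\<^bsub>R\<^esub> l \<oplus>\<^bsub>R\<^esub> (t \<ominus>\<^bsub>R\<^esub> t [^]\<^bsub>R\<^esub> n) \<otimes>\<^bsub>R\<^esub> h"
proof (induction l)
  case 0
  show ?case by (rule bexI[of _ "\<zero>\<^bsub>R\<^esub>"]) (use t in auto)
next
  case (Suc l)
  define u where "u = t [^]\<^bsub>R\<^esub> n"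
  define v where "v = t [^]\<^bsub>R\<^esub> l"
  have u: "u \<in> carrier R" "v \<in> carrier R" using t by (simp_all add: u_def v_def)
  from Suc obtain h where h: "h \<in> carrier R" "u [^]\<^bsub>R\<^esub> l = v \<oplus>\<^bsub>R\<^esub> (t \<ominus>\<^bsub>R\<^esub> u) \<otimes>\<^bsub>R\<^esub> h"
    by (auto simp: u_def v_def)
  \<comment> \<open>Writing v u = v t - (t - u) v turns the remainder into a multiple of t - u, with
    new cofactor h u - v.\<close>
  have "(v \<oplus>\<^bsub>R\<^esub> (t \<ominus>\<^bsub>R\<^esub> u) \<otimes>\<^bsub>R\<^esub> h) \<otimes>\<^bsub>R\<^esub> u =
      v \<otimes>\<^bsub>R\<^esub> t \<oplus>\<^bsub>R\<^esub> (t \<ominus>\<^bsub>R\<^esub> u) \<otimes>\<^bsub>R\<^esub> (h \<otimes>\<^bsub>R\<^esub> u \<ominus>\<^bsub>R\<^esub> v)"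
    using t u h(1) by algebra
  then show ?case
    unfolding u_def[symmetric] R.nat_pow_Suc h(2) v_def[symmetric]
    by (intro bexI[of _ "h \<otimes>\<^bsub>R\<^esub> u \<ominus>\<^bsub>R\<^esub> v"]) (use u h in auto)
qed

text \<open>Modulo t - t^n the twist disappears, and the ordinary rule d(t^(m+1)) = (m+1) t^m dt is
  left.\<close>

lemma d_pow:
  assumes t: "t \<in> carrier R"
  shows "\<exists>h\<in>carrier R. d (t [^]\<^bsub>R\<^esub> Suc m) =
    ([Suc m] \<cdot>\<^bsub>R\<^esub> (t [^]\<^bsub>R\<^esub> m) \<oplus>\<^bsub>R\<^esub> (t \<ominus>\<^bsub>R\<^esub> t [^]\<^bsub>R\<^esub> n) \<otimes>\<^bsub>R\<^esub> h) \<odot>\<^bsub>D\<^esub> d t"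
proof (induction m)
  case 0
  show ?case by (rule bexI[of _ "\<zero>\<^bsub>R\<^esub>"]) (use t in auto)
next
  case (Suc m)
  let ?w = "t \<ominus>\<^bsub>R\<^esub> t [^]\<^bsub>R\<^esub> n"
  have w: "?w \<in> carrier R" using t by simp
  define v where "v = [Suc m] \<cdot>\<^bsub>R\<^esub> (t [^]\<^bsub>R\<^esub> m)"
  have v: "v \<in> carrier R" using t by (simp add: v_def)
  from Suc obtain h where h: "h \<in> carrier R"
    "d (t [^]\<^bsub>R\<^esub> Suc m) = (v \<oplus>\<^bsub>R\<^esub> ?w \<otimes>\<^bsub>R\<^esub> h) \<odot>\<^bsub>D\<^esub> d t" by (auto simp: v_def)
  obtain k where k: "k \<in> carrier R"
    "(t [^]\<^bsub>R\<^esub> n) [^]\<^bsub>R\<^esub> Suc m = t [^]\<^bsub>R\<^esub> Suc m \<oplus>\<^bsub>R\<^esub> ?w \<otimes>\<^bsub>R\<^esub> k"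
    using pow_diff[OF t] by blast
  have sw: "(t [^]\<^bsub>R\<^esub> Suc m) [^]\<^bsub>R\<^esub> n = (t [^]\<^bsub>R\<^esub> n) [^]\<^bsub>R\<^esub> Suc m"
    using t by (simp only: R.nat_pow_pow mult.commute)
  have tm: "t [^]\<^bsub>R\<^esub> Suc (Suc m) = t \<otimes>\<^bsub>R\<^esub> t [^]\<^bsub>R\<^esub> Suc m"
    by (rule R.nat_pow_Suc2[OF t])
  have vt: "t \<otimes>\<^bsub>R\<^esub> v \<oplus>\<^bsub>R\<^esub> t [^]\<^bsub>R\<^esub> Suc m = [Suc (Suc m)] \<cdot>\<^bsub>R\<^esub> (t [^]\<^bsub>R\<^esub> Suc m)"
  proof -
    have "t \<otimes>\<^bsub>R\<^esub> v = [Suc m] \<cdot>\<^bsub>R\<^esub> (t [^]\<^bsub>R\<^esub> Suc m)"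
      unfolding v_def R.add_pow_rdistr[OF t R.nat_pow_closed[OF t]] R.nat_pow_Suc2[OF t, symmetric] ..
    then show ?thesis by (simp add: R.add.nat_pow_Suc[of "Suc m"])
  qed
  let ?X = "t [^]\<^bsub>R\<^esub> Suc m"
  have X: "?X \<in> carrier R" using t by simp
  \<comment> \<open>The factor t is split off on the left, so that the twist falls on
    \<open>?X\<close>: the n-th power of t^(m+1) is the (m+1)-st power of t^n, to which
    \<open>pow_diff\<close> applies.\<close>
  have "d (t [^]\<^bsub>R\<^esub> Suc (Suc m)) = t \<odot>\<^bsub>D\<^esub> d ?X \<oplus>\<^bsub>D\<^esub> (?X [^]\<^bsub>R\<^esub> n) \<odot>\<^bsub>D\<^esub> d t"
    unfolding tm by (rule d_mult[OF t X])
  also have "\<dots> = (t \<otimes>\<^bsub>R\<^esub> (v \<oplus>\<^bsub>R\<^esub> ?w \<otimes>\<^bsub>R\<^esub> h)) \<odot>\<^bsub>D\<^esub> d t \<oplus>\<^bsub>D\<^esub> (?X \<oplus>\<^bsub>R\<^esub> ?w \<otimes>\<^bsub>R\<^esub> k) \<odot>\<^bsub>D\<^esub> d t"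
    unfolding sw k(2) h(2) using t v w h(1) by (subst smult_assoc1) auto
  also have "\<dots> = (t \<otimes>\<^bsub>R\<^esub> (v \<oplus>\<^bsub>R\<^esub> ?w \<otimes>\<^bsub>R\<^esub> h) \<oplus>\<^bsub>R\<^esub> (?X \<oplus>\<^bsub>R\<^esub> ?w \<otimes>\<^bsub>R\<^esub> k)) \<odot>\<^bsub>D\<^esub> d t"
    by (rule smult_l_distr[symmetric]) (use t v w X h(1) k(1) in auto)
  also have "t \<otimes>\<^bsub>R\<^esub> (v \<oplus>\<^bsub>R\<^esub> ?w \<otimes>\<^bsub>R\<^esub> h) \<oplus>\<^bsub>R\<^esub> (?X \<oplus>\<^bsub>R\<^esub> ?w \<otimes>\<^bsub>R\<^esub> k) =
      (t \<otimes>\<^bsub>R\<^esub> v \<oplus>\<^bsub>R\<^esub> ?X) \<oplus>\<^bsub>R\<^esub> ?w \<otimes>\<^bsub>R\<^esub> (t \<otimes>\<^bsub>R\<^esub> h \<oplus>\<^bsub>R\<^esub> k)"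
    using t v w X h(1) k(1)
    by (simp add: R.r_distr R.a_ac R.m_ac del: R.nat_pow_Suc R.minus_closed)
  finally show ?case unfolding vt
    by (intro bexI[of _ "t \<otimes>\<^bsub>R\<^esub> h \<oplus>\<^bsub>R\<^esub> k"]) (use t h k in auto)
qed

text \<open>In \<open>d_pow\<close> with exponent n^N, the leading term has a coefficient divisible
  by nu(n) because N > 0, and acts as zero. The surviving factor (t - t^n) h is the required
  v.\<close>

lemma periodic_annihilator:
  assumes t: "t \<in> carrier R" and N: "N > 0" and per: "nu_proj n R (t [^]\<^bsub>R\<^esub> (n ^ N)) = nu_proj n R t"
  shows "\<exists>v\<in>annihilator. v \<odot>\<^bsub>D\<^esub> d t = d t"
proof -
  obtain m where m: "n ^ N = Suc m"
    using primepow_gt_0_nat[OF primepow] by (cases "n ^ N") auto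
  let ?w = "t \<ominus>\<^bsub>R\<^esub> t [^]\<^bsub>R\<^esub> n"
  obtain h where h: "h \<in> carrier R"
    "d (t [^]\<^bsub>R\<^esub> Suc m) = ([Suc m] \<cdot>\<^bsub>R\<^esub> (t [^]\<^bsub>R\<^esub> m) \<oplus>\<^bsub>R\<^esub> ?w \<otimes>\<^bsub>R\<^esub> h) \<odot>\<^bsub>D\<^esub> d t"
    using d_pow[OF t] by blast
  have "nu n dvd Suc m"
    using primepow_nu(2)[OF primepow] N unfolding m[symmetric] by (simp add: dvd_power_le[of _ _ 1, simplified] dvd_trans[OF _ dvd_power])
  then obtain q where q: "Suc m = nu n * q" by blast
  have zero: "([Suc m] \<cdot>\<^bsub>R\<^esub> (t [^]\<^bsub>R\<^esub> m)) \<odot>\<^bsub>D\<^esub> d t = \<zero>\<^bsub>D\<^esub>"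
  proof (rule kill)
    have "[Suc m] \<cdot>\<^bsub>R\<^esub> (t [^]\<^bsub>R\<^esub> m) = ([q] \<cdot>\<^bsub>R\<^esub> (t [^]\<^bsub>R\<^esub> m)) \<otimes>\<^bsub>R\<^esub> ([nu n] \<cdot>\<^bsub>R\<^esub> \<one>\<^bsub>R\<^esub>)"
      using t by (simp add: q R.add_pow_rdistr R.add.nat_pow_pow mult.commute)
    then show "[Suc m] \<cdot>\<^bsub>R\<^esub> (t [^]\<^bsub>R\<^esub> m) \<in> nu_ideal n R"
      using t by (auto simp: R.nu_ideal_iff)
  qed (use t in auto)
  have "d t = d (t [^]\<^bsub>R\<^esub> Suc m)"
    by (rule d_cong) (use t per m in auto)
  also have "\<dots> = (?w \<otimes>\<^bsub>R\<^esub> h) \<odot>\<^bsub>D\<^esub> d t"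
    unfolding h(2) using t h(1) zero by (subst smult_l_distr) auto
  finally show ?thesis
    using annihilator_mult[OF diff_in_annihilator[OF t] h(1)] by metis
qed

text \<open>Every generator of a late Frobenius stage is fixed by some annihilating scalar. What has
  to be found is one such scalar for the cycle z, which is a combination of generators with
  different scalars.\<close>

lemma cycle_eq_zero:
  assumes z: "z \<in> carrier D" "bd z = \<zero>\<^bsub>nu_quot n R\<^esub>"
  shows "z = \<zero>\<^bsub>D\<^esub>"
proof -
  obtain i N where N: "N > 0"
    and per: "\<And>b. b \<in> carrier R \<Longrightarrow> nu_proj n R (b [^]\<^bsub>R\<^esub> (n ^ i)) = nu_proj n R (b [^]\<^bsub>R\<^esub> (n ^ (i + N)))"
    using R.eventually_periodic[OF finite_quot] by blast
  have zK: "\<zero>\<^bsub>R\<^esub> \<in> annihilator" by (simp add: annihilator_def)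
  let ?H = "{x \<in> carrier D. \<exists>v\<in>annihilator. v \<odot>\<^bsub>D\<^esub> x = x}"
  have Kc: "v \<in> carrier R" if "v \<in> annihilator" for v using that by (simp add: annihilator_def)
  have "submodule ?H R D"
  proof (rule submoduleI2)
    show "\<zero>\<^bsub>D\<^esub> \<in> ?H" using bexI[OF _ zK, of "\<lambda>v. v \<odot>\<^bsub>D\<^esub> \<zero>\<^bsub>D\<^esub> = \<zero>\<^bsub>D\<^esub>"] by simp
  next
    fix x y assume "x \<in> ?H" "y \<in> ?H"
    then obtain v w where x: "x \<in> carrier D" "v \<in> annihilator" "v \<odot>\<^bsub>D\<^esub> x = x"
      and y: "y \<in> carrier D" "w \<in> annihilator" "w \<odot>\<^bsub>D\<^esub> y = y" by blast
    \<comment> \<open>1 - u = (1 - v)(1 - w), hence u fixes both x and y.\<close>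
    let ?u = "v \<oplus>\<^bsub>R\<^esub> w \<ominus>\<^bsub>R\<^esub> v \<otimes>\<^bsub>R\<^esub> w"
    have u: "?u \<in> annihilator"
      using x y Kc by (intro annihilator_minus annihilator_add annihilator_mult) auto
    note vw = Kc[OF x(2)] Kc[OF y(2)]
    have ux: "?u \<odot>\<^bsub>D\<^esub> s = v \<odot>\<^bsub>D\<^esub> s \<oplus>\<^bsub>D\<^esub> w \<odot>\<^bsub>D\<^esub> s \<ominus>\<^bsub>D\<^esub> v \<odot>\<^bsub>D\<^esub> (w \<odot>\<^bsub>D\<^esub> s)" if "s \<in> carrier D" for s
      using that vw by (simp add: a_minus_def smult_l_distr smult_l_minus smult_assoc1)
    have "?u \<odot>\<^bsub>D\<^esub> x = x"
    proof -
      have "v \<odot>\<^bsub>D\<^esub> (w \<odot>\<^bsub>D\<^esub> x) = w \<odot>\<^bsub>D\<^esub> x"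
        using smult_left_comm[OF vw x(1)] x(3) by simp
      then show ?thesis unfolding ux[OF x(1)] x(3)
        using x(1) vw by (simp add: a_minus_def M.a_assoc M.r_neg)
    qed
    moreover have "?u \<odot>\<^bsub>D\<^esub> y = y"
    proof -
      have "v \<odot>\<^bsub>D\<^esub> y \<oplus>\<^bsub>D\<^esub> y \<oplus>\<^bsub>D\<^esub> \<ominus>\<^bsub>D\<^esub> (v \<odot>\<^bsub>D\<^esub> y) = (v \<odot>\<^bsub>D\<^esub> y \<oplus>\<^bsub>D\<^esub> \<ominus>\<^bsub>D\<^esub> (v \<odot>\<^bsub>D\<^esub> y)) \<oplus>\<^bsub>D\<^esub> y"
        using y vw by (simp add: M.a_ac)
      then show ?thesis unfolding ux[OF y(1)] y(3)
        using y(1) vw by (simp add: a_minus_def M.r_neg)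
    qed
    ultimately have "?u \<odot>\<^bsub>D\<^esub> (x \<oplus>\<^bsub>D\<^esub> y) = x \<oplus>\<^bsub>D\<^esub> y"
      using x(1) y(1) Kc[OF u] by (simp only: smult_r_distr)
    then show "x \<oplus>\<^bsub>D\<^esub> y \<in> ?H" using u x(1) y(1) by blast
  next
    fix a x assume a: "a \<in> carrier R" and "x \<in> ?H"
    then obtain v where x: "x \<in> carrier D" "v \<in> annihilator" "v \<odot>\<^bsub>D\<^esub> x = x" by blast
    then have "v \<odot>\<^bsub>D\<^esub> (a \<odot>\<^bsub>D\<^esub> x) = a \<odot>\<^bsub>D\<^esub> x"
      using smult_left_comm[OF Kc[OF x(2)] a x(1)] by simp
    then show "a \<odot>\<^bsub>D\<^esub> x \<in> ?H" using a x by blast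
  qed auto
  moreover have "(\<lambda>b. d (b [^]\<^bsub>R\<^esub> (n ^ i))) ` carrier R \<subseteq> ?H"
  proof (rule image_subsetI)
    fix b assume b: "b \<in> carrier R"
    have "(b [^]\<^bsub>R\<^esub> (n ^ i)) [^]\<^bsub>R\<^esub> (n ^ N) = b [^]\<^bsub>R\<^esub> (n ^ (i + N))"
      using b by (simp add: R.nat_pow_pow power_add)
    then show "d (b [^]\<^bsub>R\<^esub> (n ^ i)) \<in> ?H"
      using periodic_annihilator[OF _ N, of "b [^]\<^bsub>R\<^esub> (n ^ i)"] per[OF b] b by simp
  qed
  ultimately have "frob_span i \<subseteq> ?H" by (rule span_least)
  then obtain v where "v \<in> annihilator" "v \<odot>\<^bsub>D\<^esub> z = z"
    using cycle_in_frob_span[OF z, of i] by blast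
  then show ?thesis using z by (simp add: annihilator_def)
qed

end

section \<open>Homology in degree one\<close>

text \<open>Degree one occurs as the literal \<open>1\<close> in \<open>U_pos n R 1\<close> and
  \<open>delta_pos n R 1\<close>; rewriting it to \<open>Suc 0\<close> would prevent facts from
  matching.\<close>

declare One_nat_def [simp del]

lemma words_one: "words R 1 = (\<lambda>b. [b]) ` carrier R"
  by (auto simp: words_def length_Suc_conv One_nat_def)

lemma words_two: "words R 2 = (\<lambda>(a, b). [a, b]) ` (carrier R \<times> carrier R)"
  by (auto simp: words_def length_Suc_conv numeral_2_eq_2)

lemma U_zero_minus [simp]: "x \<ominus>\<^bsub>U_zero n R\<^esub> y = x \<ominus>\<^bsub>nu_quot n R\<^esub> y"
  by (simp add: a_minus_def a_inv_def m_inv_def)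

context cring
begin

lemma nu_proj_eq_zero_iff:
  assumes "a \<in> carrier R"
  shows "nu_proj n R a = \<zero>\<^bsub>nu_quot n R\<^esub> \<longleftrightarrow> a \<in> nu_ideal n R"
  using nu_proj_eq_iff[OF assms zero_closed, of n] assms by (simp add: nu_proj_zero a_minus_def)

lemma c_word_one_closed: "b \<in> carrier R \<Longrightarrow> c_word n R [b] \<in> carrier (U_pos n R 1)"
  by (rule c_word_closed) (simp add: words_one)

lemma U_zero_nu_kill:
  assumes "x \<in> carrier (U_zero n R)"
  shows "([nu n] \<cdot> \<one>) \<odot>\<^bsub>U_zero n R\<^esub> x = \<zero>\<^bsub>U_zero n R\<^esub>"
proof -
  interpret Q: cring "nu_quot n R" by (rule cring_nu_quot)
  have "nu_proj n R ([nu n] \<cdot> \<one>) = \<zero>\<^bsub>nu_quot n R\<^esub>"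
    by (simp add: nu_proj_eq_zero_iff nu_in_nu_ideal)
  then show ?thesis using assms by simp
qed

text \<open>The map prescribed on generators exists because b - b^n is additive in b modulo nu(n)
  and degree zero is killed by nu(n).\<close>

lemma delta_zero:
  assumes n: "primepow n"
  shows delta_zero_hom: "delta_zero n R \<in> lin_hom R (U_pos n R 1) (U_zero n R)"
    and delta_zero_c: "b \<in> carrier R \<Longrightarrow> delta_zero n R (c_word n R [b]) = nu_proj n R (b \<ominus> b [^] n)"
proof -
  have add: "nu_proj n R ((a \<oplus> b) \<ominus> (a \<oplus> b) [^] n) =
      nu_proj n R (a \<ominus> a [^] n) \<oplus>\<^bsub>U_zero n R\<^esub> nu_proj n R (b \<ominus> b [^] n)"
    if ab: "a \<in> carrier R" "b \<in> carrier R" for a b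
  proof -
    have "nu_proj n R ((a \<oplus> b) \<ominus> (a \<oplus> b) [^] n) = nu_proj n R ((a \<oplus> b) \<ominus> (a [^] n \<oplus> b [^] n))"
      using ab nu_proj_pow_add[OF n ab] by (simp only: nu_proj_minus nat_pow_closed a_closed)
    also have "(a \<oplus> b) \<ominus> (a [^] n \<oplus> b [^] n) = (a \<ominus> a [^] n) \<oplus> (b \<ominus> b [^] n)"
      using ab nat_pow_closed[OF ab(1), of n] nat_pow_closed[OF ab(2), of n] by algebra
    also have "nu_proj n R \<dots> = nu_proj n R (a \<ominus> a [^] n) \<oplus>\<^bsub>nu_quot n R\<^esub> nu_proj n R (b \<ominus> b [^] n)"
      using ab by (intro nu_proj_add) auto
    finally show ?thesis by simp
  qed
  obtain h where h: "h \<in> lin_hom R (U_pos n R 1) (U_zero n R)"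
    "\<And>b. b \<in> carrier R \<Longrightarrow> h (c_word n R [b]) = nu_proj n R (b \<ominus> b [^] n)"
    using U_one_lift[OF module_U_zero U_zero_nu_kill _ add] by (auto simp: nu_proj_closed)
  have "h (c_word n R bs) = nu_proj n R (bs ! 0 \<ominus> (bs ! 0) [^] n)" if "bs \<in> words R 1" for bs
    using that h(2) unfolding words_one by auto
  note ext = module.lin_ext[OF module_U_pos module_U_zero h(1) U_span c_word_closed this, folded delta_zero_def]
  show "delta_zero n R \<in> lin_hom R (U_pos n R 1) (U_zero n R)" by (rule ext(1))
  show "delta_zero n R (c_word n R [b]) = nu_proj n R (b \<ominus> b [^] n)" if "b \<in> carrier R"
    using ext(2)[of "[b]"] that by (simp add: words_one)
qed

text \<open>The prescribed values are bilinear in (a, b), so \<open>U_two_lift\<close> supplies the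
  map. Additivity in a follows from the module axioms and the relations on c; additivity in b also
  needs the Frobenius, through the coefficient b^n.\<close>

lemma delta_one:
  assumes n: "primepow n"
  shows delta_one_hom: "delta_pos n R 1 \<in> lin_hom R (U_pos n R 2) (U_pos n R 1)"
    and delta_one_c: "a \<in> carrier R \<Longrightarrow> b \<in> carrier R \<Longrightarrow> delta_pos n R 1 (c_word n R [a, b]) =
      a \<odot>\<^bsub>U_pos n R 1\<^esub> c_word n R [b] \<ominus>\<^bsub>U_pos n R 1\<^esub> c_word n R [a \<otimes> b]
        \<oplus>\<^bsub>U_pos n R 1\<^esub> (b [^] n) \<odot>\<^bsub>U_pos n R 1\<^esub> c_word n R [a]"
proof -
  let ?U = "U_pos n R 1"
  interpret U: module R ?U by (rule module_U_pos)
  note c = c_word_one_closed[of _ n]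
  define g where "g a b = a \<odot>\<^bsub>?U\<^esub> c_word n R [b] \<ominus>\<^bsub>?U\<^esub> c_word n R [a \<otimes> b]
        \<oplus>\<^bsub>?U\<^esub> (b [^] n) \<odot>\<^bsub>?U\<^esub> c_word n R [a]" for a b
  have gc: "g a b \<in> carrier ?U" if "a \<in> carrier R" "b \<in> carrier R" for a b
    using that c by (simp add: g_def)
  have swap: "(x \<oplus>\<^bsub>?U\<^esub> x') \<ominus>\<^bsub>?U\<^esub> (y \<oplus>\<^bsub>?U\<^esub> y') \<oplus>\<^bsub>?U\<^esub> (z \<oplus>\<^bsub>?U\<^esub> z') =
      (x \<ominus>\<^bsub>?U\<^esub> y \<oplus>\<^bsub>?U\<^esub> z) \<oplus>\<^bsub>?U\<^esub> (x' \<ominus>\<^bsub>?U\<^esub> y' \<oplus>\<^bsub>?U\<^esub> z')"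
    if "x \<in> carrier ?U" "x' \<in> carrier ?U" "y \<in> carrier ?U" "y' \<in> carrier ?U"
      "z \<in> carrier ?U" "z' \<in> carrier ?U" for x x' y y' z z'
    using that by (simp add: a_minus_def U.M.minus_add U.M.a_ac)
  \<comment> \<open>The n-th power is additive only modulo nu(n), but nu(n) annihilates degree one,
    so the two coefficients act alike.\<close>
  have pow: "((b \<oplus> b') [^] n) \<odot>\<^bsub>?U\<^esub> x = (b [^] n) \<odot>\<^bsub>?U\<^esub> x \<oplus>\<^bsub>?U\<^esub> (b' [^] n) \<odot>\<^bsub>?U\<^esub> x"
    if b: "b \<in> carrier R" "b' \<in> carrier R" and x: "x \<in> carrier ?U" for b b' x
  proof -
    let ?u = "(b \<oplus> b') [^] n" and ?v = "b [^] n \<oplus> b' [^] n"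
    have "?u \<ominus> ?v \<in> nu_ideal n R"
      using b nu_proj_pow_add[OF n b] by (simp add: nu_proj_eq_iff)
    from nu_ideal_kills[OF module_U_pos U_nu_kill[OF zero_less_one] this x]
    have "(?u \<ominus> ?v) \<odot>\<^bsub>?U\<^esub> x = \<zero>\<^bsub>?U\<^esub>" .
    then have "?u \<odot>\<^bsub>?U\<^esub> x \<ominus>\<^bsub>?U\<^esub> ?v \<odot>\<^bsub>?U\<^esub> x = \<zero>\<^bsub>?U\<^esub>"
      using b x U.smult_l_distr[of ?u "\<ominus> ?v" x] U.smult_l_minus[of ?v x] by (simp add: a_minus_def)
    then have "?u \<odot>\<^bsub>?U\<^esub> x = ?v \<odot>\<^bsub>?U\<^esub> x" by (rule U.minus_eq_zeroD[rotated 2]) (use b x in auto)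
    then show ?thesis using b x by (simp add: U.smult_l_distr)
  qed
  have g1: "g (a \<oplus> a') b = g a b \<oplus>\<^bsub>?U\<^esub> g a' b"
    if a: "a \<in> carrier R" "a' \<in> carrier R" "b \<in> carrier R" for a a' b
  proof -
    have "g (a \<oplus> a') b = (a \<odot>\<^bsub>?U\<^esub> c_word n R [b] \<oplus>\<^bsub>?U\<^esub> a' \<odot>\<^bsub>?U\<^esub> c_word n R [b])
        \<ominus>\<^bsub>?U\<^esub> (c_word n R [a \<otimes> b] \<oplus>\<^bsub>?U\<^esub> c_word n R [a' \<otimes> b])
        \<oplus>\<^bsub>?U\<^esub> ((b [^] n) \<odot>\<^bsub>?U\<^esub> c_word n R [a] \<oplus>\<^bsub>?U\<^esub> (b [^] n) \<odot>\<^bsub>?U\<^esub> c_word n R [a'])"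
      unfolding g_def c_word_add[OF a(1,2)] l_distr[OF a] U.smult_l_distr[OF a(1,2) c[OF a(3)]]
        c_word_add[OF m_closed[OF a(1,3)] m_closed[OF a(2,3)]]
        U.smult_r_distr[OF nat_pow_closed[OF a(3)] c[OF a(1)] c[OF a(2)]] ..
    also have "\<dots> = g a b \<oplus>\<^bsub>?U\<^esub> g a' b" unfolding g_def by (rule swap) (use a c in auto)
    finally show ?thesis .
  qed
  have g2: "g a (b \<oplus> b') = g a b \<oplus>\<^bsub>?U\<^esub> g a b'"
    if a: "a \<in> carrier R" "b \<in> carrier R" "b' \<in> carrier R" for a b b'
  proof -
    have "g a (b \<oplus> b') = (a \<odot>\<^bsub>?U\<^esub> c_word n R [b] \<oplus>\<^bsub>?U\<^esub> a \<odot>\<^bsub>?U\<^esub> c_word n R [b'])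
        \<ominus>\<^bsub>?U\<^esub> (c_word n R [a \<otimes> b] \<oplus>\<^bsub>?U\<^esub> c_word n R [a \<otimes> b'])
        \<oplus>\<^bsub>?U\<^esub> ((b [^] n) \<odot>\<^bsub>?U\<^esub> c_word n R [a] \<oplus>\<^bsub>?U\<^esub> (b' [^] n) \<odot>\<^bsub>?U\<^esub> c_word n R [a])"
      unfolding g_def c_word_add[OF a(2,3)] pow[OF a(2,3) c[OF a(1)]] r_distr[OF a(2,3,1)]
        c_word_add[OF m_closed[OF a(1,2)] m_closed[OF a(1,3)]]
        U.smult_r_distr[OF a(1) c[OF a(2)] c[OF a(3)]] ..
    also have "\<dots> = g a b \<oplus>\<^bsub>?U\<^esub> g a b'" unfolding g_def by (rule swap) (use a c in auto)
    finally show ?thesis .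
  qed
  obtain h where h: "h \<in> lin_hom R (U_pos n R 2) ?U"
    and hc: "\<forall>a\<in>carrier R. \<forall>b\<in>carrier R. h (c_word n R [a, b]) = g a b"
    using U_two_lift[OF module_U_pos U_nu_kill[OF zero_less_one] gc g1 g2] by blast
  \<comment> \<open>The defining formula of \<open>delta_pos\<close> at m = 1: the sum has the
    single index 1 with sign -1, and the last sign is (-1)^2.\<close>
  let ?G = "\<lambda>bs. bs ! 0 \<odot>\<^bsub>?U\<^esub> c_word n R (tl bs)
       \<oplus>\<^bsub>?U\<^esub> (\<Oplus>\<^bsub>?U\<^esub>i\<in>{1..1}. sign R i \<odot>\<^bsub>?U\<^esub> c_word n R (merge R i bs))
       \<oplus>\<^bsub>?U\<^esub> (sign R (1 + 1) \<otimes> (bs ! 1) [^] n) \<odot>\<^bsub>?U\<^esub> c_word n R (butlast bs)"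
  have G: "?G [a, b] = g a b" if ab: "a \<in> carrier R" "b \<in> carrier R" for a b
  proof -
    have m: "merge R 1 [a, b] = [a \<otimes> b]" by (simp add: merge_def)
    have s: "sign R 1 = \<ominus> \<one>" "sign R (1 + 1) = \<one>" by (simp_all add: sign_def l_minus One_nat_def numeral_2_eq_2)
    have sum: "(\<Oplus>\<^bsub>?U\<^esub>i\<in>{1..1::nat}. sign R i \<odot>\<^bsub>?U\<^esub> c_word n R (merge R i [a, b])) =
        \<ominus>\<^bsub>?U\<^esub> c_word n R [a \<otimes> b]"
      using ab c[of "a \<otimes> b"] U.M.finsum_insert[of "{}" "1::nat" "\<lambda>i. sign R i \<odot>\<^bsub>?U\<^esub> c_word n R (merge R i [a, b])"]
      by (simp add: m s U.smult_l_minus)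
    show ?thesis unfolding sum s using ab by (simp add: g_def a_minus_def)
  qed
  have hG: "h (c_word n R bs) = ?G bs" if bs: "bs \<in> words R 2" for bs
  proof -
    obtain a b where "a \<in> carrier R" "b \<in> carrier R" "bs = [a, b]"
      using bs unfolding words_two by auto
    then show ?thesis using hc G by simp
  qed
  have def: "delta_pos n R 1 = lin_ext R (U_pos n R 2) ?U (words R 2) (c_word n R) ?G"
    by (simp only: delta_pos_def one_add_one)
  note ext = module.lin_ext[OF module_U_pos module_U_pos h U_span c_word_closed hG, folded def]
  show "delta_pos n R 1 \<in> lin_hom R (U_pos n R 2) ?U" by (rule ext(1))
  show "delta_pos n R 1 (c_word n R [a, b]) =
      a \<odot>\<^bsub>?U\<^esub> c_word n R [b] \<ominus>\<^bsub>?U\<^esub> c_word n R [a \<otimes> b] \<oplus>\<^bsub>?U\<^esub> (b [^] n) \<odot>\<^bsub>?U\<^esub> c_word n R [a]"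
    if ab: "a \<in> carrier R" "b \<in> carrier R"
  proof -
    have "delta_pos n R 1 (c_word n R [a, b]) = ?G [a, b]"
      by (rule ext(2)) (use ab in \<open>auto simp: words_two\<close>)
    then show ?thesis unfolding G[OF ab] g_def .
  qed
qed

lemma delta_delta:
  assumes n: "primepow n" and x: "x \<in> carrier (U_pos n R 2)"
  shows "delta_zero n R (delta_pos n R 1 x) = \<zero>\<^bsub>nu_quot n R\<^esub>"
proof -
  let ?U = "U_pos n R 1"
  interpret U: module R ?U by (rule module_U_pos)
  interpret U2: module R "U_pos n R 2" by (rule module_U_pos)
  interpret Z: module R "U_zero n R" by (rule module_U_zero)
  note d0 = delta_zero_hom[OF n] note d1 = delta_one_hom[OF n]
  have "submodule {x \<in> carrier (U_pos n R 2). delta_zero n R (delta_pos n R 1 x) \<in> {\<zero>\<^bsub>U_zero n R\<^esub>}} R (U_pos n R 2)"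
    by (rule U2.preimage_submodule[OF Z.module_axioms lin_hom_comp[OF d1 d0] Z.zero_submodule])
  then have "submodule {x \<in> carrier (U_pos n R 2). delta_zero n R (delta_pos n R 1 x) = \<zero>\<^bsub>nu_quot n R\<^esub>} R (U_pos n R 2)"
    by simp
  then show ?thesis
  proof (rule U2.span_carrier_induct[OF U_span _ _ x])
    fix z assume z: "z \<in> c_word n R ` words R 2"
    then obtain a b where ab: "a \<in> carrier R" "b \<in> carrier R" and zab: "z = c_word n R [a, b]"
      unfolding words_two by auto
    note c = c_word_one_closed[of _ n]
    have "delta_zero n R (delta_pos n R 1 z) =
        nu_proj n R (a \<otimes> (b \<ominus> b [^] n) \<ominus> (a \<otimes> b \<ominus> (a \<otimes> b) [^] n) \<oplus> b [^] n \<otimes> (a \<ominus> a [^] n))"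
      using ab c
      by (simp add: zab delta_one_c[OF n] lin_hom_add[OF d0]
          lin_hom_minus[OF U.module_axioms module_U_zero d0] lin_hom_smult[OF d0]
          delta_zero_c[OF n] nu_proj_add nu_proj_mult nu_proj_minus c)
    also have "(a \<otimes> b) [^] n = a [^] n \<otimes> b [^] n" using ab by (simp add: nat_pow_distrib)
    also have "a \<otimes> (b \<ominus> b [^] n) \<ominus> (a \<otimes> b \<ominus> a [^] n \<otimes> b [^] n) \<oplus> b [^] n \<otimes> (a \<ominus> a [^] n) = \<zero>"
      using ab nat_pow_closed[OF ab(1), of n] nat_pow_closed[OF ab(2), of n] by algebra
    finally show "z \<in> carrier (U_pos n R 2) \<and> delta_zero n R (delta_pos n R 1 z) = \<zero>\<^bsub>nu_quot n R\<^esub>"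
      using z c_word_closed by (auto simp: nu_proj_zero)
  qed
qed

lemma boundaries_one_submodule: "primepow n \<Longrightarrow> submodule (boundaries_one n R) R (U_pos n R 1)"
  unfolding boundaries_one_def
  by (rule module.image_submodule[OF module_U_pos module_U_pos delta_one_hom])

text \<open>This is the vanishing of H_1. In the quotient D of degree-one chains by boundaries, the
  class of a cycle lies in the kernel of the induced differential, so it is zero by
  \<open>cycle_eq_zero\<close>; that is, the cycle is a boundary.\<close>

lemma cycles_eq_boundaries:
  assumes n: "primepow n" and fin: "finite (carrier (nu_quot n R))"
  shows "carrier (cycles_one n R) = boundaries_one n R"
proof -
  let ?U = "U_pos n R 1" let ?B = "boundaries_one n R" let ?D = "quot_module ?U ?B"
  let ?d = "\<lambda>b. ?B +>\<^bsub>?U\<^esub> c_word n R [b]" let ?bd = "\<lambda>Z. the_elem (delta_zero n R ` Z)"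
  interpret U: module R ?U by (rule module_U_pos)
  note B = boundaries_one_submodule[OF n]
  interpret D: module R ?D by (rule U.quot_module[OF B])
  note d0 = delta_zero_hom[OF n]
  note c = c_word_one_closed[of _ n]
  have bz: "delta_zero n R y = \<zero>\<^bsub>U_zero n R\<^esub>" if "y \<in> ?B" for y
    using that delta_delta[OF n] by (auto simp: boundaries_one_def)
  note el = U.the_elem_coset[OF B module_U_zero d0 bz]
  interpret t: twisted_derivation R ?D n ?d ?bd
  proof (unfold_locales)
    show "?d b \<in> carrier ?D" if "b \<in> carrier R" for b
      using c[OF that] unfolding U.quot_carrier[OF B] by blast
    show "?d (a \<oplus> b) = ?d a \<oplus>\<^bsub>?D\<^esub> ?d b" if "a \<in> carrier R" "b \<in> carrier R" for a b
      by (simp only: c_word_add that U.quot_add[OF B c c])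
    show "?d (a \<otimes> b) = a \<odot>\<^bsub>?D\<^esub> ?d b \<oplus>\<^bsub>?D\<^esub> (b [^] n) \<odot>\<^bsub>?D\<^esub> ?d a"
      if ab: "a \<in> carrier R" "b \<in> carrier R" for a b
    proof -
      let ?p = "a \<odot>\<^bsub>?U\<^esub> c_word n R [b]" and ?q = "(b [^] n) \<odot>\<^bsub>?U\<^esub> c_word n R [a]"
        and ?r = "c_word n R [a \<otimes> b]"
      have pqr: "?p \<in> carrier ?U" "?q \<in> carrier ?U" "?r \<in> carrier ?U" using ab c by auto
      \<comment> \<open>The boundary of c_a (x) c_b is the difference of the two sides of the
        Leibniz rule, so they have the same class.\<close>
      have "[a, b] \<in> words R 2" using ab by (auto simp: words_two)
      then have "delta_pos n R 1 (c_word n R [a, b]) \<in> ?B"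
        unfolding boundaries_one_def by (intro imageI c_word_closed)
      moreover have "delta_pos n R 1 (c_word n R [a, b]) = (?p \<oplus>\<^bsub>?U\<^esub> ?q) \<ominus>\<^bsub>?U\<^esub> ?r"
        unfolding delta_one_c[OF n ab] using pqr by (simp add: a_minus_def U.M.a_ac)
      ultimately have "?B +>\<^bsub>?U\<^esub> (?p \<oplus>\<^bsub>?U\<^esub> ?q) = ?B +>\<^bsub>?U\<^esub> ?r"
        using pqr by (simp only: U.coset_eq_iff[OF B] U.M.a_closed)
      then show ?thesis
        using ab c pqr by (simp only: U.quot_add[OF B] U.quot_smult[OF B] nat_pow_closed)
    qed
    show "([nu n] \<cdot> \<one>) \<odot>\<^bsub>?D\<^esub> z = \<zero>\<^bsub>?D\<^esub>" if z: "z \<in> carrier ?D" for z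
    proof -
      obtain u where u: "u \<in> carrier ?U" "z = ?B +>\<^bsub>?U\<^esub> u" using z unfolding U.quot_carrier[OF B] by blast
      have "([nu n] \<cdot> \<one>) \<odot>\<^bsub>?D\<^esub> z = ?B +>\<^bsub>?U\<^esub> \<zero>\<^bsub>?U\<^esub>"
        unfolding u(2) U_nu_kill[OF zero_less_one u(1), symmetric] using u(1) by (intro U.quot_smult[OF B]) auto
      then show ?thesis
        using U.coset_zero_iff[OF B U.M.zero_closed] U.submodule_zero[OF B] by (simp add: U.quot_zero[OF B])
    qed
    show "span_submodule R ?D (?d ` carrier R) = carrier ?D"
    proof -
      let ?H = "span_submodule R ?D (?d ` carrier R)"
      have H: "submodule ?H R ?D"
        by (rule D.span_submodule) (use c U.quot_carrier[OF B] in auto)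
      have "submodule {x \<in> carrier ?U. ?B +>\<^bsub>?U\<^esub> x \<in> ?H} R ?U"
        by (rule U.preimage_submodule[OF D.module_axioms U.quot_proj_hom[OF B] H])
      moreover have "c_word n R ` words R 1 \<subseteq> {x \<in> carrier ?U. ?B +>\<^bsub>?U\<^esub> x \<in> ?H}"
        unfolding words_one using c subsetD[OF D.span_incl imageI, of _ "carrier R" ?d] by auto
      ultimately have "carrier ?U \<subseteq> {x \<in> carrier ?U. ?B +>\<^bsub>?U\<^esub> x \<in> ?H}"
        unfolding U_span[of n 1, symmetric] by (rule U.span_least)
      then have "carrier ?D \<subseteq> ?H" unfolding U.quot_carrier[OF B] by blast
      then show ?thesis using D.submoduleE(1)[OF H] by (rule subset_antisym[rotated])
    qed
    show "?bd \<in> lin_hom R ?D (U_zero n R)" by (rule U.quot_lift_hom[OF B module_U_zero d0 bz])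
    show "?bd (?d b) = nu_proj n R (b \<ominus> b [^] n)" if "b \<in> carrier R" for b
      using that c by (simp only: el delta_zero_c[OF n])
  qed (rule n fin)+
  have "z \<in> ?B" if z: "z \<in> carrier ?U" "delta_zero n R z = \<zero>\<^bsub>nu_quot n R\<^esub>" for z
  proof -
    have "?B +>\<^bsub>?U\<^esub> z = \<zero>\<^bsub>?D\<^esub>"
      by (rule t.cycle_eq_zero) (use z el U.quot_carrier[OF B] in auto)
    then show ?thesis using z(1) by (simp only: U.quot_zero[OF B] U.coset_zero_iff[OF B])
  qed
  moreover have "?B \<subseteq> carrier ?U" by (rule U.submoduleE(1)[OF B])
  ultimately show ?thesis using bz by (auto simp: cycles_one_def)
qed

end

section \<open>Adic completion\<close>

lemma ideals_set_sel [simp]: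
  "\<one>\<^bsub>ideals_set R\<^esub> = carrier R" "I \<otimes>\<^bsub>ideals_set R\<^esub> J = ideal_prod R I J"
  by (simp_all add: ideals_set_def)

context cring
begin

lemma ideal_ideal_pow:
  assumes "ideal I R" shows "ideal (I [^]\<^bsub>ideals_set R\<^esub> (k::nat)) R"
  by (induction k) (simp_all add: oneideal ideal_prod_is_ideal assms)

lemma ideal_pow_Suc_subset:
  assumes "ideal I R" shows "I [^]\<^bsub>ideals_set R\<^esub> Suc k \<subseteq> I"
  using ideal_prod_inter[OF ideal_ideal_pow[OF assms] assms, of k] by auto

lemma pow_in_ideal_pow:
  assumes I: "ideal I R" and a: "a \<in> I"
  shows "a [^] k \<in> I [^]\<^bsub>ideals_set R\<^esub> (k::nat)"
proof (induction k)
  case (Suc k)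
  then show ?case using ideal_prod.prod[OF Suc a, of R] by simp
qed simp

end

context module
begin

lemma adic_gen_carrier:
  "ideal I R \<Longrightarrow> {a \<odot>\<^bsub>M\<^esub> x | a x. a \<in> I [^]\<^bsub>ideals_set R\<^esub> (k::nat) \<and> x \<in> carrier M} \<subseteq> carrier M"
  using ideal.Icarr[OF R.ideal_ideal_pow] by auto

lemma adic_submodule_submodule: "ideal I R \<Longrightarrow> submodule (adic_submodule R I M k) R M"
  unfolding adic_submodule_def by (rule span_submodule[OF adic_gen_carrier])

lemma adic_submodule_0: "ideal I R \<Longrightarrow> adic_submodule R I M 0 = carrier M"
proof
  assume I: "ideal I R"
  show "adic_submodule R I M 0 \<subseteq> carrier M" by (rule submoduleE(1)[OF adic_submodule_submodule[OF I]])
  have "x \<in> {a \<odot>\<^bsub>M\<^esub> x | a x. a \<in> I [^]\<^bsub>ideals_set R\<^esub> (0::nat) \<and> x \<in> carrier M}" if "x \<in> carrier M" for x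
    using that by (auto intro!: exI[of _ "\<one>"] exI[of _ x])
  then show "carrier M \<subseteq> adic_submodule R I M 0"
    unfolding adic_submodule_def using span_incl by blast
qed

lemma smult_in_adic_submodule:
  assumes "a \<in> I [^]\<^bsub>ideals_set R\<^esub> (k::nat)" "x \<in> carrier M"
  shows "a \<odot>\<^bsub>M\<^esub> x \<in> adic_submodule R I M k"
  unfolding adic_submodule_def by (rule subsetD[OF span_incl]) (use assms in blast)

lemma smult_in_adic_submodule_one:
  assumes I: "ideal I R" and a: "a \<in> I" and x: "x \<in> carrier M"
  shows "a \<odot>\<^bsub>M\<^esub> x \<in> adic_submodule R I M 1"
  using R.pow_in_ideal_pow[OF I a, of 1] ideal.Icarr[OF I a] x
  by (intro smult_in_adic_submodule) (auto simp: One_nat_def)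

text \<open>Positive powers of I are contained in I, so testing products with elements of I bounds
  every stage of the filtration but the zeroth, which is M.\<close>

lemma adic_submodule_subset:
  assumes I: "ideal I R" and H: "submodule H R M"
    and IM: "\<And>a x. a \<in> I \<Longrightarrow> x \<in> carrier M \<Longrightarrow> a \<odot>\<^bsub>M\<^esub> x \<in> H"
  shows "adic_submodule R I M (Suc k) \<subseteq> H"
  unfolding adic_submodule_def
  by (rule span_least[OF H]) (use R.ideal_pow_Suc_subset[OF I] IM in blast)

text \<open>Iterating the assumption, \<open>a\<close> acts in the same way as \<open>a\<^bsup>n^k\<^esup>\<close>, which lies in a high power of \<open>I\<close>.\<close>

lemma adic_submodule_stable:
  assumes I: "ideal I R" and n: "n > (1::nat)"
    and frob: "\<And>a x. a \<in> I \<Longrightarrow> x \<in> carrier M \<Longrightarrow> (a [^] n) \<odot>\<^bsub>M\<^esub> x = a \<odot>\<^bsub>M\<^esub> x"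
  shows "adic_submodule R I M (Suc k) = adic_submodule R I M 1"
proof (rule subset_antisym)
  show "adic_submodule R I M (Suc k) \<subseteq> adic_submodule R I M 1"
    by (rule adic_submodule_subset[OF I adic_submodule_submodule[OF I] smult_in_adic_submodule_one[OF I]])
  have "a \<odot>\<^bsub>M\<^esub> x \<in> adic_submodule R I M (Suc k)" if a: "a \<in> I" and x: "x \<in> carrier M" for a x
  proof -
    interpret I: ideal I R by (rule I)
    have ac: "a \<in> carrier R" using a by (rule I.Icarr)
    have pw: "(a [^] (n ^ j)) \<odot>\<^bsub>M\<^esub> x = a \<odot>\<^bsub>M\<^esub> x" for j
    proof (induction j)
      case (Suc j)
      have "a [^] (n ^ j) \<in> I"
      proof -
        obtain m where "n ^ j = Suc m" using n by (cases "n ^ j") auto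
        then show ?thesis using a ac by (simp add: I.I_l_closed)
      qed
      from frob[OF this x] Suc show ?case using ac by (simp add: R.nat_pow_pow mult.commute)
    qed (use ac in \<open>simp add: One_nat_def\<close>)
    \<comment> \<open>Any j with n^j at least k + 1 would do; j = k + 1 works because n is at least
      2.\<close>
    have "Suc k \<le> n ^ Suc k" using self_le_ge2_pow[of n "Suc k"] n by simp
    then obtain l where l: "n ^ Suc k = Suc k + l" using le_Suc_ex by blast
    have "a [^] (n ^ Suc k) = a [^] Suc k \<otimes> a [^] l"
      unfolding l using ac by (simp only: R.nat_pow_mult)
    then have "a [^] (n ^ Suc k) \<in> I [^]\<^bsub>ideals_set R\<^esub> Suc k"
      using ideal.I_r_closed[OF R.ideal_ideal_pow[OF I] R.pow_in_ideal_pow[OF I a]] ac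
      by (simp only: R.nat_pow_closed)
    then show ?thesis using smult_in_adic_submodule[OF _ x] pw[of "Suc k"] by metis
  qed
  then show "adic_submodule R I M 1 \<subseteq> adic_submodule R I M (Suc k)"
    using adic_submodule_subset[OF I adic_submodule_submodule[OF I], of "Suc k" 0] by (simp add: One_nat_def)
qed

text \<open>When the filtration is constant from stage 1 on, a compatible family is determined by
  its entry at 1, and the completion is M/IM. The kernel and image conditions identify this quotient
  with N through h.\<close>

lemma completion_map_iso:
  assumes I: "ideal I R" and N: "module R N" and h: "h \<in> lin_hom R M N"
    and surj: "h ` carrier M = carrier N"
    and ker: "\<And>x. x \<in> carrier M \<Longrightarrow> h x = \<zero>\<^bsub>N\<^esub> \<longleftrightarrow> x \<in> adic_submodule R I M 1"
    and stable: "\<And>k. adic_submodule R I M (Suc k) = adic_submodule R I M 1"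
  shows "completion_map h \<in> lin_iso R (adic_completion R I M) N"
proof -
  let ?S = "adic_submodule R I M"
  let ?C = "adic_completion R I M"
  interpret N: module R N by (rule N)
  note S = adic_submodule_submodule[OF I]
  have Ccarr: "carrier ?C = {Z. (\<forall>k. Z k \<in> carrier (quot_module M (?S k))) \<and>
      (\<forall>k. \<forall>x\<in>Z (Suc k). Z k = ?S k +>\<^bsub>M\<^esub> x)}"
    and Cadd: "\<And>Z Y k. (Z \<oplus>\<^bsub>?C\<^esub> Y) k = Z k \<oplus>\<^bsub>quot_module M (?S k)\<^esub> Y k"
    and Csmult: "\<And>r Z k. (r \<odot>\<^bsub>?C\<^esub> Z) k = r \<odot>\<^bsub>quot_module M (?S k)\<^esub> Z k"
    by (simp_all add: adic_completion_def Let_def)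
  have ker': "h y = \<zero>\<^bsub>N\<^esub>" if "y \<in> ?S 1" for y
    using that ker submoduleE(1)[OF S, of 1] by blast
  note el = the_elem_coset[OF S[of 1] N h ker']
  note hb = quot_lift_hom[OF S[of 1] N h ker']
  have Z1: "Z 1 \<in> carrier (quot_module M (?S 1))" if "Z \<in> carrier ?C" for Z
    using that by (simp add: Ccarr)
  have lin: "completion_map h \<in> lin_hom R ?C N"
    by (rule lin_homI)
      (simp_all add: completion_map_def Cadd Csmult lin_homD[OF hb] Z1)
  \<comment> \<open>A representative at stage 1 represents all stages: later ones by stability and
    induction, stage 0 by compatibility.\<close>
  have coset: "\<exists>x\<in>carrier M. \<forall>k. Z k = ?S k +>\<^bsub>M\<^esub> x" if Z: "Z \<in> carrier ?C" for Z
  proof -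
    obtain x where x: "x \<in> carrier M" "Z 1 = ?S 1 +>\<^bsub>M\<^esub> x"
      using Z1[OF Z] unfolding quot_carrier[OF S] by blast
    have self: "y \<in> ?S k +>\<^bsub>M\<^esub> y" if "y \<in> carrier M" for y k
      using abelian_subgroup.a_rcos_self[OF submodule_abelian_subgroup[OF S] that] .
    have step: "Z k = ?S k +>\<^bsub>M\<^esub> y" if "y \<in> Z (Suc k)" for y k
      using Z that by (simp add: Ccarr)
    have "Z (Suc k) = ?S 1 +>\<^bsub>M\<^esub> x" for k
    proof (induction k)
      case (Suc k)
      obtain y where y: "y \<in> carrier M" "Z (Suc (Suc k)) = ?S (Suc (Suc k)) +>\<^bsub>M\<^esub> y"
        using Z unfolding Ccarr quot_carrier[OF S] by blast
      then have "Z (Suc k) = ?S (Suc k) +>\<^bsub>M\<^esub> y" using self step by blast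
      then show ?case using y(2) Suc by (simp only: stable)
    qed (use x in \<open>simp add: One_nat_def\<close>)
    then have pos: "Z (Suc k) = ?S (Suc k) +>\<^bsub>M\<^esub> x" for k by (simp only: stable)
    then have "Z 0 = ?S 0 +>\<^bsub>M\<^esub> x" using self[OF x(1)] step by blast
    then have "Z k = ?S k +>\<^bsub>M\<^esub> x" for k using pos by (cases k) auto
    then show ?thesis using x(1) by blast
  qed
  have inC: "(\<lambda>k. ?S k +>\<^bsub>M\<^esub> x) \<in> carrier ?C" if x: "x \<in> carrier M" for x
  proof -
    have "?S k +>\<^bsub>M\<^esub> x = ?S k +>\<^bsub>M\<^esub> y" if y: "y \<in> ?S (Suc k) +>\<^bsub>M\<^esub> x" for k y
    proof -
      have yc: "y \<in> carrier M" "?S (Suc k) +>\<^bsub>M\<^esub> y = ?S (Suc k) +>\<^bsub>M\<^esub> x"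
        by (rule coset_memD[OF S y x])+
      show ?thesis
      proof (cases k)
        \<comment> \<open>Stability says nothing about stage 0; there the submodule is all of M and
          any two cosets agree.\<close>
        case 0
        have "x \<ominus>\<^bsub>M\<^esub> y \<in> ?S 0" using x yc(1) by (simp add: adic_submodule_0[OF I])
        then show ?thesis using x yc(1) unfolding 0 by (simp only: coset_eq_iff[OF S])
      next
        case (Suc m)
        then show ?thesis using yc(2) by (simp only: stable)
      qed
    qed
    then show ?thesis using x by (auto simp: Ccarr quot_carrier[OF S])
  qed
  have val: "completion_map h (\<lambda>k. ?S k +>\<^bsub>M\<^esub> x) = h x" if "x \<in> carrier M" for x
    unfolding completion_map_def by (rule el) (use that in auto)
  have "bij_betw (completion_map h) (carrier ?C) (carrier N)"
  proof (rule bij_betwI')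
    fix Z Y assume Z: "Z \<in> carrier ?C" and Y: "Y \<in> carrier ?C"
    obtain x y where x: "x \<in> carrier M" "\<And>k. Z k = ?S k +>\<^bsub>M\<^esub> x" and y: "y \<in> carrier M" "\<And>k. Y k = ?S k +>\<^bsub>M\<^esub> y"
      using coset[OF Z] coset[OF Y] by blast
    have Zx: "Z = (\<lambda>k. ?S k +>\<^bsub>M\<^esub> x)" and Yy: "Y = (\<lambda>k. ?S k +>\<^bsub>M\<^esub> y)" using x(2) y(2) by auto
    have "Z = Y" if "h x = h y"
    proof -
      have xy: "x \<ominus>\<^bsub>M\<^esub> y \<in> carrier M" using x y by simp
      have "h (x \<ominus>\<^bsub>M\<^esub> y) = h y \<ominus>\<^bsub>N\<^esub> h y"
        using lin_hom_minus[OF module_axioms N h x(1) y(1)] that by simp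
      then have "h (x \<ominus>\<^bsub>M\<^esub> y) = \<zero>\<^bsub>N\<^esub>" using lin_hom_closed[OF h y(1)] by (simp add: a_minus_def N.M.r_neg)
      then have d: "x \<ominus>\<^bsub>M\<^esub> y \<in> ?S 1" using ker[OF xy] by simp
      have "x \<ominus>\<^bsub>M\<^esub> y \<in> ?S k" for k
        using d xy by (cases k) (simp_all add: adic_submodule_0[OF I] stable)
      then have "?S k +>\<^bsub>M\<^esub> x = ?S k +>\<^bsub>M\<^esub> y" for k
        unfolding coset_eq_iff[OF S x(1) y(1)] .
      then show ?thesis unfolding Zx Yy by simp
    qed
    then show "completion_map h Z = completion_map h Y \<longleftrightarrow> Z = Y"
      using val[OF x(1), folded Zx] val[OF y(1), folded Yy] by metis
  next
    fix y assume "y \<in> carrier N"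
    then obtain x where "x \<in> carrier M" "y = h x" using surj by blast
    then show "\<exists>Z\<in>carrier ?C. y = completion_map h Z" using inC val by metis
  qed (rule lin_hom_closed[OF lin])
  then show ?thesis using lin by (simp add: lin_iso_def)
qed

end

section \<open>Naturality\<close>

lemma cycles_one_sel [simp]:
  "x \<in> carrier (cycles_one n R) \<longleftrightarrow> x \<in> carrier (U_pos n R 1) \<and> delta_zero n R x = \<zero>\<^bsub>U_zero n R\<^esub>"
  "x \<oplus>\<^bsub>cycles_one n R\<^esub> y = x \<oplus>\<^bsub>U_pos n R 1\<^esub> y"
  "r \<odot>\<^bsub>cycles_one n R\<^esub> x = r \<odot>\<^bsub>U_pos n R 1\<^esub> x"
  by (simp_all add: cycles_one_def)

context ring_hom_cring
begin

lemma module_restrict: "module S M \<Longrightarrow> module R (restrict_scalars h M)"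
  by (rule module_restrict_scalars[OF R.is_cring homh])

text \<open>Elements of B/nu(n) are cosets in a ring. Reading the ring as a module over itself, with
  \<open>nu_ideal\<close> as submodule, makes \<open>the_elem_coset\<close> applicable.\<close>

lemma U_zero_map:
  shows U_zero_map_hom: "U_zero_map n S h \<in> lin_hom R (U_zero n R) (restrict_scalars h (U_zero n S))"
    and U_zero_map_nu_proj: "a \<in> carrier R \<Longrightarrow> U_zero_map n S h (nu_proj n R a) = nu_proj n S (h a)"
proof -
  let ?N = "restrict_scalars h (U_zero n S)" let ?M = "ring_as_module R"
  have N: "module R ?N" by (rule module_restrict[OF S.module_U_zero])
  interpret M: module R ?M by (rule ring_as_module[OF R.is_cring])
  have g: "(\<lambda>b. nu_proj n S (h b)) \<in> lin_hom R ?M ?N"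
    by (rule lin_homI) (simp_all add: S.nu_proj_ring)
  have I: "submodule (nu_ideal n R) R ?M"
  proof -
    interpret I: ideal "nu_ideal n R" R by (rule R.ideal_nu_ideal)
    show ?thesis by (rule M.submoduleI2) (auto simp: I.I_l_closed)
  qed
  have z: "nu_proj n S (h y) = \<zero>\<^bsub>?N\<^esub>" if y: "y \<in> nu_ideal n R" for y
  proof -
    obtain b where b: "b \<in> carrier R" "y = b \<otimes>\<^bsub>R\<^esub> ([nu n] \<cdot>\<^bsub>R\<^esub> \<one>\<^bsub>R\<^esub>)"
      using y by (auto simp: R.nu_ideal_iff)
    then have "h y = h b \<otimes>\<^bsub>S\<^esub> ([nu n] \<cdot>\<^bsub>S\<^esub> \<one>\<^bsub>S\<^esub>)"
      using hom_mult[OF b(1) R.add.nat_pow_closed[OF R.one_closed]] by (simp only: hom_nat_one)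
    then have "h y \<in> nu_ideal n S" using b(1) by (auto simp: S.nu_ideal_iff)
    then show ?thesis using b by (simp add: S.nu_proj_eq_zero_iff)
  qed
  have coset: "nu_ideal n R +>\<^bsub>?M\<^esub> a = nu_proj n R a" for a
    by (simp add: nu_proj_def a_r_coset_def')
  show val: "U_zero_map n S h (nu_proj n R a) = nu_proj n S (h a)" if a: "a \<in> carrier R" for a
    unfolding U_zero_map_def coset[symmetric] by (rule M.the_elem_coset[OF I N g z]) (use a in auto)
  show "U_zero_map n S h \<in> lin_hom R (U_zero n R) ?N"
  proof (rule lin_homI)
    fix x assume "x \<in> carrier (U_zero n R)"
    then obtain a where a: "a \<in> carrier R" "x = nu_proj n R a" using R.nu_proj_image[of n] by auto
    show "U_zero_map n S h x \<in> carrier ?N" using a by (simp add: val S.nu_proj_closed)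
    show "U_zero_map n S h (r \<odot>\<^bsub>U_zero n R\<^esub> x) = r \<odot>\<^bsub>?N\<^esub> U_zero_map n S h x" if "r \<in> carrier R" for r
      using a that val[of "r \<otimes>\<^bsub>R\<^esub> a"] by (simp add: val S.nu_proj_mult R.nu_proj_mult)
    fix y assume "y \<in> carrier (U_zero n R)"
    then obtain b where b: "b \<in> carrier R" "y = nu_proj n R b" using R.nu_proj_image[of n] by auto
    show "U_zero_map n S h (x \<oplus>\<^bsub>U_zero n R\<^esub> y) = U_zero_map n S h x \<oplus>\<^bsub>?N\<^esub> U_zero_map n S h y"
      using a b val[of "a \<oplus>\<^bsub>R\<^esub> b"] by (simp add: val S.nu_proj_add R.nu_proj_add)
  qed
qed

lemma U_pos_map_one:
  shows U_one_map_hom: "U_pos_map n R S h 1 \<in> lin_hom R (U_pos n R 1) (restrict_scalars h (U_pos n S 1))"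
    and U_one_map_c: "a \<in> carrier R \<Longrightarrow> U_pos_map n R S h 1 (c_word n R [a]) = c_word n S [h a]"
proof -
  let ?N = "restrict_scalars h (U_pos n S 1)"
  have N: "module R ?N" by (rule module_restrict[OF S.module_U_pos])
  obtain k where k: "k \<in> lin_hom R (U_pos n R 1) ?N"
    "\<And>b. b \<in> carrier R \<Longrightarrow> k (c_word n R [b]) = c_word n S [h b]"
    using R.U_one_lift[of ?N n "\<lambda>b. c_word n S [h b]", OF N]
    by (auto simp: hom_nat_one S.U_nu_kill S.c_word_one_closed S.c_word_add)
  have eq: "k (c_word n R bs) = c_word n S (map h bs)" if "bs \<in> words R 1" for bs
    using that k(2) unfolding words_one by auto
  note ext = module.lin_ext[OF R.module_U_pos N k(1) R.U_span R.c_word_closed eq, folded U_pos_map_def]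
  show "U_pos_map n R S h 1 \<in> lin_hom R (U_pos n R 1) ?N" by (rule ext(1))
  show "U_pos_map n R S h 1 (c_word n R [a]) = c_word n S [h a]" if "a \<in> carrier R"
    using ext(2)[of "[a]"] that by (simp add: words_one)
qed

lemma delta_zero_natural:
  assumes n: "primepow n" and x: "x \<in> carrier (U_pos n R 1)"
  shows "delta_zero n S (U_pos_map n R S h 1 x) = U_zero_map n S h (delta_zero n R x)"
proof (rule module.lin_hom_eqI[OF R.module_U_pos _ _ _ R.U_span R.c_word_closed _ x])
  show "module R (restrict_scalars h (U_zero n S))" by (rule module_restrict[OF S.module_U_zero])
  show "(\<lambda>x. delta_zero n S (U_pos_map n R S h 1 x)) \<in> lin_hom R (U_pos n R 1) (restrict_scalars h (U_zero n S))"
    by (rule lin_hom_comp[OF U_one_map_hom lin_hom_restrict_scalars[OF homh S.delta_zero_hom[OF n]]])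
  show "(\<lambda>x. U_zero_map n S h (delta_zero n R x)) \<in> lin_hom R (U_pos n R 1) (restrict_scalars h (U_zero n S))"
    by (rule lin_hom_comp[OF R.delta_zero_hom[OF n] U_zero_map_hom])
  fix bs assume "bs \<in> words R 1"
  then obtain b where b: "b \<in> carrier R" "bs = [b]" unfolding words_one by blast
  then show "delta_zero n S (U_pos_map n R S h 1 (c_word n R bs)) =
      U_zero_map n S h (delta_zero n R (c_word n R bs))"
    by (simp add: U_one_map_c S.delta_zero_c[OF n] R.delta_zero_c[OF n] U_zero_map_nu_proj
        a_minus_def hom_nat_power)
qed

text \<open>The image is at first only an R-submodule; surjectivity of h makes it an S-submodule,
  and it contains the generators c_(h a).\<close>

lemma U_one_map_surj:
  assumes surj: "h ` carrier R = carrier S"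
  shows "U_pos_map n R S h 1 ` carrier (U_pos n R 1) = carrier (U_pos n S 1)"
proof -
  let ?N = "restrict_scalars h (U_pos n S 1)" let ?H = "U_pos_map n R S h 1 ` carrier (U_pos n R 1)"
  have N: "module R ?N" by (rule module_restrict[OF S.module_U_pos])
  interpret U: module S "U_pos n S 1" by (rule S.module_U_pos)
  have "submodule ?H R ?N"
    by (rule module.image_submodule[OF R.module_U_pos N U_one_map_hom])
  then have H: "submodule ?H S (U_pos n S 1)"
    by (rule submodule_restrict_scalarsD[OF U.module_axioms surj N])
  have "c_word n S ` words S 1 \<subseteq> ?H"
  proof (rule image_subsetI)
    fix bs assume "bs \<in> words S 1"
    then obtain a where a: "a \<in> carrier R" "bs = [h a]" unfolding words_one surj[symmetric] by blast
    then show "c_word n S bs \<in> ?H" using R.c_word_one_closed[OF a(1), of n] U_one_map_c[OF a(1), of n] by force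
  qed
  from U.span_least[OF H this] show ?thesis
    unfolding S.U_span using U.submoduleE(1)[OF H] by (rule subset_antisym[rotated])
qed

text \<open>Surjectivity in degree one gives equality instead of inclusion: boundaries over S lift
  to boundaries over R, from which the kernel on H_0 is computed.\<close>

lemma boundaries_zero_image:
  assumes n: "primepow n" and surj: "h ` carrier R = carrier S"
  shows "U_zero_map n S h ` boundaries_zero n R = boundaries_zero n S"
  unfolding boundaries_zero_def U_one_map_surj[OF surj, symmetric] image_image
  by (rule image_cong) (simp_all add: delta_zero_natural[OF n])

text \<open>Carries the finiteness needed for the vanishing of H_1 from A over to A/m.\<close>

lemma finite_nu_quot_image:
  assumes surj: "h ` carrier R = carrier S" and fin: "finite (carrier (nu_quot n R))"
  shows "finite (carrier (nu_quot n S))"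
proof -
  have "carrier (nu_quot n S) = U_zero_map n S h ` carrier (nu_quot n R)"
    unfolding S.nu_proj_image[symmetric] R.nu_proj_image[symmetric] surj[symmetric] image_image
    by (rule image_cong) (simp_all add: U_zero_map_nu_proj)
  then show ?thesis using fin by simp
qed

end

section \<open>The homology modules of a single ring\<close>

context cring
begin

lemma boundaries_zero_submodule: "primepow n \<Longrightarrow> submodule (boundaries_zero n R) R (U_zero n R)"
  unfolding boundaries_zero_def
  by (rule module.image_submodule[OF module_U_pos module_U_zero delta_zero_hom])

lemma module_H_zero: "primepow n \<Longrightarrow> module R (H_zero n R)"
  unfolding H_zero_def by (rule module.quot_module[OF module_U_zero boundaries_zero_submodule])

lemma H_zero_carrier:
  "primepow n \<Longrightarrow> carrier (H_zero n R) =
    (\<lambda>a. boundaries_zero n R +>\<^bsub>U_zero n R\<^esub> nu_proj n R a) ` carrier R"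
  using module.quot_carrier[OF module_U_zero boundaries_zero_submodule]
  by (simp add: H_zero_def nu_proj_image[symmetric] image_image)

text \<open>(a - a^n) b is b times the boundary of c_a, so it vanishes in H_0.\<close>

lemma H_zero_smult_pow:
  assumes n: "primepow n" and a: "a \<in> carrier R" and x: "x \<in> carrier (H_zero n R)"
  shows "(a [^] n) \<odot>\<^bsub>H_zero n R\<^esub> x = a \<odot>\<^bsub>H_zero n R\<^esub> x"
proof -
  interpret Z: module R "U_zero n R" by (rule module_U_zero)
  let ?B = "boundaries_zero n R"
  note B = boundaries_zero_submodule[OF n]
  obtain b where b: "b \<in> carrier R" "x = ?B +>\<^bsub>U_zero n R\<^esub> nu_proj n R b"
    using x unfolding H_zero_carrier[OF n] by blast
  have z: "nu_proj n R b \<in> carrier (U_zero n R)" using b by (simp add: nu_proj_closed)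
  have "nu_proj n R (a \<ominus> a [^] n) \<in> ?B"
    unfolding delta_zero_c[OF n a, symmetric] boundaries_zero_def by (intro imageI c_word_one_closed a)
  then have "b \<odot>\<^bsub>U_zero n R\<^esub> nu_proj n R (a \<ominus> a [^] n) \<in> ?B" by (rule Z.submoduleE(4)[OF B b(1)])
  moreover have "b \<odot>\<^bsub>U_zero n R\<^esub> nu_proj n R (a \<ominus> a [^] n) =
      a \<odot>\<^bsub>U_zero n R\<^esub> nu_proj n R b \<ominus>\<^bsub>U_zero n R\<^esub> (a [^] n) \<odot>\<^bsub>U_zero n R\<^esub> nu_proj n R b"
  proof -
    have "b \<otimes> (a \<ominus> a [^] n) = a \<otimes> b \<ominus> a [^] n \<otimes> b"
      using a b(1) nat_pow_closed[OF a, of n] by algebra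
    then have "nu_proj n R (b \<otimes> (a \<ominus> a [^] n)) = nu_proj n R (a \<otimes> b \<ominus> a [^] n \<otimes> b)" by simp
    then show ?thesis using a b(1) by (simp add: nu_proj_mult nu_proj_minus)
  qed
  ultimately have "?B +>\<^bsub>U_zero n R\<^esub> (a \<odot>\<^bsub>U_zero n R\<^esub> nu_proj n R b) =
      ?B +>\<^bsub>U_zero n R\<^esub> ((a [^] n) \<odot>\<^bsub>U_zero n R\<^esub> nu_proj n R b)"
    using a z by (subst Z.coset_eq_iff[OF B]) (auto simp del: U_zero_sel)
  then show ?thesis
    unfolding b(2) H_zero_def using a z by (simp only: Z.quot_smult[OF B] nat_pow_closed)
qed

lemma module_cycles_one:
  assumes n: "primepow n" shows "module R (cycles_one n R)"
proof -
  interpret U: module R "U_pos n R 1" by (rule module_U_pos)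
  interpret Z: module R "U_zero n R" by (rule module_U_zero)
  have "submodule {z \<in> carrier (U_pos n R 1). delta_zero n R z \<in> {\<zero>\<^bsub>U_zero n R\<^esub>}} R (U_pos n R 1)"
    by (rule U.preimage_submodule[OF module_U_zero delta_zero_hom[OF n] Z.zero_submodule])
  from submodule.submodule_is_module[OF this U.module_axioms] show ?thesis
    by (simp add: cycles_one_def)
qed

text \<open>By \<open>cycles_eq_boundaries\<close> the boundaries are the whole carrier of the
  cycles, and the carrier is a submodule of itself.\<close>

lemma boundaries_one_submodule_cycles:
  assumes n: "primepow n" and fin: "finite (carrier (nu_quot n R))"
  shows "submodule (boundaries_one n R) R (cycles_one n R)"
  using module.carrier_is_submodule[OF module_cycles_one[OF n]]
  by (simp only: cycles_eq_boundaries[OF n fin])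

lemma module_H_one:
  assumes n: "primepow n" and fin: "finite (carrier (nu_quot n R))"
  shows "module R (H_one n R)"
  unfolding H_one_def
  by (rule module.quot_module[OF module_cycles_one[OF n] boundaries_one_submodule_cycles[OF n fin]])

lemma H_one_trivial:
  assumes n: "primepow n" and fin: "finite (carrier (nu_quot n R))"
  shows "carrier (H_one n R) = {\<zero>\<^bsub>H_one n R\<^esub>}"
proof -
  interpret C: module R "cycles_one n R" by (rule module_cycles_one[OF n])
  note B = boundaries_one_submodule_cycles[OF n fin]
  note CB = cycles_eq_boundaries[OF n fin]
  interpret H: module R "H_one n R" by (rule module_H_one[OF n fin])
  have "carrier (H_one n R) \<subseteq> {boundaries_one n R}"
    unfolding H_one_def C.quot_carrier[OF B] using C.coset_zero_iff[OF B] CB by auto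
  then show ?thesis using H.M.zero_closed C.quot_zero[OF B] by (auto simp: H_one_def)
qed

end

text \<open>In degree one both H_1(A) and H_1(A/m) are zero, so the kernel computation takes place
  in degree zero.\<close>

theorem theorem2p15:
  fixes n :: nat and A :: "('a, 'x) ring_scheme" and \<mm> :: "'a set"
  assumes "n > 1"
    and "cring A"
    and "\<exists>S. finite S \<and> S \<subseteq> carrier A \<and> generate (add_monoid A) S = carrier A"
    and "maximalideal \<mm> A"
    and "[nu n] \<cdot>\<^bsub>A\<^esub> \<one>\<^bsub>A\<^esub> \<in> \<mm>"
  shows "completion_map (H_zero_map n (A Quot \<mm>) (\<lambda>a. \<mm> +>\<^bsub>A\<^esub> a))
      \<in> lin_iso A (adic_completion A \<mm> (H_zero n A))
          (restrict_scalars (\<lambda>a. \<mm> +>\<^bsub>A\<^esub> a) (H_zero n (A Quot \<mm>))) \<and>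
    completion_map (H_one_map n A (A Quot \<mm>) (\<lambda>a. \<mm> +>\<^bsub>A\<^esub> a))
      \<in> lin_iso A (adic_completion A \<mm> (H_one n A))
          (restrict_scalars (\<lambda>a. \<mm> +>\<^bsub>A\<^esub> a) (H_one n (A Quot \<mm>)))"
proof -
  define f where "f = (\<lambda>a. \<mm> +>\<^bsub>A\<^esub> a)"
  define K where "K = A Quot \<mm>"
  interpret A: cring A by fact
  interpret m: maximalideal \<mm> A by fact
  have I: "ideal \<mm> A" by (rule m.is_ideal)
  interpret K: cring K unfolding K_def by (rule m.quotient_is_cring[OF A.is_cring])
  interpret f: ring_hom_cring A K f
    using m.rcos_ring_hom A.is_cring K.is_cring
    by (simp add: ring_hom_cring_def ring_hom_cring_axioms_def f_def K_def)
  have surj: "f ` carrier A = carrier K"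
    by (auto simp: f_def K_def FactRing_def A_RCOSETS_def')
  have f0: "f a = \<zero>\<^bsub>K\<^esub> \<longleftrightarrow> a \<in> \<mm>" if "a \<in> carrier A" for a
    using that m.a_rcos_const m.a_rcos_self by (auto simp: f_def K_def FactRing_def)
  \<comment> \<open>Otherwise nu(n) = 1 would lie in the proper ideal m.\<close>
  have n: "primepow n"
  proof (rule ccontr)
    assume "\<not> primepow n"
    then have "\<one>\<^bsub>A\<^esub> \<in> \<mm>" using assms(5) by (simp add: nu_def One_nat_def)
    then show False using m.one_imp_carrier m.I_notcarr by blast
  qed
  have "nu n > 0" using primepow_nu(1)[OF n] by (rule prime_gt_0_nat)
  then have finA: "finite (carrier (nu_quot n A))" using A.finite_nu_quot assms(3) by blast
  then have finK: "finite (carrier (nu_quot n K))" by (rule f.finite_nu_quot_image[OF surj])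

  have "completion_map (H_zero_map n K f) \<in> lin_iso A (adic_completion A \<mm> (H_zero n A))
      (restrict_scalars f (H_zero n K))"
  proof -
    let ?M = "H_zero n A" let ?N = "restrict_scalars f (H_zero n K)" let ?h = "H_zero_map n K f"
    let ?BA = "boundaries_zero n A" let ?BK = "boundaries_zero n K"
    let ?Z = "restrict_scalars f (U_zero n K)"
    interpret M: module A ?M by (rule A.module_H_zero[OF n])
    have N: "module A ?N" by (rule f.module_restrict[OF K.module_H_zero[OF n]])
    interpret N: module A ?N by (rule N)
    interpret UA: module A "U_zero n A" by (rule A.module_U_zero)
    interpret UK: module K "U_zero n K" by (rule K.module_U_zero)
    note BA = A.boundaries_zero_submodule[OF n] note BK = K.boundaries_zero_submodule[OF n]
    \<comment> \<open>\<open>quot_map\<close> sees its target only through cosets, which restriction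
      of scalars does not change; so the same map is the quotient map into the restricted
      A-module.\<close>
    have h_eq: "?h = quot_map ?Z ?BK (U_zero_map n K f)"
      by (simp add: H_zero_map_def quot_map_def[abs_def])
    have BB: "U_zero_map n K f y \<in> ?BK" if "y \<in> ?BA" for y
      using that f.boundaries_zero_image[OF n surj] by blast
    note qm = quot_map[OF A.module_U_zero f.module_restrict[OF K.module_U_zero] BA
        submodule_restrict_scalars[OF A.is_cring f.homh K.module_U_zero BK] f.U_zero_map_hom BB,
        folded h_eq, unfolded quot_module_restrict_scalars, folded H_zero_def]
    have h: "?h \<in> lin_hom A ?M ?N" by (rule qm(1))
    have hv: "?h (?BA +>\<^bsub>U_zero n A\<^esub> nu_proj n A a) = ?BK +>\<^bsub>U_zero n K\<^esub> nu_proj n K (f a)"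
      if "a \<in> carrier A" for a
      using qm(2)[of "nu_proj n A a"] that by (simp add: A.nu_proj_closed f.U_zero_map_nu_proj)
    show ?thesis
    proof (rule M.completion_map_iso[OF I N h])
      show "?h ` carrier ?M = carrier ?N"
        unfolding restrict_scalars_sel A.H_zero_carrier[OF n] K.H_zero_carrier[OF n] surj[symmetric] image_image
        by (rule image_cong) (simp_all add: hv)
      show "adic_submodule A \<mm> ?M (Suc k) = adic_submodule A \<mm> ?M 1" for k
        by (rule M.adic_submodule_stable[OF I assms(1)]) (simp add: A.H_zero_smult_pow[OF n] m.Icarr)
      fix x assume x: "x \<in> carrier ?M"
      then obtain a where a: "a \<in> carrier A" "x = ?BA +>\<^bsub>U_zero n A\<^esub> nu_proj n A a"
        unfolding A.H_zero_carrier[OF n] by blast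
      show "?h x = \<zero>\<^bsub>?N\<^esub> \<longleftrightarrow> x \<in> adic_submodule A \<mm> ?M 1"
      proof
        \<comment> \<open>If the class of a dies over K, its image is a boundary over K, which lifts
          to a boundary y over A with representative b. Then f a = f b, so a - b lies in m, while x
          is also the class of a - b.\<close>
        assume "?h x = \<zero>\<^bsub>?N\<^esub>"
        then have "?BK +>\<^bsub>U_zero n K\<^esub> nu_proj n K (f a) = ?BK"
          using a hv by (simp add: H_zero_def UK.quot_zero[OF BK])
        then have "nu_proj n K (f a) \<in> ?BK"
          using a UK.coset_zero_iff[OF BK, of "nu_proj n K (f a)"] by (simp add: K.nu_proj_closed)
        then obtain y where y: "y \<in> ?BA" "nu_proj n K (f a) = U_zero_map n K f y"
          unfolding f.boundaries_zero_image[OF n surj, symmetric] by blast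
        obtain b where b: "b \<in> carrier A" "y = nu_proj n A b"
          using subsetD[OF UA.submoduleE(1)[OF BA] y(1)]
          unfolding U_zero_sel A.nu_proj_image[symmetric] by blast
        have "nu_proj n K (f a) = nu_proj n K (f b)" using y(2) b by (simp add: f.U_zero_map_nu_proj)
        then have "f a \<ominus>\<^bsub>K\<^esub> f b \<in> nu_ideal n K" using a b by (simp add: K.nu_proj_eq_iff)
        \<comment> \<open>As nu(n) lies in m, it is zero in K; so is \<open>nu_ideal n K\<close>,
          and congruence becomes equality.\<close>
        moreover have "[nu n] \<cdot>\<^bsub>K\<^esub> \<one>\<^bsub>K\<^esub> = \<zero>\<^bsub>K\<^esub>"
          using f0[of "[nu n] \<cdot>\<^bsub>A\<^esub> \<one>\<^bsub>A\<^esub>"] assms(5) by (simp add: f.hom_nat_one)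
        ultimately have "f (a \<ominus>\<^bsub>A\<^esub> b) = \<zero>\<^bsub>K\<^esub>"
          using a b by (auto simp: K.nu_ideal_iff a_minus_def)
        then have ab: "a \<ominus>\<^bsub>A\<^esub> b \<in> \<mm>" using f0 a b by simp
        have one: "?BA +>\<^bsub>U_zero n A\<^esub> nu_proj n A \<one>\<^bsub>A\<^esub> \<in> carrier ?M"
          unfolding A.H_zero_carrier[OF n] by blast
        have "x = ?BA +>\<^bsub>U_zero n A\<^esub> nu_proj n A (a \<ominus>\<^bsub>A\<^esub> b)"
        proof -
          interpret Q: cring "nu_quot n A" by (rule A.cring_nu_quot)
          have "nu_proj n A a \<ominus>\<^bsub>U_zero n A\<^esub> nu_proj n A (a \<ominus>\<^bsub>A\<^esub> b) = y"
          proof -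
            have "a \<ominus>\<^bsub>A\<^esub> (a \<ominus>\<^bsub>A\<^esub> b) = b" using a b by algebra
            then show ?thesis using a(1) b by (simp add: A.nu_proj_minus[symmetric])
          qed
          then show ?thesis
            unfolding a(2) using a(1) b y(1) UA.coset_eq_iff[OF BA] by (simp add: A.nu_proj_closed)
        qed
        \<comment> \<open>The class of a - b is a - b times the class of 1, hence an element of m
          H_0.\<close>
        also have "\<dots> = (a \<ominus>\<^bsub>A\<^esub> b) \<odot>\<^bsub>?M\<^esub> (?BA +>\<^bsub>U_zero n A\<^esub> nu_proj n A \<one>\<^bsub>A\<^esub>)"
        proof -
          have "(a \<ominus>\<^bsub>A\<^esub> b) \<odot>\<^bsub>U_zero n A\<^esub> nu_proj n A \<one>\<^bsub>A\<^esub> = nu_proj n A (a \<ominus>\<^bsub>A\<^esub> b)"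
            using a(1) b A.nu_proj_mult[of "a \<ominus>\<^bsub>A\<^esub> b" "\<one>\<^bsub>A\<^esub>" n] by simp
          then show ?thesis
            unfolding H_zero_def using a(1) b UA.quot_smult[OF BA, of "a \<ominus>\<^bsub>A\<^esub> b" "nu_proj n A \<one>\<^bsub>A\<^esub>"]
            by (simp add: A.nu_proj_closed)
        qed
        finally show "x \<in> adic_submodule A \<mm> ?M 1"
          using M.smult_in_adic_submodule_one[OF I ab one] by simp
      next
        assume x1: "x \<in> adic_submodule A \<mm> ?M 1"
        have "adic_submodule A \<mm> ?M (Suc 0) \<subseteq> {x \<in> carrier ?M. ?h x \<in> {\<zero>\<^bsub>?N\<^esub>}}"
        proof (rule M.adic_submodule_subset[OF I M.preimage_submodule[OF N h N.zero_submodule]])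
          fix a x assume a: "a \<in> \<mm>" and x: "x \<in> carrier ?M"
          interpret HK: module K "H_zero n K" by (rule K.module_H_zero[OF n])
          have "?h (a \<odot>\<^bsub>?M\<^esub> x) = f a \<odot>\<^bsub>H_zero n K\<^esub> ?h x"
            using lin_hom_smult[OF h m.Icarr[OF a] x] by simp
          also have "f a = \<zero>\<^bsub>K\<^esub>" using f0 a m.Icarr by simp
          finally show "a \<odot>\<^bsub>?M\<^esub> x \<in> {x \<in> carrier ?M. ?h x \<in> {\<zero>\<^bsub>?N\<^esub>}}"
            using lin_hom_closed[OF h x] a m.Icarr x by simp
        qed
        then show "?h x = \<zero>\<^bsub>?N\<^esub>" using x1 by (auto simp: One_nat_def)
      qed
    qed
  qed
  moreover have "completion_map (H_one_map n A K f) \<in> lin_iso A (adic_completion A \<mm> (H_one n A))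
      (restrict_scalars f (H_one n K))"
  proof -
    let ?M = "H_one n A" let ?N = "restrict_scalars f (H_one n K)" let ?h = "H_one_map n A K f"
    let ?C = "restrict_scalars f (cycles_one n K)"
    interpret M: module A ?M by (rule A.module_H_one[OF n finA])
    have N: "module A ?N" by (rule f.module_restrict[OF K.module_H_one[OF n finK]])
    note CA = A.module_cycles_one[OF n] note CK = K.module_cycles_one[OF n]
    note BA = A.boundaries_one_submodule_cycles[OF n finA] note BK = K.boundaries_one_submodule_cycles[OF n finK]
    have h_eq: "?h = quot_map ?C (boundaries_one n K) (U_pos_map n A K f 1)"
      by (simp add: H_one_map_def quot_map_def[abs_def])
    \<comment> \<open>Naturality of the differential sends cycles to cycles, so the chain map
      restricts to the modules whose quotients are H_1.\<close>
    have U: "U_pos_map n A K f 1 \<in> lin_hom A (cycles_one n A) ?C"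
    proof (rule lin_homI)
      fix x assume "x \<in> carrier (cycles_one n A)"
      then have x: "x \<in> carrier (U_pos n A 1)" "delta_zero n A x = \<zero>\<^bsub>U_zero n A\<^esub>"
        by simp_all
      have "delta_zero n K (U_pos_map n A K f 1 x) = \<zero>\<^bsub>U_zero n K\<^esub>"
        using f.delta_zero_natural[OF n x(1)] x(2)
          lin_hom_zero[OF A.module_U_zero f.module_restrict[OF K.module_U_zero] f.U_zero_map_hom, of n]
        by simp
      then show "U_pos_map n A K f 1 x \<in> carrier ?C"
        using lin_hom_closed[OF f.U_one_map_hom x(1)] by simp
    qed (use lin_homD[OF f.U_one_map_hom[of n]] in simp_all)
    have BB: "U_pos_map n A K f 1 y \<in> boundaries_one n K" if "y \<in> boundaries_one n A" for y
      using lin_hom_closed[OF U, of y] that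
      unfolding restrict_scalars_sel A.cycles_eq_boundaries[OF n finA] K.cycles_eq_boundaries[OF n finK] .
    have h: "?h \<in> lin_hom A ?M ?N"
      using quot_map(1)[OF CA f.module_restrict[OF CK] BA
          submodule_restrict_scalars[OF A.is_cring f.homh CK BK] U BB]
      by (simp only: h_eq quot_module_restrict_scalars H_one_def)
    have Mc: "carrier ?M = {\<zero>\<^bsub>?M\<^esub>}" by (rule A.H_one_trivial[OF n finA])
    \<comment> \<open>The zero module has only one submodule, so the filtration is constant and the
      conditions on kernel and stability are immediate.\<close>
    have S: "adic_submodule A \<mm> ?M k = carrier ?M" for k
      using M.submoduleE(1)[OF M.adic_submodule_submodule[OF I, of k]]
        M.submodule_zero[OF M.adic_submodule_submodule[OF I, of k]] Mc by auto
    show ?thesis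
      by (rule M.completion_map_iso[OF I N h])
        (use lin_hom_zero[OF M.module_axioms N h] in \<open>simp_all add: S Mc K.H_one_trivial[OF n finK]\<close>)
  qed
  ultimately show ?thesis unfolding f_def K_def by (rule conjI)
qed

end
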